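(* Let $(u_0,v_0)\in L^2(\Omega)\times L^2(\Omega)$ and $0<T<+\infty$. Suppose that $f:\mathbb{R}\to\mathbb{R}$ satisfies $|f(s)-f(t)|\le M_1|s-t|$ for all $s,t\in\mathbb{R}$, that $a:\mathbb{R}\to\mathbb{R}$ satisfies $|a(s)-a(t)|\le M_2|s-t|$ for all $s,t\in\mathbb{R}$ and $a(\xi)\ge m>0$ for all $\xi\in\mathbb{R}$, and that $l:L^2(\Omega)\to\mathbb{R}$ is a continuous linear form. Then there exists a solution $(u,v)$ of $$u_t-a(l(u))\,\Delta u=-f(u-v)+\alpha(u-v)\quad\text{in }\Omega\times(0,T),$$ $$v_t-a(l(v))\,\Delta v=f(u-v)-\alpha(u-v)\quad\text{in }\Omega\times(0,T),$$ $$u=v=0\ \text{on }\partial\Omega\times(0,T),\qquad u(x,0)=u_0(x),\ v(x,0)=v_0(x)\ \text{in }\Omega,$$ such that $$(u,v)\in\bigl[L^2(0,T;H_0^1(\Omega))\cap C([0,T);L^2(\Omega))\bigr]\times\bigl[L^2(0,T;H_0^1(\Omega))\cap C([0,T);L^2(\Omega))\bigr],$$ $$(u_t,v_t)\in L^2(0,T;H^{-1}(\Omega))\times L^2(0,T;H^{-1}(\Omega)),$$ $$\frac{d}{dt}(u,h_1)+a(l(u))\int_\Omega\nabla u\cdot\nabla h_1\,dx=-\int_\Omega f(u-v)\,h_1\,dx+\int_\Omega\alpha(u-v)\,h_1\,dx$$ for all $h_1\in H_0^1(\Omega)$, as an equality in $\mathcal{D}'(0,T)$, and $$\frac{d}{dt}(v,h_2)+a(l(v))\int_\Omega\nabla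 v\cdot\nabla h_2\,dx=\int_\Omega f(u-v)\,h_2\,dx-\int_\Omega\alpha(u-v)\,h_2\,dx$$ for all $h_2\in H_0^1(\Omega)$, as an equality in $\mathcal{D}'(0,T)$.
   Context: $\Omega\subset\mathbb{R}^n$ is a bounded domain with boundary $\partial\Omega$ of class $C^2$; $\alpha>0$, $M_1>0$, $M_2>0$, $m>0$ are constants; $u=u(x,t)$, $v=v(x,t)$ are real valued. $l(u)$ denotes the function $t\mapsto l(u(\cdot,t))$. $(\cdot,\cdot)$ denotes the inner product of $L^2(\Omega)$. The differential equations and boundary conditions are understood in the weak sense given by the two displayed variational identities and membership in $H_0^1(\Omega)$; the initial conditions are understood in $L^2(\Omega)$, using continuity in time. *)

theory Defs
  imports "HOL-Analysis.Analysis"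
begin

text \<open>
  Elements of a function space are represented by functions, not by equivalence classes:
  two representatives are the same element when the seminorm of their difference vanishes
  (for \<open>L\<^sup>2\<close> and \<open>H\<^sup>1\<close> this is equality almost everywhere in \<open>\<Omega>\<close>; for the dual space
  \<open>H\<^sup>-\<^sup>1\<close> it is equality on \<open>H\<^sub>0\<^sup>1\<close>). Values of a representative outside \<open>\<Omega>\<close>
  play no role.
\<close>

primrec C_k :: "nat \<Rightarrow> ('a::euclidean_space \<Rightarrow> real) \<Rightarrow> bool" where
  "C_k 0 f \<longleftrightarrow> continuous_on UNIV f"
| "C_k (Suc k) f \<longleftrightarrow>
     (\<forall>x. f differentiable (at x)) \<and> (\<forall>h. C_k k (\<lambda>x. frechet_derivative f (at x) h))"

definition test_functions :: "'a::euclidean_space set \<Rightarrow> ('a \<Rightarrow> real) set" where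
  "test_functions \<Omega> =
     {\<phi>. (\<forall>k. C_k k \<phi>) \<and> compact (closure {x. \<phi> x \<noteq> 0}) \<and> closure {x. \<phi> x \<noteq> 0} \<subseteq> \<Omega>}"

text \<open>
  Near each boundary point, \<open>\<Omega>\<close> is the region above the graph of a \<open>C\<^sup>2\<close> function in suitable
  orthonormal coordinates, the last axis of which is \<open>\<nu>\<close>. The function \<open>\<gamma>\<close> is evaluated only on
  the hyperplane orthogonal to \<open>\<nu>\<close>; being given on the whole space is no restriction, since
  a function on the hyperplane can be composed with the orthogonal projection.
\<close>
definition C2_boundary :: "'a::euclidean_space set \<Rightarrow> bool" where
  "C2_boundary \<Omega> \<longleftrightarrow>
     (\<forall>p\<in>frontier \<Omega>. \<exists>r>0. \<exists>\<nu> \<gamma>. norm \<nu> = 1 \<and> C_k 2 \<gamma> \<and>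
        \<Omega> \<inter> ball p r = {x \<in> ball p r. \<gamma> (x - (x \<bullet> \<nu>) *\<^sub>R \<nu>) < x \<bullet> \<nu>})"

definition L2 :: "'a::euclidean_space set \<Rightarrow> ('a \<Rightarrow> 'b::euclidean_space) set" where
  "L2 \<Omega> = {u. u \<in> borel_measurable (lebesgue_on \<Omega>) \<and>
              integrable (lebesgue_on \<Omega>) (\<lambda>x. (norm (u x))\<^sup>2)}"

definition L2_inner ::
  "'a::euclidean_space set \<Rightarrow> ('a \<Rightarrow> 'b::euclidean_space) \<Rightarrow> ('a \<Rightarrow> 'b) \<Rightarrow> real" where
  "L2_inner \<Omega> u v = (LINT x|lebesgue_on \<Omega>. u x \<bullet> v x)"

definition L2_norm :: "'a::euclidean_space set \<Rightarrow> ('a \<Rightarrow> 'b::euclidean_space) \<Rightarrow> real" where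
  "L2_norm \<Omega> u = sqrt (L2_inner \<Omega> u u)"

definition weak_gradient :: "'a::euclidean_space set \<Rightarrow> ('a \<Rightarrow> real) \<Rightarrow> ('a \<Rightarrow> 'a) \<Rightarrow> bool" where
  "weak_gradient \<Omega> u g \<longleftrightarrow>
     (\<forall>\<phi>\<in>test_functions \<Omega>. \<forall>b\<in>Basis.
        (LINT x|lebesgue_on \<Omega>. u x * frechet_derivative \<phi> (at x) b) =
        - (LINT x|lebesgue_on \<Omega>. (g x \<bullet> b) * \<phi> x))"

definition H1 :: "'a::euclidean_space set \<Rightarrow> ('a \<Rightarrow> real) set" where
  "H1 \<Omega> = {u \<in> L2 \<Omega>. \<exists>g\<in>L2 \<Omega>. weak_gradient \<Omega> u g}"

text \<open>The weak gradient is unique up to a null set, so the choice is immaterial.\<close>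
definition grad :: "'a::euclidean_space set \<Rightarrow> ('a \<Rightarrow> real) \<Rightarrow> 'a \<Rightarrow> 'a" where
  "grad \<Omega> u = (SOME g. g \<in> L2 \<Omega> \<and> weak_gradient \<Omega> u g)"

definition H1_norm :: "'a::euclidean_space set \<Rightarrow> ('a \<Rightarrow> real) \<Rightarrow> real" where
  "H1_norm \<Omega> u = sqrt ((L2_norm \<Omega> u)\<^sup>2 + (L2_norm \<Omega> (grad \<Omega> u))\<^sup>2)"

definition H10 :: "'a::euclidean_space set \<Rightarrow> ('a \<Rightarrow> real) set" where
  "H10 \<Omega> = {u \<in> H1 \<Omega>. \<exists>\<phi>. (\<forall>k. \<phi> k \<in> test_functions \<Omega>) \<and>
               (\<lambda>k::nat. H1_norm \<Omega> (\<lambda>x. \<phi> k x - u x)) \<longlonglongrightarrow> 0}"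

text \<open>
  In the following definitions \<open>X\<close> is a linear space of real functions with seminorm \<open>N\<close>.
  A continuous linear form takes equal values on representatives at distance zero,
  so it is a form on the quotient space.
\<close>
definition continuous_linear_form ::
  "('s \<Rightarrow> real) set \<Rightarrow> (('s \<Rightarrow> real) \<Rightarrow> real) \<Rightarrow> (('s \<Rightarrow> real) \<Rightarrow> real) \<Rightarrow> bool" where
  "continuous_linear_form X N l \<longleftrightarrow>
     (\<forall>u\<in>X. \<forall>v\<in>X. l (\<lambda>x. u x + v x) = l u + l v) \<and>
     (\<forall>c. \<forall>u\<in>X. l (\<lambda>x. c * u x) = c * l u) \<and>
     (\<forall>u\<in>X. \<forall>\<epsilon>>0. \<exists>\<delta>>0. \<forall>v\<in>X. N (\<lambda>x. v x - u x) < \<delta> \<longrightarrow> \<bar>l v - l u\<bar> < \<epsilon>)"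

definition Hm1 :: "'a::euclidean_space set \<Rightarrow> (('a \<Rightarrow> real) \<Rightarrow> real) set" where
  "Hm1 \<Omega> = {F. continuous_linear_form (H10 \<Omega>) (H1_norm \<Omega>) F}"

definition Hm1_norm :: "'a::euclidean_space set \<Rightarrow> (('a \<Rightarrow> real) \<Rightarrow> real) \<Rightarrow> real" where
  "Hm1_norm \<Omega> F = Sup {\<bar>F h\<bar> | h. h \<in> H10 \<Omega> \<and> H1_norm \<Omega> h \<le> 1}"

text \<open>Bochner measurability: almost everywhere limit, in \<open>N\<close>, of \<open>X\<close>-valued simple functions.\<close>
definition strongly_measurable ::
  "real set \<Rightarrow> ('s \<Rightarrow> real) set \<Rightarrow> (('s \<Rightarrow> real) \<Rightarrow> real) \<Rightarrow> (real \<Rightarrow> 's \<Rightarrow> real) \<Rightarrow> bool" where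
  "strongly_measurable I X N u \<longleftrightarrow>
     (\<exists>\<sigma>. (\<forall>k::nat. simple_function (lebesgue_on I) (\<sigma> k) \<and> \<sigma> k ` I \<subseteq> X) \<and>
          (AE t in lebesgue_on I. (\<lambda>k. N (\<lambda>x. \<sigma> k t x - u t x)) \<longlonglongrightarrow> 0))"

definition Bochner_L2 ::
  "real set \<Rightarrow> ('s \<Rightarrow> real) set \<Rightarrow> (('s \<Rightarrow> real) \<Rightarrow> real) \<Rightarrow> (real \<Rightarrow> 's \<Rightarrow> real) set" where
  "Bochner_L2 I X N =
     {u. (AE t in lebesgue_on I. u t \<in> X) \<and> strongly_measurable I X N u \<and>
         integrable (lebesgue_on I) (\<lambda>t. (N (u t))\<^sup>2)}"

definition continuous_into ::
  "real set \<Rightarrow> ('s \<Rightarrow> real) set \<Rightarrow> (('s \<Rightarrow> real) \<Rightarrow> real) \<Rightarrow> (real \<Rightarrow> 's \<Rightarrow> real) set" where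
  "continuous_into I X N =
     {u. \<forall>t\<in>I. u t \<in> X \<and> ((\<lambda>s. N (\<lambda>x. u s x - u t x)) \<longlongrightarrow> 0) (at t within I)}"

text \<open>
  Distributions on an open interval \<open>I\<close>, as functionals on \<open>test_functions I\<close>:
  the one given by a locally integrable function, and the derivative.
\<close>
definition regular_distr :: "real set \<Rightarrow> (real \<Rightarrow> real) \<Rightarrow> (real \<Rightarrow> real) \<Rightarrow> real" where
  "regular_distr I w \<phi> = (LINT t|lebesgue_on I. w t * \<phi> t)"

definition distr_deriv :: "((real \<Rightarrow> real) \<Rightarrow> real) \<Rightarrow> (real \<Rightarrow> real) \<Rightarrow> real" where
  "distr_deriv D \<phi> = - D (deriv \<phi>)"

text \<open>
  \<open>g\<close> is the derivative of \<open>u\<close> in the \<open>H\<^sup>-\<^sup>1\<close>-valued distributions on \<open>I\<close>, where \<open>L\<^sup>2\<close> is embedded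
  in \<open>H\<^sup>-\<^sup>1\<close> by \<open>w \<mapsto> (w, \<cdot>)\<close>, i.e. \<open>\<integral> u \<phi>' dt = - \<integral> g \<phi> dt\<close>. An identity in \<open>H\<^sup>-\<^sup>1\<close> is an identity of
  functionals on \<open>H\<^sub>0\<^sup>1\<close>, and Bochner integrals in \<open>H\<^sup>-\<^sup>1\<close> are evaluated under the integral sign.
\<close>
definition weak_time_deriv ::
  "real set \<Rightarrow> 'a::euclidean_space set \<Rightarrow> (real \<Rightarrow> 'a \<Rightarrow> real) \<Rightarrow>
   (real \<Rightarrow> ('a \<Rightarrow> real) \<Rightarrow> real) \<Rightarrow> bool" where
  "weak_time_deriv I \<Omega> u g \<longleftrightarrow>
     (\<forall>\<phi>\<in>test_functions I. \<forall>h\<in>H10 \<Omega>.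
        (LINT t|lebesgue_on I. L2_inner \<Omega> (u t) h * deriv \<phi> t) =
        - (LINT t|lebesgue_on I. g t h * \<phi> t))"

end

theory Submission imports Defs begin

text \<open>
  The solution is obtained as a strong limit of solutions of ordinary differential equations in the
  Hilbert space of square integrable functions; no compactness is used. The diffusion coefficient
  \<open>a (l u)\<close> depends on the state through one real number and is Lipschitz, which is what makes the
  approximations converge strongly.

  The operator \<open>- \<Delta>\<close> with Dirichlet condition is replaced by its Yosida approximation
  \<open>A \<epsilon> = (1 - J \<epsilon>) / \<epsilon>\<close> with resolvent \<open>J \<epsilon> = (1 - \<epsilon>\<Delta>)\<^sup>-\<^sup>1\<close>, a bounded symmetric nonnegative
  operator. The approximate system \<open>u' = - a (l u) A \<epsilon> u + N (u - v)\<close>,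
  \<open>v' = - a (l v) A \<epsilon> v - N (u - v)\<close> is an ordinary differential equation, solvable on the whole
  interval (\<open>yosida_exists\<close>). Three estimates carry the proof. Testing with \<open>u\<close> and \<open>v\<close> bounds the
  states and the space-time integral of the squared gradients, uniformly in \<open>\<epsilon>\<close>. Testing with
  \<open>A \<epsilon> u\<close> and \<open>A \<epsilon> v\<close> bounds the space-time integral of \<open>\<parallel>A \<epsilon> u\<parallel>\<^sup>2 + \<parallel>A \<epsilon> v\<parallel>\<^sup>2\<close> by the gradients
  of the initial values (\<open>yosida_A_bound\<close>). Testing the difference of two approximate systems with
  the difference \<open>w\<close> of their solutions produces, besides the monotone main part, the term
  \<open>\<bar>a (l u\<^sub>1) - a (l u\<^sub>2)\<bar> \<parallel>\<nabla>u\<^sub>2\<parallel> \<parallel>\<nabla>w\<parallel>\<close>, which is at most half of the dissipation plus a constant times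
  \<open>\<parallel>\<nabla>u\<^sub>2\<parallel>\<^sup>2 \<parallel>w\<parallel>\<^sup>2\<close>. The factor \<open>\<parallel>\<nabla>u\<^sub>2\<parallel>\<^sup>2\<close> is integrable in time, so Gronwall's inequality applies
  (\<open>yosida_difference\<close>), with an error of the order of \<open>\<epsilon>\<close> times the quantity from the second
  estimate.

  The initial values are only square integrable. They are approximated by values \<open>x\<^sub>k\<close> that have
  gradients, and then \<open>\<epsilon>\<^sub>k\<close> is chosen small against these gradients, so that consecutive
  approximations differ by \<open>O(8\<^sup>-\<^sup>k)\<close> (\<open>weak_solution_exists\<close>). The states converge uniformly in time
  and the gradients almost everywhere in time with a square integrable majorant, hence every term of
  the equation passes to the limit.

  The abstract argument knows the Sobolev space only as a closed subspace \<open>G\<close> of pairs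
  \<open>(u, \<nabla>u)\<close>. For the concrete spaces this subspace is the closure of the test functions with their
  classical gradients. Its elements are exactly the functions in \<open>H\<^sub>0\<^sup>1\<close> with their weak gradients
  (\<open>gradient_graph_H10\<close>, \<open>H10_gradient_graph\<close>), because weak gradients are unique by the fundamental
  lemma of the calculus of variations. Strong measurability in time holds because the solution
  is a limit of continuous functions, which are limits of step functions (\<open>Bochner_L2_limit\<close>).
\<close>

section \<open>Projection and resolvent\<close>

text \<open>
  A point of least distance exists by completeness, and at such a point the residual is
  orthogonal to the subspace because moving along any direction of the subspace cannot decrease
  the distance.
\<close>
lemma closed_subspace_projection:
  fixes S :: "'h::{real_inner,banach} set"
  assumes S: "subspace S" and cl: "closed S"
  shows "\<exists>p\<in>S. \<forall>s\<in>S. (x - p) \<bullet> s = 0"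
proof -
  define d where "d = Inf ((\<lambda>s. (norm (x - s))\<^sup>2) ` S)"
  have ne: "S \<noteq> {}" using subspace_0[OF S] by auto
  have bdd: "bdd_below ((\<lambda>s. (norm (x - s))\<^sup>2) ` S)"
    by (rule bdd_belowI[of _ 0]) auto
  have d_le: "d \<le> (norm (x - s))\<^sup>2" if "s \<in> S" for s
    unfolding d_def using that bdd by (intro cInf_lower) auto
  have "\<exists>s\<in>S. (norm (x - s))\<^sup>2 < d + 1 / real (Suc n)" for n
  proof -
    have "d < d + 1 / real (Suc n)" by simp
    then have "\<exists>r\<in>(\<lambda>s. (norm (x - s))\<^sup>2) ` S. r < d + 1 / real (Suc n)"
      unfolding d_def using ne by (intro cInf_lessD) auto
    then show ?thesis by auto
  qed
  then obtain s where sS: "\<And>n. s n \<in> S" and s: "\<And>n. (norm (x - s n))\<^sup>2 < d + 1 / real (Suc n)"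
    by metis
  \<comment> \<open>The parallelogram law at the midpoint, which lies in the subspace, makes a minimising sequence Cauchy.\<close>
  have par: "(norm (s i - s j))\<^sup>2 \<le> 2 / real (Suc i) + 2 / real (Suc j)" for i j
  proof -
    have mid: "(1/2) *\<^sub>R (s i + s j) \<in> S"
      using S sS by (simp add: subspace_add subspace_scale)
    have "(norm (s i - s j))\<^sup>2 =
        2 * (norm (x - s i))\<^sup>2 + 2 * (norm (x - s j))\<^sup>2 - 4 * (norm (x - (1/2) *\<^sub>R (s i + s j)))\<^sup>2"
      unfolding power2_norm_eq_inner
      by (simp add: inner_diff_left inner_diff_right inner_add_left inner_add_right inner_commute field_simps)
    also have "\<dots> \<le> 2 * (d + 1 / real (Suc i)) + 2 * (d + 1 / real (Suc j)) - 4 * d"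
      using s[of i] s[of j] d_le[OF mid] by (intro diff_mono add_mono mult_left_mono) auto
    finally show ?thesis by simp
  qed
  have "Cauchy s"
  proof (rule metric_CauchyI)
    fix e :: real assume e: "e > 0"
    obtain M :: nat where M: "4 / e\<^sup>2 < real M" using reals_Archimedean2 by blast
    show "\<exists>M. \<forall>m\<ge>M. \<forall>n\<ge>M. dist (s m) (s n) < e"
    proof (intro exI allI impI)
      fix m n assume mn: "M \<le> m" "M \<le> n"
      have M0: "real M > 0" using M e by (smt (verit) divide_nonneg_nonneg zero_le_power2)
      have "2 / real (Suc m) \<le> 2 / real M" "2 / real (Suc n) \<le> 2 / real M"
        using mn M0 by (auto intro!: divide_left_mono)
      then have "(norm (s m - s n))\<^sup>2 \<le> 4 / real M" using par[of m n] by simp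
      also have "\<dots> < e\<^sup>2" using M M0 e by (simp add: field_simps)
      finally show "dist (s m) (s n) < e"
        using e by (simp add: dist_norm power2_less_imp_less)
    qed
  qed
  then obtain p where p: "s \<longlonglongrightarrow> p" by (meson Cauchy_convergent convergent_def)
  have pS: "p \<in> S" using cl sS p closed_sequentially by blast
  have pd: "(norm (x - p))\<^sup>2 \<le> d"
  proof (rule LIMSEQ_le)
    show "(\<lambda>n. (norm (x - s n))\<^sup>2) \<longlonglongrightarrow> (norm (x - p))\<^sup>2" by (intro tendsto_intros p)
    show "(\<lambda>n. d + 1 / real (Suc n)) \<longlonglongrightarrow> d"
      using LIMSEQ_inverse_real_of_nat_add[of d] by (simp add: divide_inverse)
  qed (use s less_imp_le in auto)
  have "(x - p) \<bullet> t = 0" if t: "t \<in> S" for t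
  proof (cases "t = 0")
    case False
    define c where "c = (x - p) \<bullet> t / (t \<bullet> t)"
    have tt: "t \<bullet> t > 0" using False by simp
    have "p + c *\<^sub>R t \<in> S" using S pS t by (simp add: subspace_add subspace_scale)
    then have "(norm (x - p))\<^sup>2 \<le> (norm (x - (p + c *\<^sub>R t)))\<^sup>2" using d_le pd order_trans by blast
    also have "\<dots> = (norm (x - p))\<^sup>2 - 2 * c * ((x - p) \<bullet> t) + c\<^sup>2 * (t \<bullet> t)"
      unfolding power2_norm_eq_inner
      by (simp add: inner_diff_left inner_diff_right inner_add_left inner_add_right inner_commute
          algebra_simps power2_eq_square)
    also have "\<dots> = (norm (x - p))\<^sup>2 - ((x - p) \<bullet> t)\<^sup>2 / (t \<bullet> t)"
      using tt unfolding c_def by (simp add: field_simps power2_eq_square)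
    finally have "((x - p) \<bullet> t)\<^sup>2 / (t \<bullet> t) \<le> 0" by simp
    then show ?thesis using tt by (simp add: divide_le_0_iff)
  qed simp
  then show ?thesis using pS by blast
qed

text \<open>
  If \<open>G\<close> is the graph of an operator \<open>D\<close>, the point \<open>x\<close> found here solves
  \<open>x + \<epsilon> D\<^sup>* D x = u\<close> in the weak sense, with \<open>y = D x\<close>. The formulation through the graph
  needs only a closed subspace of pairs.
\<close>
lemma resolvent_exists:
  fixes G :: "('h::{real_inner,banach} \<times> 'k::{real_inner,banach}) set"
  assumes G: "subspace G" "closed G" and e: "\<epsilon> > 0"
  shows "\<exists>x y. (x, y) \<in> G \<and> (\<forall>(p, q) \<in> G. (u - x) \<bullet> p = \<epsilon> * (y \<bullet> q))"
proof -
  \<comment> \<open>Rescaling the second component by the root of the parameter turns the weighted equation into orthogonality to a closed subspace.\<close>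
  define c where "c = sqrt \<epsilon>"
  have c: "c > 0" "c * c = \<epsilon>" using e by (auto simp: c_def)
  define S where "S = {z :: 'h \<times> 'k. (fst z, (1/c) *\<^sub>R snd z) \<in> G}"
  define \<phi> where "\<phi> = (\<lambda>z :: 'h \<times> 'k. (fst z, (1/c) *\<^sub>R snd z))"
  have S_alt: "S = \<phi> -` G" by (auto simp: S_def \<phi>_def)
  have "linear \<phi>"
    by (rule linearI) (auto simp: \<phi>_def scaleR_add_right)
  then have "subspace S" unfolding S_alt by (rule linear_subspace_vimage[OF _ G(1)])
  moreover have "closed S"
    unfolding S_alt \<phi>_def by (intro closed_vimage G(2) continuous_intros)
  ultimately obtain r where r: "r \<in> S" "\<forall>s\<in>S. ((u, 0) - r) \<bullet> s = 0"
    using closed_subspace_projection by blast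
  have "(u - fst r) \<bullet> p = \<epsilon> * (((1/c) *\<^sub>R snd r) \<bullet> q)" if "(p, q) \<in> G" for p q
  proof -
    have "(p, c *\<^sub>R q) \<in> S" using that c by (simp add: S_def)
    then have "((u, 0) - r) \<bullet> (p, c *\<^sub>R q) = 0" using r by blast
    then have "(u - fst r) \<bullet> p = c * (snd r \<bullet> q)"
      by (simp add: inner_prod_def)
    also have "\<dots> = \<epsilon> * (((1/c) *\<^sub>R snd r) \<bullet> q)" using c by (simp add: field_simps flip: c(2))
    finally show ?thesis .
  qed
  then show ?thesis using r(1) unfolding S_def by blast
qed

section \<open>Global solutions of ordinary differential equations\<close>

text \<open>
  A fixed point of the integral operator in an exponentially weighted supremum norm; the weight
  gives the solution on the whole interval at once, with no patching of short intervals.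
\<close>
lemma picard_lindeloef_global:
  fixes \<Phi> :: "'x::banach \<Rightarrow> 'x"
  assumes lip: "\<And>x y. norm (\<Phi> x - \<Phi> y) \<le> L * norm (x - y)" and T: "0 \<le> T"
  shows "\<exists>X. X 0 = x0 \<and>
    (\<forall>t\<in>{0..T}. (X has_vector_derivative \<Phi> (X t)) (at t within {0..T}))"
proof -
  define K where "K = max L 1"
  have K: "K > 0" and lipK: "norm (\<Phi> x - \<Phi> y) \<le> K * norm (x - y)" for x y
    using lip[of x y] order_trans[OF lip[of x y] mult_right_mono[of L K "norm (x - y)"]]
    by (auto simp: K_def)
  have cont\<Phi>: "continuous_on UNIV \<Phi>"
    using lipschitz_on_continuous_on[of K UNIV \<Phi>] lipK K
    by (auto simp: lipschitz_on_def dist_norm)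
  define cl where "cl = (\<lambda>t::real. max 0 (min T t))"
  have cl: "cl t \<in> {0..T}" for t using T by (auto simp: cl_def)
  have cl_id: "cl t = t" if "t \<in> {0..T}" for t using that by (auto simp: cl_def)
  have contcl: "continuous_on UNIV cl" unfolding cl_def by (intro continuous_intros)
  define h where "h = (\<lambda>(w::real \<Rightarrow>\<^sub>C 'x) s. \<Phi> (exp (2*K * s) *\<^sub>R apply_bcontfun w s))"
  have conth: "continuous_on A (h w)" for w A
    unfolding h_def
    by (intro continuous_on_compose2[OF cont\<Phi>] continuous_intros continuous_on_apply_bcontfun) auto
  have inth: "h w integrable_on {0..t}" for w t
    by (intro integrable_continuous_interval conth)
  \<comment> \<open>The weight makes the integral operator a contraction with factor one half on an interval of any length; freezing the time argument outside the interval gives bounded functions on the whole line.\<close>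
  define P where "P = (\<lambda>w t. exp (- 2*K*cl t) *\<^sub>R (x0 + integral {0..cl t} (h w)))"
  have contI: "continuous_on {0..T} (\<lambda>t. integral {0..t} (h w))" for w
    by (rule indefinite_integral_continuous_1[OF inth])
  have contP: "continuous_on UNIV (P w)" for w
    unfolding P_def
    using cl by (intro continuous_intros continuous_on_compose2[OF contI contcl] contcl) auto
  have rangeP: "range (P w) \<subseteq> P w ` {0..T}" for w
    using cl_id[OF cl] by (auto simp: P_def intro!: image_eqI[where x="cl _"] cl)
  have "bounded (P w ` {0..T})" for w
    by (intro compact_imp_bounded compact_continuous_image continuous_on_subset[OF contP]) auto
  then have "bounded (range (P w))" for w
    by (rule bounded_subset[OF _ rangeP])
  then have "P w \<in> bcontfun" for w
    using contP by (auto simp: bcontfun_def)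
  then have app: "apply_bcontfun (Bcontfun (P w)) = P w" for w
    by (simp add: Bcontfun_inverse)
  have "\<exists>!w. Bcontfun (P w) = w"
  proof (rule banach_fix_type[of "1/2"]; (intro allI)?)
    fix w z :: "real \<Rightarrow>\<^sub>C 'x"
    show "dist (Bcontfun (P w)) (Bcontfun (P z)) \<le> 1/2 * dist w z"
    proof (rule dist_bound)
      fix t
      define \<tau> where "\<tau> = cl t"
      have \<tau>: "0 \<le> \<tau>" using cl by (auto simp: \<tau>_def)
      define D where "D = dist w z"
      have D: "norm (apply_bcontfun w s - apply_bcontfun z s) \<le> D" for s
        using dist_bounded[of w s z] by (simp add: D_def dist_norm)
      have expint: "((\<lambda>s. K * exp (2*K * s) * D) has_integral (exp (2*K*\<tau>) * D / 2 - exp (2*K*0) * D / 2)) {0..\<tau>}"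
        by (rule fundamental_theorem_of_calculus[OF \<tau>])
          (auto intro!: derivative_eq_intros simp: has_real_derivative_iff_has_vector_derivative[symmetric])
      have "norm (integral {0..\<tau>} (\<lambda>s. h w s - h z s)) \<le> integral {0..\<tau>} (\<lambda>s. K * exp (2*K * s) * D)"
      proof (rule integral_norm_bound_integral)
        show "(\<lambda>s. h w s - h z s) integrable_on {0..\<tau>}" by (intro integrable_diff inth)
        show "(\<lambda>s. K * exp (2*K * s) * D) integrable_on {0..\<tau>}" using expint by blast
        fix s
        have "norm (h w s - h z s) \<le> K * norm (exp (2*K * s) *\<^sub>R (apply_bcontfun w s - apply_bcontfun z s))"
          unfolding h_def using lipK by (simp add: scaleR_diff_right)
        also have "\<dots> \<le> K * (exp (2*K * s) * D)" using D K by (auto intro!: mult_left_mono)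
        finally show "norm (h w s - h z s) \<le> K * exp (2*K * s) * D" by simp
      qed
      also have "\<dots> = exp (2*K*\<tau>) * D / 2 - D / 2" using integral_unique[OF expint] by simp
      finally have *: "norm (integral {0..\<tau>} (h w) - integral {0..\<tau>} (h z)) \<le> exp (2*K*\<tau>) * D / 2 - D / 2"
        by (simp add: integral_diff inth)
      have D0: "D \<ge> 0" by (simp add: D_def)
      have "dist (P w t) (P z t) = exp (- 2*K*\<tau>) * norm (integral {0..\<tau>} (h w) - integral {0..\<tau>} (h z))"
        by (simp add: P_def \<tau>_def dist_norm flip: scaleR_diff_right)
      also have "\<dots> \<le> exp (- 2*K*\<tau>) * (exp (2*K*\<tau>) * D / 2)"
        using * D0 by (intro mult_left_mono) auto
      also have "\<dots> = 1/2 * D" by (simp add: exp_minus)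
      finally show "dist (apply_bcontfun (Bcontfun (P w)) t) (apply_bcontfun (Bcontfun (P z)) t) \<le> 1/2 * dist w z"
        unfolding app D_def .
    qed
  qed auto
  then obtain w where "Bcontfun (P w) = w" by blast
  then have w: "apply_bcontfun w t = P w t" for t using app by metis
  define X where "X = (\<lambda>t. exp (2*K*t) *\<^sub>R apply_bcontfun w t)"
  have h_eq: "h w s = \<Phi> (X s)" for s by (simp add: h_def X_def)
  have X_eq: "X t = x0 + integral {0..t} (h w)" if "t \<in> {0..T}" for t
    using that by (simp add: X_def w P_def cl_id exp_minus)
  have "(X has_vector_derivative \<Phi> (X t)) (at t within {0..T})" if t: "t \<in> {0..T}" for t
  proof (rule has_vector_derivative_transform[OF t X_eq])
    show "((\<lambda>t. x0 + integral {0..t} (h w)) has_vector_derivative \<Phi> (X t)) (at t within {0..T})"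
      using integral_has_vector_derivative[OF conth t, of w] h_eq
      by (auto intro!: derivative_eq_intros)
  qed 
  moreover have "X 0 = x0" using X_eq[of 0] T by simp
  ultimately show ?thesis by blast
qed

section \<open>Differential inequalities\<close>

lemma within_deriv_nonpos_imp_nonincreasing:
  fixes F :: "real \<Rightarrow> real"
  assumes F: "\<And>t. t \<in> {0..T} \<Longrightarrow> (F has_real_derivative F' t) (at t within {0..T})"
    and le: "\<And>t. t \<in> {0..T} \<Longrightarrow> F' t \<le> 0" and t: "t \<in> {0..T}"
  shows "F t \<le> F 0"
proof (cases "t = 0")
  case False
  then have t0: "0 < t" using t by auto
  have "(F has_derivative (\<lambda>h. F' s * h)) (at s within {0..t})" if "s \<in> {0..t}" for s
    using F[of s] that t has_field_derivative_subset[of F "F' s" s "{0..T}" "{0..t}"]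
    by (auto simp: has_field_derivative_def)
  then obtain s where s: "s \<in> {0<..<t}" "F t - F 0 = F' s * (t - 0)"
    using mvt_simple[OF t0, of F "\<lambda>s h. F' s * h"] by (auto simp: set_eq_iff)
  moreover have "F' s * t \<le> 0" using le[of s] s t t0 by (auto intro!: mult_nonpos_nonneg)
  ultimately show ?thesis by simp
qed simp

lemma gronwall_differential:
  fixes E E' g r :: "real \<Rightarrow> real"
  assumes T: "0 \<le> T"
    and E: "\<And>t. t \<in> {0..T} \<Longrightarrow> (E has_real_derivative E' t) (at t within {0..T})"
    and g: "continuous_on {0..T} g" "\<And>t. t \<in> {0..T} \<Longrightarrow> 0 \<le> g t"
    and r: "continuous_on {0..T} r" "\<And>t. t \<in> {0..T} \<Longrightarrow> 0 \<le> r t"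
    and le: "\<And>t. t \<in> {0..T} \<Longrightarrow> E' t \<le> g t * E t + r t"
    and t: "t \<in> {0..T}" and E0: "0 \<le> E 0"
  shows "E t \<le> exp (integral {0..T} g) * (E 0 + integral {0..T} r)"
proof -
  define \<Gamma> where "\<Gamma> = (\<lambda>t. integral {0..t} g)"
  define R where "R = (\<lambda>t. integral {0..t} r)"
  have d\<Gamma>: "(\<Gamma> has_real_derivative g s) (at s within {0..T})" if "s \<in> {0..T}" for s
    unfolding \<Gamma>_def has_real_derivative_iff_has_vector_derivative
    by (rule integral_has_vector_derivative[OF g(1) that])
  have dR: "(R has_real_derivative r s) (at s within {0..T})" if "s \<in> {0..T}" for s
    unfolding R_def has_real_derivative_iff_has_vector_derivative
    by (rule integral_has_vector_derivative[OF r(1) that])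
  have ing: "g integrable_on {0..s}" "r integrable_on {0..s}" if "s \<in> {0..T}" for s
    using that by (auto intro!: integrable_continuous_interval continuous_on_subset[OF g(1)] continuous_on_subset[OF r(1)])
  have \<Gamma>0: "\<Gamma> s \<ge> 0" if "s \<in> {0..T}" for s
    unfolding \<Gamma>_def using that g(2) by (intro integral_nonneg ing) auto
  have \<Gamma>T: "\<Gamma> s \<le> \<Gamma> T" "R s \<le> R T" if "s \<in> {0..T}" for s
    unfolding \<Gamma>_def R_def using that T
    by (auto intro!: g(2) r(2) integral_subset_le[of _ _ g] integral_subset_le[of _ _ r] ing)
  \<comment> \<open>Since \<open>exp (- \<Gamma>) \<le> 1\<close> and the forcing is nonnegative, this quantity does not increase.\<close>
  define F where "F = (\<lambda>t. exp (- \<Gamma> t) * E t - R t)"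
  have dF: "(F has_real_derivative (- g s * exp (- \<Gamma> s) * E s + exp (- \<Gamma> s) * E' s - r s)) (at s within {0..T})"
    if "s \<in> {0..T}" for s
    unfolding F_def using d\<Gamma>[OF that] dR[OF that] E[OF that]
    by (auto intro!: derivative_eq_intros)
  have "F t \<le> F 0"
  proof (rule within_deriv_nonpos_imp_nonincreasing[OF dF _ t])
    fix s assume s: "s \<in> {0..T}"
    have "exp (- \<Gamma> s) * E' s \<le> exp (- \<Gamma> s) * (g s * E s + r s)"
      by (intro mult_left_mono le s) auto
    also have "\<dots> \<le> g s * exp (- \<Gamma> s) * E s + r s"
      using \<Gamma>0[OF s] r(2)[OF s] mult_right_mono[of "exp (- \<Gamma> s)" 1 "r s"] by (simp add: algebra_simps)
    finally show "- g s * exp (- \<Gamma> s) * E s + exp (- \<Gamma> s) * E' s - r s \<le> 0" by simp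
  qed
  then have "exp (- \<Gamma> t) * E t \<le> E 0 + R t" by (simp add: F_def \<Gamma>_def R_def)
  then have "E t \<le> exp (\<Gamma> t) * (E 0 + R t)"
    by (simp add: exp_minus field_simps)
  also have "\<dots> \<le> exp (\<Gamma> T) * (E 0 + R T)"
  proof (rule mult_mono)
    have "0 \<le> R t" unfolding R_def using t by (intro integral_nonneg ing r(2)) auto
    then show "0 \<le> E 0 + R t" using E0 by simp
  qed (use \<Gamma>T[OF t] in auto)
  finally show ?thesis by (simp add: \<Gamma>_def R_def)
qed

text \<open>
  The integrated form of an energy inequality, used to bound the dissipated quantity \<open>h\<close>.
\<close>
lemma dissipation_integral:
  fixes E E' h r :: "real \<Rightarrow> real"
  assumes T: "0 \<le> T"
    and E: "\<And>t. t \<in> {0..T} \<Longrightarrow> (E has_real_derivative E' t) (at t within {0..T})"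
    and h: "continuous_on {0..T} h" and r: "continuous_on {0..T} r"
    and le: "\<And>t. t \<in> {0..T} \<Longrightarrow> E' t + h t \<le> r t"
  shows "E T + integral {0..T} h \<le> E 0 + integral {0..T} r"
proof -
  have d: "((\<lambda>t. integral {0..t} f) has_real_derivative f s) (at s within {0..T})"
    if "s \<in> {0..T}" "continuous_on {0..T} f" for s f
    unfolding has_real_derivative_iff_has_vector_derivative
    by (rule integral_has_vector_derivative[OF that(2,1)])
  have "E T + integral {0..T} h - integral {0..T} r \<le> E 0 + integral {0..0} h - integral {0..0} r"
  proof (rule within_deriv_nonpos_imp_nonincreasing[where F'="\<lambda>t. E' t + h t - r t" and T=T])
    fix t assume t: "t \<in> {0..T}"
    show "((\<lambda>t. E t + integral {0..t} h - integral {0..t} r) has_real_derivative E' t + h t - r t) (at t within {0..T})"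
      by (intro DERIV_diff DERIV_add E d h r t)
    show "E' t + h t - r t \<le> 0" using le[OF t] by simp
  qed (use T in auto)
  then show ?thesis by simp
qed

lemma inner_has_real_derivative:
  assumes "(f has_vector_derivative f') (at t within S)" "(g has_vector_derivative g') (at t within S)"
  shows "((\<lambda>t. f t \<bullet> g t) has_real_derivative (f t \<bullet> g' + f' \<bullet> g t)) (at t within S)"
  unfolding has_real_derivative_iff_has_vector_derivative
  by (rule bounded_bilinear.has_vector_derivative[OF bounded_bilinear_inner assms])

section \<open>Lipschitz truncation\<close>

lemma lipschitz_scaleR:
  fixes F :: "'x::real_normed_vector \<Rightarrow> 'y::real_normed_vector" and b :: "'x \<Rightarrow> real"
  assumes b: "\<And>x. \<bar>b x\<bar> \<le> B" "\<And>x y. \<bar>b x - b y\<bar> \<le> Lb * norm (x - y)"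
    and F: "\<And>x. norm (F x) \<le> C" "\<And>x y. norm (F x - F y) \<le> LF * norm (x - y)"
  shows "norm (b x *\<^sub>R F x - b y *\<^sub>R F y) \<le> (B * LF + Lb * C) * norm (x - y)"
proof -
  have "b x *\<^sub>R F x - b y *\<^sub>R F y = b x *\<^sub>R (F x - F y) + (b x - b y) *\<^sub>R F y"
    by (simp add: algebra_simps)
  then have "norm (b x *\<^sub>R F x - b y *\<^sub>R F y) \<le> \<bar>b x\<bar> * norm (F x - F y) + \<bar>b x - b y\<bar> * norm (F y)"
    by (metis norm_scaleR norm_triangle_ineq real_norm_def)
  also have "\<dots> \<le> B * (LF * norm (x - y)) + (Lb * norm (x - y)) * C"
    by (intro add_mono mult_mono b F) (use b(1)[of x] order_trans[OF abs_ge_zero b(2)] in auto)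
  finally show ?thesis by (simp add: algebra_simps)
qed

definition radial_retraction :: "real \<Rightarrow> 'h::real_normed_vector \<Rightarrow> 'h" where
  "radial_retraction R u = (R / max R (norm u)) *\<^sub>R u"

lemma radial_retraction_norm: "R > 0 \<Longrightarrow> norm (radial_retraction R u) \<le> R"
  by (auto simp: radial_retraction_def field_simps max_def)

lemma radial_retraction_id: "R > 0 \<Longrightarrow> norm u \<le> R \<Longrightarrow> radial_retraction R u = u"
  by (simp add: radial_retraction_def max_absorb1)

text \<open>
  In a general normed space the retraction onto a ball is not nonexpansive, but the constant two
  suffices.
\<close>
lemma radial_retraction_lipschitz:
  assumes R: "R > 0"
  shows "norm (radial_retraction R u - radial_retraction R w) \<le> 2 * norm (u - w)"
proof -
  define p where "p = max R (norm u)"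
  define q where "q = max R (norm w)"
  have pq: "p > 0" "q > 0" "R \<le> p" "norm w \<le> q" using R by (auto simp: p_def q_def)
  have "radial_retraction R u - radial_retraction R w = (R/p) *\<^sub>R (u - w) + (R/p - R/q) *\<^sub>R w"
    by (simp add: radial_retraction_def p_def q_def algebra_simps)
  then have "norm (radial_retraction R u - radial_retraction R w) \<le> \<bar>R/p\<bar> * norm (u - w) + \<bar>R/p - R/q\<bar> * norm w"
    by (metis norm_scaleR norm_triangle_ineq)
  moreover have "\<bar>R/p\<bar> * norm (u - w) \<le> 1 * norm (u - w)"
    using pq R by (intro mult_right_mono) auto
  moreover have "\<bar>R/p - R/q\<bar> * norm w \<le> norm (u - w)"
  proof -
    have "R/p - R/q = (R/p) * ((q - p) / q)" using pq by (simp add: field_simps)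
    then have "\<bar>R/p - R/q\<bar> * norm w = (R/p) * \<bar>q - p\<bar> * (norm w / q)"
      using pq R by (simp add: abs_mult)
    also have "\<dots> \<le> 1 * \<bar>q - p\<bar> * 1"
      using pq R by (intro mult_mono) auto
    also have "\<bar>q - p\<bar> \<le> norm (u - w)"
      using norm_triangle_ineq3[of u w] by (auto simp: p_def q_def max_def abs_if split: if_splits)
    finally show ?thesis by simp
  qed
  ultimately show ?thesis by simp
qed

section \<open>The Yosida approximation of a graph operator\<close>

text \<open>
  The set \<open>G\<close> stands for the graph of the weak gradient, with values in a second Hilbert space.
  Treating the pairs \<open>(u, \<nabla>u)\<close> as elements of a closed subspace makes the Sobolev space a Hilbert
  space and keeps the abstract part free of function spaces.
\<close>
locale closed_graph =
  fixes G :: "('h::{real_inner,banach} \<times> 'k::{real_inner,banach}) set"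
  assumes subspace_G: "subspace G" and closed_G: "closed G"
begin

definition resolvent :: "real \<Rightarrow> 'h \<Rightarrow> 'h \<times> 'k" where
  "resolvent \<epsilon> u = (SOME z. z \<in> G \<and> (\<forall>(p, q) \<in> G. (u - fst z) \<bullet> p = \<epsilon> * (snd z \<bullet> q)))"

text \<open>
  \<open>J \<epsilon>\<close> is the resolvent \<open>(1 - \<epsilon>\<Delta>)\<^sup>-\<^sup>1\<close>, \<open>Y \<epsilon> u\<close> is the gradient of \<open>J \<epsilon> u\<close>, and \<open>A \<epsilon>\<close> is the
  Yosida approximation of \<open>- \<Delta>\<close>, a bounded operator.
\<close>
definition J :: "real \<Rightarrow> 'h \<Rightarrow> 'h" where "J \<epsilon> u = fst (resolvent \<epsilon> u)"
definition Y :: "real \<Rightarrow> 'h \<Rightarrow> 'k" where "Y \<epsilon> u = snd (resolvent \<epsilon> u)"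
definition A :: "real \<Rightarrow> 'h \<Rightarrow> 'h" where "A \<epsilon> u = (1/\<epsilon>) *\<^sub>R (u - J \<epsilon> u)"

lemma resolvent_spec:
  assumes "\<epsilon> > 0"
  shows "(J \<epsilon> u, Y \<epsilon> u) \<in> G" and "(p, q) \<in> G \<Longrightarrow> (u - J \<epsilon> u) \<bullet> p = \<epsilon> * (Y \<epsilon> u \<bullet> q)"
proof -
  have "resolvent \<epsilon> u \<in> G \<and> (\<forall>(p, q) \<in> G. (u - fst (resolvent \<epsilon> u)) \<bullet> p = \<epsilon> * (snd (resolvent \<epsilon> u) \<bullet> q))"
    unfolding resolvent_def
    by (rule someI_ex) (use resolvent_exists[OF subspace_G closed_G assms, of u] in force)
  then show "(J \<epsilon> u, Y \<epsilon> u) \<in> G" "(p, q) \<in> G \<Longrightarrow> (u - J \<epsilon> u) \<bullet> p = \<epsilon> * (Y \<epsilon> u \<bullet> q)"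
    by (auto simp: J_def Y_def)
qed

lemma G_add: "(p, q) \<in> G \<Longrightarrow> (p', q') \<in> G \<Longrightarrow> (p + p', q + q') \<in> G"
  using subspace_add[OF subspace_G, of "(p, q)" "(p', q')"] by simp
lemma G_diff: "(p, q) \<in> G \<Longrightarrow> (p', q') \<in> G \<Longrightarrow> (p - p', q - q') \<in> G"
  using subspace_diff[OF subspace_G, of "(p, q)" "(p', q')"] by simp
lemma G_scale: "(p, q) \<in> G \<Longrightarrow> (c *\<^sub>R p, c *\<^sub>R q) \<in> G"
  using subspace_scale[OF subspace_G, of "(p, q)" c] by simp

context
  fixes \<epsilon> :: real
  assumes \<epsilon>: "\<epsilon> > 0"
begin

text \<open>
  The difference of two solutions is an admissible test pair, and testing with it gives a sum of
  squares equal to zero.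
\<close>
lemma resolvent_unique:
  assumes xy: "(x, y) \<in> G" and *: "\<And>p q. (p, q) \<in> G \<Longrightarrow> (u - x) \<bullet> p = \<epsilon> * (y \<bullet> q)"
  shows "J \<epsilon> u = x" "Y \<epsilon> u = y"
proof -
  define d where "d = J \<epsilon> u - x"
  define e where "e = Y \<epsilon> u - y"
  have de: "(d, e) \<in> G" unfolding d_def e_def by (intro G_diff resolvent_spec \<epsilon> xy)
  have "- (d \<bullet> d) = (u - J \<epsilon> u) \<bullet> d - (u - x) \<bullet> d"
    by (simp add: d_def inner_diff_left)
  also have "\<dots> = \<epsilon> * (e \<bullet> e)"
    unfolding resolvent_spec(2)[OF \<epsilon> de] *[OF de] by (simp add: e_def inner_diff_left algebra_simps)
  finally have "\<epsilon> * (e \<bullet> e) + d \<bullet> d = 0" by simp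
  then have "d \<bullet> d = 0" "\<epsilon> * (e \<bullet> e) = 0"
    using \<epsilon> by (metis add_nonneg_eq_0_iff inner_ge_zero less_imp_le mult_nonneg_nonneg)+
  then show "J \<epsilon> u = x" "Y \<epsilon> u = y" using \<epsilon> by (auto simp: d_def e_def)
qed

lemma linear_resolvent: "linear (J \<epsilon>)" "linear (Y \<epsilon>)"
proof -
  have add: "J \<epsilon> (u + w) = J \<epsilon> u + J \<epsilon> w \<and> Y \<epsilon> (u + w) = Y \<epsilon> u + Y \<epsilon> w" for u w
  proof (intro conjI; rule resolvent_unique)
    show "(J \<epsilon> u + J \<epsilon> w, Y \<epsilon> u + Y \<epsilon> w) \<in> G" by (intro G_add resolvent_spec \<epsilon>)
    then show "(J \<epsilon> u + J \<epsilon> w, Y \<epsilon> u + Y \<epsilon> w) \<in> G" .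
    fix p q assume pq: "(p, q) \<in> G"
    show "(u + w - (J \<epsilon> u + J \<epsilon> w)) \<bullet> p = \<epsilon> * ((Y \<epsilon> u + Y \<epsilon> w) \<bullet> q)"
      using resolvent_spec(2)[OF \<epsilon> pq, of u] resolvent_spec(2)[OF \<epsilon> pq, of w]
      by (simp add: algebra_simps inner_add_left inner_diff_left)
    then show "(u + w - (J \<epsilon> u + J \<epsilon> w)) \<bullet> p = \<epsilon> * ((Y \<epsilon> u + Y \<epsilon> w) \<bullet> q)" .
  qed
  have scale: "J \<epsilon> (c *\<^sub>R u) = c *\<^sub>R J \<epsilon> u \<and> Y \<epsilon> (c *\<^sub>R u) = c *\<^sub>R Y \<epsilon> u" for u c
  proof (intro conjI; rule resolvent_unique)
    show "(c *\<^sub>R J \<epsilon> u, c *\<^sub>R Y \<epsilon> u) \<in> G" by (intro G_scale resolvent_spec \<epsilon>)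
    then show "(c *\<^sub>R J \<epsilon> u, c *\<^sub>R Y \<epsilon> u) \<in> G" .
    fix p q assume pq: "(p, q) \<in> G"
    show "(c *\<^sub>R u - c *\<^sub>R J \<epsilon> u) \<bullet> p = \<epsilon> * ((c *\<^sub>R Y \<epsilon> u) \<bullet> q)"
      using resolvent_spec(2)[OF \<epsilon> pq, of u] by (simp flip: scaleR_diff_right)
    then show "(c *\<^sub>R u - c *\<^sub>R J \<epsilon> u) \<bullet> p = \<epsilon> * ((c *\<^sub>R Y \<epsilon> u) \<bullet> q)" .
  qed
  show "linear (J \<epsilon>)" "linear (Y \<epsilon>)" using add scale by (auto intro!: linearI)
qed

lemma J_eq: "J \<epsilon> u = u - \<epsilon> *\<^sub>R A \<epsilon> u"
  using \<epsilon> by (simp add: A_def)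

lemma A_weak: "(p, q) \<in> G \<Longrightarrow> A \<epsilon> u \<bullet> p = Y \<epsilon> u \<bullet> q"
  using resolvent_spec(2)[OF \<epsilon>, of p q u] \<epsilon> by (simp add: A_def)

text \<open>
  The key identity: testing the weak equation with \<open>J \<epsilon> w = w - \<epsilon> A \<epsilon> w\<close> displays the form of
  \<open>A \<epsilon>\<close> as a sum of two symmetric nonnegative forms. Symmetry, positivity and boundedness follow
  from it.
\<close>
lemma A_inner: "A \<epsilon> u \<bullet> w = Y \<epsilon> u \<bullet> Y \<epsilon> w + \<epsilon> * (A \<epsilon> u \<bullet> A \<epsilon> w)"
  using A_weak[OF resolvent_spec(1)[OF \<epsilon>], of u w] by (simp add: J_eq inner_diff_right)

lemma A_symmetric: "A \<epsilon> u \<bullet> w = A \<epsilon> w \<bullet> u"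
  unfolding A_inner[of u w] A_inner[of w u] by (simp add: inner_commute)

lemma A_self: "A \<epsilon> u \<bullet> u = (norm (Y \<epsilon> u))\<^sup>2 + \<epsilon> * (norm (A \<epsilon> u))\<^sup>2"
  unfolding A_inner[of u u] by (simp add: power2_norm_eq_inner)

lemma A_nonneg: "0 \<le> A \<epsilon> u \<bullet> u"
  unfolding A_self using \<epsilon> by simp

lemma A_norm: "norm (A \<epsilon> u) \<le> (1/\<epsilon>) * norm u"
proof -
  have "\<epsilon> * (norm (A \<epsilon> u))\<^sup>2 \<le> A \<epsilon> u \<bullet> u" unfolding A_self by simp
  also have "\<dots> \<le> norm (A \<epsilon> u) * norm u" by (rule norm_cauchy_schwarz)
  finally have "norm (A \<epsilon> u) * (\<epsilon> * norm (A \<epsilon> u)) \<le> norm (A \<epsilon> u) * norm u"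
    by (simp add: power2_eq_square algebra_simps)
  then have "\<epsilon> * norm (A \<epsilon> u) \<le> norm u" if "norm (A \<epsilon> u) > 0"
    using that by (simp only: mult_le_cancel_left_pos)
  then show ?thesis using \<epsilon> by (cases "norm (A \<epsilon> u) > 0") (auto simp: field_simps)
qed

lemma Y_norm: "norm (Y \<epsilon> u) \<le> sqrt (1/\<epsilon>) * norm u"
proof -
  have "(norm (Y \<epsilon> u))\<^sup>2 \<le> A \<epsilon> u \<bullet> u" unfolding A_self using \<epsilon> by simp
  also have "\<dots> \<le> norm (A \<epsilon> u) * norm u" by (rule norm_cauchy_schwarz)
  also have "\<dots> \<le> (1/\<epsilon>) * norm u * norm u" by (intro mult_right_mono A_norm) auto
  also have "\<dots> = (sqrt (1/\<epsilon>) * norm u)\<^sup>2" using \<epsilon> by (simp add: power_mult_distrib power2_eq_square[of "norm u"])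
  finally show ?thesis by (rule power2_le_imp_le) (use \<epsilon> in auto)
qed

lemma bounded_linear_A: "bounded_linear (A \<epsilon>)"
proof (rule bounded_linear_intro[where K="1/\<epsilon>"])
  show "A \<epsilon> (u + w) = A \<epsilon> u + A \<epsilon> w" for u w
    using linear_resolvent(1) by (simp add: A_def linear_add algebra_simps)
  show "A \<epsilon> (c *\<^sub>R u) = c *\<^sub>R A \<epsilon> u" for c u
    using linear_resolvent(1) by (simp add: A_def linear_scale algebra_simps)
  show "norm (A \<epsilon> u) \<le> norm u * (1/\<epsilon>)" for u using A_norm[of u] by (simp add: mult.commute)
qed

lemma bounded_linear_Y: "bounded_linear (Y \<epsilon>)"
proof (rule bounded_linear_intro[where K="sqrt (1/\<epsilon>)"])
  show "Y \<epsilon> (u + w) = Y \<epsilon> u + Y \<epsilon> w" for u w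
    using linear_resolvent(2) by (simp add: linear_add)
  show "Y \<epsilon> (c *\<^sub>R u) = c *\<^sub>R Y \<epsilon> u" for c u
    using linear_resolvent(2) by (simp add: linear_scale)
  show "norm (Y \<epsilon> u) \<le> norm u * sqrt (1/\<epsilon>)" for u using Y_norm[of u] by (simp add: mult.commute)
qed

text \<open>
  On elements that have a gradient the approximate energy stays bounded as \<open>\<epsilon> \<longlonglongrightarrow> 0\<close>. This is
  where regularity of the initial value enters.
\<close>
lemma A_energy_le: 
  assumes "(x, g) \<in> G" shows "A \<epsilon> x \<bullet> x \<le> (norm g)\<^sup>2"
proof -
  have "A \<epsilon> x \<bullet> x = Y \<epsilon> x \<bullet> g" by (rule A_weak[OF assms])
  also have "\<dots> \<le> norm (Y \<epsilon> x) * norm g" by (rule norm_cauchy_schwarz)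
  finally have 1: "A \<epsilon> x \<bullet> x \<le> norm (Y \<epsilon> x) * norm g" .
  moreover have "(norm (Y \<epsilon> x))\<^sup>2 \<le> A \<epsilon> x \<bullet> x" unfolding A_self using \<epsilon> by simp
  ultimately have "norm (Y \<epsilon> x) * norm (Y \<epsilon> x) \<le> norm (Y \<epsilon> x) * norm g" by (simp add: power2_eq_square)
  then have "norm (Y \<epsilon> x) \<le> norm g"
    by (cases "norm (Y \<epsilon> x) = 0") (auto simp: mult_le_cancel_left)
  then have "norm (Y \<epsilon> x) * norm g \<le> norm g * norm g" by (intro mult_right_mono) auto
  with 1 show ?thesis by (simp add: power2_eq_square)
qed

end

end

section \<open>The approximate system\<close>

text \<open>
  Both equations of the system have the same diffusion law, and their source terms are \<open>N (u - v)\<close>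
  and its negative, with \<open>N w = \<alpha> w - f w\<close> in the application. The number \<open>\<Lambda>\<close> bounds the linear
  form \<open>l\<close>.
\<close>
locale nonlocal_system = closed_graph G
  for G :: "('h::{real_inner,banach} \<times> 'k::{real_inner,banach}) set" +
  fixes l :: "'h \<Rightarrow> real" and \<Lambda> :: real and a :: "real \<Rightarrow> real" and N :: "'h \<Rightarrow> 'h" and m M L T :: real
  assumes bl_l: "bounded_linear l" and l_le: "\<bar>l u\<bar> \<le> \<Lambda> * norm u" and \<Lambda>0: "0 \<le> \<Lambda>"
    and a_lip: "\<bar>a s - a t\<bar> \<le> M * \<bar>s - t\<bar>" and M0: "0 \<le> M"
    and a_ge: "m \<le> a s" and m0: "0 < m"
    and N_lip: "norm (N u - N w) \<le> L * norm (u - w)" and L0: "0 \<le> L"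
    and T0: "0 < T"
begin

abbreviation I where "I \<equiv> {0..T}"

definition yosida_solution :: "real \<Rightarrow> (real \<Rightarrow> 'h) \<Rightarrow> (real \<Rightarrow> 'h) \<Rightarrow> bool" where
  "yosida_solution \<epsilon> u v \<longleftrightarrow>
     (\<forall>t\<in>I. (u has_vector_derivative (- a (l (u t)) *\<^sub>R A \<epsilon> (u t) + N (u t - v t))) (at t within I) \<and>
            (v has_vector_derivative (- a (l (v t)) *\<^sub>R A \<epsilon> (v t) - N (u t - v t))) (at t within I))"

lemma a_pos: "0 < a s" using a_ge[of s] m0 by linarith

lemma N_inner: "2 * (N w \<bullet> w) \<le> 2 * (L + 1) * (norm w)\<^sup>2 + (norm (N 0))\<^sup>2"
proof -
  have "N w \<bullet> w = (N w - N 0) \<bullet> w + N 0 \<bullet> w" by (simp add: inner_diff_left)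
  also have "\<dots> \<le> norm (N w - N 0) * norm w + norm (N 0) * norm w"
    by (intro add_mono norm_cauchy_schwarz)
  also have "\<dots> \<le> L * norm w * norm w + norm (N 0) * norm w"
    using N_lip[of w 0] by (intro add_mono mult_right_mono) auto
  finally have "2 * (N w \<bullet> w) \<le> 2 * L * (norm w)\<^sup>2 + 2 * norm (N 0) * norm w"
    by (simp add: power2_eq_square)
  moreover have "2 * norm (N 0) * norm w \<le> (norm (N 0))\<^sup>2 + (norm w)\<^sup>2"
    by (rule sum_squares_bound)
  moreover have "2 * L * (norm w)\<^sup>2 + (norm w)\<^sup>2 \<le> 2 * (L + 1) * (norm w)\<^sup>2" by (simp add: algebra_simps)
  ultimately show ?thesis by linarith
qed

lemma norm_diff_sq: "(norm (u - w :: 'x::real_inner))\<^sup>2 \<le> 2 * ((norm u)\<^sup>2 + (norm w)\<^sup>2)"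
proof -
  have "0 \<le> (norm (u + w))\<^sup>2" by simp
  then show ?thesis unfolding power2_norm_eq_inner
    by (simp add: inner_diff_left inner_diff_right inner_add_left inner_add_right inner_commute)
qed

text \<open>
  The Gronwall bound for \<open>\<parallel>u\<parallel>\<^sup>2 + \<parallel>v\<parallel>\<^sup>2\<close> when \<open>S\<close> bounds its initial value.
\<close>
definition bound_sq :: "real \<Rightarrow> real" where
  "bound_sq S = exp (4 * (L + 1) * T) * (S + T * (norm (N 0))\<^sup>2)"

text \<open>
  Each equation is tested with its own unknown: the diffusion terms have the good sign and the
  source grows linearly. Arbitrary nonnegative coefficients are allowed in order to cover the
  truncated system from which a solution is constructed.
\<close>
lemma energy_bound:
  assumes e: "\<epsilon> > 0"
    and u: "\<And>t. t \<in> I \<Longrightarrow> (u has_vector_derivative (- \<beta> t *\<^sub>R A \<epsilon> (u t) + N (u t - v t))) (at t within I)"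
    and v: "\<And>t. t \<in> I \<Longrightarrow> (v has_vector_derivative (- \<gamma> t *\<^sub>R A \<epsilon> (v t) - N (u t - v t))) (at t within I)"
    and \<beta>\<gamma>: "\<And>t. t \<in> I \<Longrightarrow> 0 \<le> \<beta> t" "\<And>t. t \<in> I \<Longrightarrow> 0 \<le> \<gamma> t"
    and t: "t \<in> I"
  shows "(norm (u t))\<^sup>2 + (norm (v t))\<^sup>2 \<le> bound_sq ((norm (u 0))\<^sup>2 + (norm (v 0))\<^sup>2)"
proof -
  define E where "E = (\<lambda>t. u t \<bullet> u t + v t \<bullet> v t)"
  define E' where "E' = (\<lambda>t. 2 * (u t \<bullet> (- \<beta> t *\<^sub>R A \<epsilon> (u t) + N (u t - v t))) + 2 * (v t \<bullet> (- \<gamma> t *\<^sub>R A \<epsilon> (v t) - N (u t - v t))))"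
  have "E t \<le> exp (integral {0..T} (\<lambda>_. 4 * (L + 1))) * (E 0 + integral {0..T} (\<lambda>_. (norm (N 0))\<^sup>2))"
  proof (rule gronwall_differential[where E'=E' and E=E])
    fix s assume s: "s \<in> I"
    show "(E has_real_derivative E' s) (at s within I)"
      unfolding E_def E'_def
      using DERIV_add[OF inner_has_real_derivative[OF u u] inner_has_real_derivative[OF v v], OF s s s s]
      by (simp add: inner_commute)
    have "E' s = - 2 * \<beta> s * (A \<epsilon> (u s) \<bullet> u s) - 2 * \<gamma> s * (A \<epsilon> (v s) \<bullet> v s) + 2 * (N (u s - v s) \<bullet> (u s - v s))"
      by (simp add: E'_def inner_add_right inner_diff_right inner_commute algebra_simps)
    also have "\<dots> \<le> 2 * (N (u s - v s) \<bullet> (u s - v s))"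
      using mult_nonneg_nonneg[OF \<beta>\<gamma>(1)[OF s] A_nonneg[OF e, of "u s"]]
        mult_nonneg_nonneg[OF \<beta>\<gamma>(2)[OF s] A_nonneg[OF e, of "v s"]] by simp
    also have "\<dots> \<le> 2 * (L + 1) * (norm (u s - v s))\<^sup>2 + (norm (N 0))\<^sup>2" by (rule N_inner)
    also have "\<dots> \<le> 2 * (L + 1) * (2 * ((norm (u s))\<^sup>2 + (norm (v s))\<^sup>2)) + (norm (N 0))\<^sup>2"
      using L0 by (intro add_mono mult_left_mono norm_diff_sq) auto
    also have "\<dots> = 4 * (L + 1) * E s + (norm (N 0))\<^sup>2"
      by (simp add: E_def power2_norm_eq_inner algebra_simps)
    finally show "E' s \<le> 4 * (L + 1) * E s + (norm (N 0))\<^sup>2" .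
  qed (use T0 t L0 in \<open>auto simp: E_def\<close>)
  then show ?thesis using T0 by (simp add: bound_sq_def E_def power2_norm_eq_inner mult.commute)
qed

lemma bound_sq_mono: "S \<le> S' \<Longrightarrow> bound_sq S \<le> bound_sq S'"
  by (simp add: bound_sq_def)

lemma yosida_bound:
  assumes e: "\<epsilon> > 0" and y: "yosida_solution \<epsilon> u v" and t: "t \<in> I"
  shows "(norm (u t))\<^sup>2 + (norm (v t))\<^sup>2 \<le> bound_sq ((norm (u 0))\<^sup>2 + (norm (v 0))\<^sup>2)"
  by (rule energy_bound[OF e _ _ _ _ t, where \<beta>="\<lambda>t. a (l (u t))" and \<gamma>="\<lambda>t. a (l (v t))"])
    (use y a_pos in \<open>auto simp: yosida_solution_def less_imp_le\<close>)

text \<open>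
  The field \<open>u \<mapsto> a (l u) A \<epsilon> u\<close> is only locally Lipschitz. Truncating the argument of \<open>a\<close> and
  retracting \<open>u\<close> to a ball makes it globally Lipschitz, and the energy bound, which holds for the
  truncated equations too, shows that the truncation is inactive along the solution.
\<close>
lemma yosida_exists:
  assumes e: "\<epsilon> > 0"
  shows "\<exists>u v. yosida_solution \<epsilon> u v \<and> u 0 = x0 \<and> v 0 = y0"
proof -
  \<comment> \<open>The right-hand side is cut off outside the ball of radius \<open>R\<close>, where the energy bound confines every solution, so the cut-off never acts on the solution found.\<close>
  define Rq where "Rq = bound_sq ((norm x0)\<^sup>2 + (norm y0)\<^sup>2)"
  define R where "R = sqrt Rq + 1"
  have Rq: "Rq \<ge> 0" unfolding Rq_def bound_sq_def using T0 by simp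
  have "sqrt Rq \<ge> 0" using Rq by simp
  then have R0: "R > 0" unfolding R_def by linarith
  have "(sqrt Rq)\<^sup>2 \<le> R\<^sup>2" using Rq by (intro power_mono) (auto simp: R_def)
  then have R: "R > 0" "Rq \<le> R\<^sup>2" using Rq R0 by simp_all
  define S where "S = \<Lambda> * R"
  have S: "0 \<le> S" using R \<Lambda>0 by (simp add: S_def)
  define b where "b = (\<lambda>u. a (max (- S) (min S (l u))))"
  have lip_l: "\<bar>l u - l w\<bar> \<le> \<Lambda> * norm (u - w)" for u w
    using l_le[of "u - w"] by (simp add: linear_diff[OF bounded_linear.linear[OF bl_l]])
  have clamp: "\<bar>max (- S) (min S x) - max (- S) (min S y)\<bar> \<le> \<bar>x - y\<bar>" for x y
    unfolding max_def min_def by (auto simp: abs_if)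
  have b_lip: "\<bar>b u - b w\<bar> \<le> (M * \<Lambda>) * norm (u - w)" for u w
  proof -
    have "\<bar>b u - b w\<bar> \<le> M * \<bar>max (- S) (min S (l u)) - max (- S) (min S (l w))\<bar>"
      unfolding b_def by (rule a_lip)
    also have "\<dots> \<le> M * \<bar>l u - l w\<bar>" by (intro mult_left_mono clamp M0)
    also have "\<dots> \<le> M * (\<Lambda> * norm (u - w))" using M0 lip_l by (intro mult_left_mono) auto
    finally show ?thesis by simp
  qed
  have b_bd: "\<bar>b u\<bar> \<le> \<bar>a 0\<bar> + M * S" for u
  proof -
    have "\<bar>b u - a 0\<bar> \<le> M * \<bar>max (- S) (min S (l u)) - 0\<bar>" unfolding b_def by (rule a_lip)
    also have "\<dots> \<le> M * S" using M0 S by (intro mult_left_mono) auto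
    finally show ?thesis by linarith
  qed
  define F where "F = (\<lambda>u. A \<epsilon> (radial_retraction R u))"
  have F_bd: "norm (F u) \<le> (1/\<epsilon>) * R" for u
    unfolding F_def using order_trans[OF A_norm[OF e] mult_left_mono[OF radial_retraction_norm[OF R(1)]]] e by simp
  have F_lip: "norm (F u - F w) \<le> (1/\<epsilon> * 2) * norm (u - w)" for u w
  proof -
    have "norm (F u - F w) = norm (A \<epsilon> (radial_retraction R u - radial_retraction R w))"
      unfolding F_def by (simp add: linear_diff[OF bounded_linear.linear[OF bounded_linear_A[OF e]]])
    also have "\<dots> \<le> (1/\<epsilon>) * norm (radial_retraction R u - radial_retraction R w)" by (rule A_norm[OF e])
    also have "\<dots> \<le> (1/\<epsilon>) * (2 * norm (u - w))"
      using e by (intro mult_left_mono radial_retraction_lipschitz R) auto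
    finally show ?thesis by simp
  qed
  define C where "C = (\<bar>a 0\<bar> + M * S) * (1/\<epsilon> * 2) + (M * \<Lambda>) * ((1/\<epsilon>) * R)"
  have bF: "norm (b u *\<^sub>R F u - b w *\<^sub>R F w) \<le> C * norm (u - w)" for u w
    unfolding C_def by (rule lipschitz_scaleR[OF b_bd b_lip F_bd F_lip])
  have C0: "C \<ge> 0" unfolding C_def using M0 S e \<Lambda>0 R by simp
  define \<Phi> where "\<Phi> = (\<lambda>z. (- b (fst z) *\<^sub>R F (fst z) + N (fst z - snd z), - b (snd z) *\<^sub>R F (snd z) - N (fst z - snd z)))"
  have "norm (\<Phi> z - \<Phi> z') \<le> (2 * C + 4 * L) * norm (z - z')" for z z'
  proof -
    define n where "n = norm (z - z')"
    have 1: "norm (fst z - fst z') \<le> n" "norm (snd z - snd z') \<le> n"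
      using norm_fst_le[of "fst (z - z')" "snd (z - z')"] norm_snd_le[of "snd (z - z')" "fst (z - z')"]
      unfolding prod.collapse by (simp_all add: n_def)
    have 2: "norm (b (fst z) *\<^sub>R F (fst z) - b (fst z') *\<^sub>R F (fst z')) \<le> C * n"
      "norm (b (snd z) *\<^sub>R F (snd z) - b (snd z') *\<^sub>R F (snd z')) \<le> C * n"
      using order_trans[OF bF mult_left_mono[OF 1(1) C0]] order_trans[OF bF mult_left_mono[OF 1(2) C0]] by auto
    have 3: "norm (N (fst z - snd z) - N (fst z' - snd z')) \<le> 2 * L * n"
    proof -
      have "norm (N (fst z - snd z) - N (fst z' - snd z')) \<le> L * norm ((fst z - snd z) - (fst z' - snd z'))"
        by (rule N_lip)
      also have "(fst z - snd z) - (fst z' - snd z') = (fst z - fst z') - (snd z - snd z')" by simp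
      also have "L * norm \<dots> \<le> L * (n + n)"
        using L0 1 by (intro mult_left_mono order_trans[OF norm_triangle_ineq4[of "fst z - fst z'"]] add_mono) auto
      finally show ?thesis by simp
    qed
    have "norm (\<Phi> z - \<Phi> z') \<le> norm (fst (\<Phi> z - \<Phi> z')) + norm (snd (\<Phi> z - \<Phi> z'))"
      using norm_Pair_le[of "fst (\<Phi> z - \<Phi> z')" "snd (\<Phi> z - \<Phi> z')"] unfolding prod.collapse .
    also have "fst (\<Phi> z - \<Phi> z') = (N (fst z - snd z) - N (fst z' - snd z')) - (b (fst z) *\<^sub>R F (fst z) - b (fst z') *\<^sub>R F (fst z'))"
      by (simp add: \<Phi>_def)
    also have "snd (\<Phi> z - \<Phi> z') = - (N (fst z - snd z) - N (fst z' - snd z')) - (b (snd z) *\<^sub>R F (snd z) - b (snd z') *\<^sub>R F (snd z'))"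
      by (simp add: \<Phi>_def)
    also have "norm ((N (fst z - snd z) - N (fst z' - snd z')) - (b (fst z) *\<^sub>R F (fst z) - b (fst z') *\<^sub>R F (fst z'))) +
      norm (- (N (fst z - snd z) - N (fst z' - snd z')) - (b (snd z) *\<^sub>R F (snd z) - b (snd z') *\<^sub>R F (snd z')))
      \<le> (2 * L * n + C * n) + (2 * L * n + C * n)"
      using 2 3 norm_triangle_ineq4[of "N (fst z - snd z) - N (fst z' - snd z')" "b (fst z) *\<^sub>R F (fst z) - b (fst z') *\<^sub>R F (fst z')"]
        norm_triangle_ineq4[of "- (N (fst z - snd z) - N (fst z' - snd z'))" "b (snd z) *\<^sub>R F (snd z) - b (snd z') *\<^sub>R F (snd z')"]
      unfolding norm_minus_cancel by linarith
    finally show ?thesis by (simp add: n_def algebra_simps)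
  qed
  then obtain X where X0: "X 0 = (x0, y0)"
    and X: "\<And>t. t \<in> I \<Longrightarrow> (X has_vector_derivative \<Phi> (X t)) (at t within I)"
    using picard_lindeloef_global[of \<Phi> _ T "(x0, y0)"] T0 by (metis less_imp_le)
  define u where "u = (\<lambda>t. fst (X t))"
  define v where "v = (\<lambda>t. snd (X t))"
  have du: "(u has_vector_derivative (- b (u t) *\<^sub>R F (u t) + N (u t - v t))) (at t within I)" if "t \<in> I" for t
    using bounded_linear.has_vector_derivative[OF bounded_linear_fst X[OF that]] by (simp add: u_def v_def \<Phi>_def)
  have dv: "(v has_vector_derivative (- b (v t) *\<^sub>R F (v t) - N (u t - v t))) (at t within I)" if "t \<in> I" for t
    using bounded_linear.has_vector_derivative[OF bounded_linear_snd X[OF that]] by (simp add: u_def v_def \<Phi>_def)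
  \<comment> \<open>The retraction rescales by a nonnegative factor, so the truncated diffusion still dissipates energy.\<close>
  define c where "c = (\<lambda>u::'h. R / max R (norm u))"
  have c0: "c u \<ge> 0" for u using R by (simp add: c_def)
  have Fc: "F u = c u *\<^sub>R A \<epsilon> u" for u
    unfolding F_def radial_retraction_def c_def
    by (simp add: linear_scale[OF bounded_linear.linear[OF bounded_linear_A[OF e]]])
  have b0: "b u \<ge> 0" for u using a_pos by (simp add: b_def less_imp_le)
  have bd: "(norm (u t))\<^sup>2 + (norm (v t))\<^sup>2 \<le> R\<^sup>2" if t: "t \<in> I" for t
  proof -
    have "(norm (u t))\<^sup>2 + (norm (v t))\<^sup>2 \<le> bound_sq ((norm (u 0))\<^sup>2 + (norm (v 0))\<^sup>2)"
      by (rule energy_bound[OF e _ _ _ _ t, where \<beta>="\<lambda>t. b (u t) * c (u t)" and \<gamma>="\<lambda>t. b (v t) * c (v t)"])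
        (use du dv b0 c0 in \<open>auto simp: Fc\<close>)
    then show ?thesis using R X0 by (simp add: u_def v_def Rq_def)
  qed
  have n: "norm (u t) \<le> R" "norm (v t) \<le> R" if "t \<in> I" for t
  proof -
    have "(norm (u t))\<^sup>2 \<le> R\<^sup>2" "(norm (v t))\<^sup>2 \<le> R\<^sup>2"
      using bd[OF that] zero_le_power2[of "norm (u t)"] zero_le_power2[of "norm (v t)"] by linarith+
    then show "norm (u t) \<le> R" "norm (v t) \<le> R"
      using R by (auto intro: power2_le_imp_le)
  qed
  have F_id: "F w = A \<epsilon> w" "b w = a (l w)" if "norm w \<le> R" for w
  proof -
    show "F w = A \<epsilon> w" by (simp add: F_def radial_retraction_id[OF R(1) that])
    have "\<bar>l w\<bar> \<le> S" using order_trans[OF l_le mult_left_mono[OF that \<Lambda>0]] by (simp add: S_def)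
    then have "max (- S) (min S (l w)) = l w" by linarith
    then show "b w = a (l w)" by (simp add: b_def)
  qed
  have "yosida_solution \<epsilon> u v"
    unfolding yosida_solution_def
    using du dv by (simp add: F_id n)
  moreover have "u 0 = x0" "v 0 = y0" using X0 by (auto simp: u_def v_def)
  ultimately show ?thesis by blast
qed

end

section \<open>Energy estimates\<close>

context nonlocal_system
begin

lemma yosida_continuous:
  assumes "yosida_solution \<epsilon> u v"
  shows "continuous_on I u" "continuous_on I v"
  using assms has_vector_derivative_continuous
  unfolding yosida_solution_def continuous_on_eq_continuous_within by blast+

lemma yosida_continuous_ops:
  assumes e: "\<epsilon> > 0" and y: "yosida_solution \<epsilon> u v"
  shows "continuous_on I (\<lambda>t. A \<epsilon> (u t))" "continuous_on I (\<lambda>t. A \<epsilon> (v t))"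
    "continuous_on I (\<lambda>t. Y \<epsilon> (u t))" "continuous_on I (\<lambda>t. Y \<epsilon> (v t))"
  by (intro bounded_linear.continuous_on[OF bounded_linear_A[OF e]]
      bounded_linear.continuous_on[OF bounded_linear_Y[OF e]] yosida_continuous[OF y])+

text \<open>
  The diffusion discarded in the energy bound controls the gradients in the mean square over
  time, uniformly in \<open>\<epsilon>\<close>.
\<close>
lemma yosida_gradient_bound:
  assumes e: "\<epsilon> > 0" and y: "yosida_solution \<epsilon> u v"
    and S: "(norm (u 0))\<^sup>2 + (norm (v 0))\<^sup>2 \<le> S"
  shows "integral I (\<lambda>t. (norm (Y \<epsilon> (u t)))\<^sup>2 + (norm (Y \<epsilon> (v t)))\<^sup>2)
      \<le> (S + T * (4 * (L + 1) * bound_sq S + (norm (N 0))\<^sup>2)) / (2 * m)"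
proof -
  define E where "E = (\<lambda>t. u t \<bullet> u t + v t \<bullet> v t)"
  define E' where "E' = (\<lambda>t. 2 * (u t \<bullet> (- a (l (u t)) *\<^sub>R A \<epsilon> (u t) + N (u t - v t))) + 2 * (v t \<bullet> (- a (l (v t)) *\<^sub>R A \<epsilon> (v t) - N (u t - v t))))"
  define h where "h = (\<lambda>t. 2 * m * ((norm (Y \<epsilon> (u t)))\<^sup>2 + (norm (Y \<epsilon> (v t)))\<^sup>2))"
  define r where "r = 4 * (L + 1) * bound_sq S + (norm (N 0))\<^sup>2"
  have "E T + integral I h \<le> E 0 + integral I (\<lambda>_. r)"
  proof (rule dissipation_integral[where E'=E' and E=E])
    show "continuous_on I h" unfolding h_def
      by (intro continuous_intros yosida_continuous_ops[OF e y])
    fix s assume s: "s \<in> I"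
    have u: "(u has_vector_derivative (- a (l (u s)) *\<^sub>R A \<epsilon> (u s) + N (u s - v s))) (at s within I)"
      and v: "(v has_vector_derivative (- a (l (v s)) *\<^sub>R A \<epsilon> (v s) - N (u s - v s))) (at s within I)"
      using y s by (auto simp: yosida_solution_def)
    show "(E has_real_derivative E' s) (at s within I)"
      unfolding E_def E'_def
      using DERIV_add[OF inner_has_real_derivative[OF u u] inner_has_real_derivative[OF v v]]
      by (simp add: inner_commute)
    have diss: "m * (norm (Y \<epsilon> w))\<^sup>2 \<le> a (l w) * (A \<epsilon> w \<bullet> w)" for w
      using a_ge[of "l w"] a_pos[of "l w"] e m0 unfolding A_self[OF e] by (intro mult_mono) auto
    have "E' s = - 2 * (a (l (u s)) * (A \<epsilon> (u s) \<bullet> u s)) - 2 * (a (l (v s)) * (A \<epsilon> (v s) \<bullet> v s)) + 2 * (N (u s - v s) \<bullet> (u s - v s))"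
      by (simp add: E'_def inner_add_right inner_diff_right inner_commute algebra_simps)
    also have "\<dots> \<le> - h s + 2 * (N (u s - v s) \<bullet> (u s - v s))"
      using diss[of "u s"] diss[of "v s"] by (simp add: h_def algebra_simps)
    also have "2 * (N (u s - v s) \<bullet> (u s - v s)) \<le> 2 * (L + 1) * (norm (u s - v s))\<^sup>2 + (norm (N 0))\<^sup>2" by (rule N_inner)
    also have "\<dots> \<le> 2 * (L + 1) * (2 * ((norm (u s))\<^sup>2 + (norm (v s))\<^sup>2)) + (norm (N 0))\<^sup>2"
      using L0 by (intro add_mono mult_left_mono norm_diff_sq) auto
    also have "\<dots> \<le> 2 * (L + 1) * (2 * bound_sq S) + (norm (N 0))\<^sup>2"
      using L0 order_trans[OF yosida_bound[OF e y s] bound_sq_mono[OF S]]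
      by (intro add_mono mult_left_mono) auto
    finally show "E' s + h s \<le> r" by (simp add: r_def algebra_simps)
  qed (use T0 in auto)
  moreover have "0 \<le> E T" by (simp add: E_def)
  moreover have "E 0 \<le> S" using S by (simp add: E_def power2_norm_eq_inner)
  ultimately have "integral I h \<le> S + T * r" using T0 by simp
  moreover have "integral I h = 2 * m * integral I (\<lambda>t. (norm (Y \<epsilon> (u t)))\<^sup>2 + (norm (Y \<epsilon> (v t)))\<^sup>2)"
    unfolding h_def by (rule integral_mult_right)
  ultimately show ?thesis using m0 unfolding r_def[symmetric] by (simp add: pos_le_divide_eq mult.commute)
qed

lemma N_bound:
  assumes "(norm u)\<^sup>2 + (norm v)\<^sup>2 \<le> R"
  shows "(norm (N (u - v)))\<^sup>2 \<le> 2 * (norm (N 0))\<^sup>2 + 4 * L\<^sup>2 * R"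
proof -
  have "(norm (N (u - v)))\<^sup>2 = (norm ((N (u - v) - N 0) - (- N 0)))\<^sup>2" by simp
  also have "\<dots> \<le> 2 * ((norm (N (u - v) - N 0))\<^sup>2 + (norm (- N 0))\<^sup>2)" by (rule norm_diff_sq)
  also have "(norm (N (u - v) - N 0))\<^sup>2 \<le> (L * norm (u - v))\<^sup>2"
    using N_lip[of "u - v" 0] by (intro power_mono) auto
  also have "\<dots> \<le> L\<^sup>2 * (2 * R)"
    unfolding power_mult_distrib using norm_diff_sq[of u v] assms by (intro mult_left_mono) auto
  finally show ?thesis by (simp add: algebra_simps)
qed

text \<open>
  Testing with \<open>A \<epsilon> u\<close> and \<open>A \<epsilon> v\<close> controls the approximate Laplacians in the mean square over
  time, at the cost of the gradients of the initial values.
\<close>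
lemma yosida_A_bound:
  assumes e: "\<epsilon> > 0" and y: "yosida_solution \<epsilon> u v"
    and S: "(norm (u 0))\<^sup>2 + (norm (v 0))\<^sup>2 \<le> S"
    and g: "(u 0, g) \<in> G" "(v 0, k) \<in> G"
  shows "integral I (\<lambda>t. (norm (A \<epsilon> (u t)))\<^sup>2 + (norm (A \<epsilon> (v t)))\<^sup>2)
      \<le> ((norm g)\<^sup>2 + (norm k)\<^sup>2 + T * (2 * (2 * (norm (N 0))\<^sup>2 + 4 * L\<^sup>2 * bound_sq S) / m)) / m"
proof -
  have bl: "bounded_linear (A \<epsilon>)" by (rule bounded_linear_A[OF e])
  define E where "E = (\<lambda>t. u t \<bullet> A \<epsilon> (u t) + v t \<bullet> A \<epsilon> (v t))"
  define E' where "E' = (\<lambda>t. 2 * (A \<epsilon> (u t) \<bullet> (- a (l (u t)) *\<^sub>R A \<epsilon> (u t) + N (u t - v t))) + 2 * (A \<epsilon> (v t) \<bullet> (- a (l (v t)) *\<^sub>R A \<epsilon> (v t) - N (u t - v t))))"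
  define h where "h = (\<lambda>t. m * ((norm (A \<epsilon> (u t)))\<^sup>2 + (norm (A \<epsilon> (v t)))\<^sup>2))"
  define n where "n = 2 * (norm (N 0))\<^sup>2 + 4 * L\<^sup>2 * bound_sq S"
  have "E T + integral I h \<le> E 0 + integral I (\<lambda>_. 2 * n / m)"
  proof (rule dissipation_integral[where E'=E' and E=E])
    show "continuous_on I h" unfolding h_def
      by (intro continuous_intros yosida_continuous_ops[OF e y])
    fix s assume s: "s \<in> I"
    have u: "(u has_vector_derivative (- a (l (u s)) *\<^sub>R A \<epsilon> (u s) + N (u s - v s))) (at s within I)"
      and v: "(v has_vector_derivative (- a (l (v s)) *\<^sub>R A \<epsilon> (v s) - N (u s - v s))) (at s within I)"
      using y s by (auto simp: yosida_solution_def)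
    show "(E has_real_derivative E' s) (at s within I)"
      unfolding E_def E'_def
      using DERIV_add[OF inner_has_real_derivative[OF u bounded_linear.has_vector_derivative[OF bl u]]
          inner_has_real_derivative[OF v bounded_linear.has_vector_derivative[OF bl v]]]
      using A_symmetric[OF e, of "- a (l (u s)) *\<^sub>R A \<epsilon> (u s) + N (u s - v s)" "u s"]
        A_symmetric[OF e, of "- a (l (v s)) *\<^sub>R A \<epsilon> (v s) - N (u s - v s)" "v s"]
      by (simp add: inner_commute)
    have nb: "(norm (N (u s - v s)))\<^sup>2 \<le> n"
      unfolding n_def by (intro N_bound order_trans[OF yosida_bound[OF e y s] bound_sq_mono[OF S]])
    have diss: "2 * (w \<bullet> (- a (l x) *\<^sub>R w + f)) + m * (norm w)\<^sup>2 \<le> n / m"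
      if "(norm f)\<^sup>2 \<le> n" for w f :: 'h and x
    proof -
      have "0 \<le> (norm (m *\<^sub>R w - f))\<^sup>2" by simp
      then have "2 * m * (w \<bullet> f) \<le> m\<^sup>2 * (norm w)\<^sup>2 + (norm f)\<^sup>2"
        unfolding power2_norm_eq_inner
        by (simp add: inner_diff_left inner_diff_right inner_commute power2_eq_square algebra_simps)
      then have "m * (2 * (w \<bullet> f)) \<le> m * (m * (norm w)\<^sup>2 + n / m)"
        using that m0 by (simp add: algebra_simps power2_eq_square)
      then have "2 * (w \<bullet> f) \<le> m * (norm w)\<^sup>2 + n / m" using m0 by simp
      moreover have "m * (norm w)\<^sup>2 \<le> a (l x) * (norm w)\<^sup>2" by (intro mult_right_mono a_ge) auto
      ultimately show ?thesis by (simp add: inner_add_right power2_norm_eq_inner algebra_simps)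
    qed
    show "E' s + h s \<le> 2 * n / m"
      using diss[OF nb, of "A \<epsilon> (u s)" "u s"] diss[of "- N (u s - v s)" "A \<epsilon> (v s)" "v s"] nb
        add_divide_distrib[of n n m]
      by (simp add: E'_def h_def distrib_left)
  qed (use T0 in auto)
  moreover have "0 \<le> E T"
    using A_nonneg[OF e, of "u T"] A_nonneg[OF e, of "v T"] by (simp add: E_def inner_commute)
  moreover have "E 0 \<le> (norm g)\<^sup>2 + (norm k)\<^sup>2"
    using A_energy_le[OF e g(1)] A_energy_le[OF e g(2)] by (simp add: E_def inner_commute)
  ultimately have "integral I h \<le> (norm g)\<^sup>2 + (norm k)\<^sup>2 + T * (2 * n / m)"
    using T0 by (simp add: algebra_simps)
  moreover have "integral I h = m * integral I (\<lambda>t. (norm (A \<epsilon> (u t)))\<^sup>2 + (norm (A \<epsilon> (v t)))\<^sup>2)"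
    unfolding h_def by (rule integral_mult_right)
  ultimately show ?thesis using m0 unfolding n_def[symmetric] by (simp add: pos_le_divide_eq mult.commute)
qed

definition a_bound :: "real \<Rightarrow> real" where "a_bound R = \<bar>a 0\<bar> + M * \<Lambda> * sqrt R"

lemma a_le: 
  assumes "(norm u)\<^sup>2 \<le> R" shows "a (l u) \<le> a_bound R"
proof -
  have "norm u \<le> sqrt R" using assms by (simp add: real_le_rsqrt)
  have "\<bar>a (l u) - a 0\<bar> \<le> M * \<bar>l u - 0\<bar>" by (rule a_lip)
  also have "\<dots> \<le> M * (\<Lambda> * norm u)" using l_le M0 by (intro mult_left_mono) auto
  also have "\<dots> \<le> M * (\<Lambda> * sqrt R)" using \<Lambda>0 M0 \<open>norm u \<le> sqrt R\<close> by (intro mult_left_mono) auto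
  finally show ?thesis by (simp add: a_bound_def)
qed

text \<open>
  Two approximations with different parameters are compared. The coefficients differ by at most
  \<open>M \<Lambda> \<parallel>u - v\<parallel>\<close>, so this contribution is absorbed into the dissipation up to a term
  proportional to \<open>\<parallel>\<nabla>v\<parallel>\<^sup>2 \<parallel>u - v\<parallel>\<^sup>2\<close>, which suits Gronwall's inequality because
  \<open>\<parallel>\<nabla>v\<parallel>\<^sup>2\<close> is integrable in time. What remains is of the order of the larger parameter \<open>\<eta>\<close>.
\<close>
lemma diffusion_difference:
  assumes e: "\<epsilon> > 0" "\<delta> > 0" "\<epsilon> \<le> \<eta>" "\<delta> \<le> \<eta>"
    and R: "(norm u)\<^sup>2 \<le> R" "(norm v)\<^sup>2 \<le> R"
  shows "- 2 * ((a (l u) *\<^sub>R A \<epsilon> u - a (l v) *\<^sub>R A \<delta> v) \<bullet> (u - v)) + m * (norm (Y \<epsilon> u - Y \<delta> v))\<^sup>2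
    \<le> (M * \<Lambda>)\<^sup>2 / m * (norm (Y \<delta> v))\<^sup>2 * (norm (u - v))\<^sup>2
      + 4 * a_bound R * \<eta> * ((norm (A \<epsilon> u))\<^sup>2 + (norm (A \<delta> v))\<^sup>2)"
proof -
  define d where "d = J \<epsilon> u - J \<delta> v"
  \<comment> \<open>The difference \<open>u - v\<close> splits into a part \<open>d\<close> that has a gradient and an error \<open>f\<close> of the size of the Yosida parameters.\<close>
  define f where "f = \<epsilon> *\<^sub>R A \<epsilon> u - \<delta> *\<^sub>R A \<delta> v"
  define y where "y = Y \<epsilon> u - Y \<delta> v"
  define z where "z = a (l u) *\<^sub>R A \<epsilon> u - a (l v) *\<^sub>R A \<delta> v"
  define B where "B = a_bound R"
  define n where "n = norm (u - v)"
  have B: "0 < a (l u)" "0 < a (l v)" "a (l u) \<le> B" "a (l v) \<le> B"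
    using a_pos a_le R by (auto simp: B_def)
  have \<eta>: "0 < \<eta>" using e by simp
  have uv: "u - v = d + f" by (simp add: d_def f_def J_eq[OF e(1)] J_eq[OF e(2)])
  have dG: "(d, y) \<in> G" unfolding d_def y_def by (intro G_diff resolvent_spec e)
  have "z \<bullet> d = a (l u) * (Y \<epsilon> u \<bullet> y) - a (l v) * (Y \<delta> v \<bullet> y)"
    by (simp add: z_def inner_diff_left A_weak[OF e(1) dG] A_weak[OF e(2) dG])
  also have "\<dots> = a (l u) * (norm y)\<^sup>2 + (a (l u) - a (l v)) * (Y \<delta> v \<bullet> y)"
    by (simp add: y_def inner_diff_left power2_norm_eq_inner algebra_simps)
  finally have zd: "z \<bullet> d = a (l u) * (norm y)\<^sup>2 + (a (l u) - a (l v)) * (Y \<delta> v \<bullet> y)" .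
  define \<beta> where "\<beta> = a (l u) - a (l v)"
  have "\<bar>\<beta>\<bar> \<le> M * \<bar>l u - l v\<bar>" unfolding \<beta>_def by (rule a_lip)
  also have "\<dots> \<le> M * (\<Lambda> * n)"
    using l_le[of "u - v"] M0 by (intro mult_left_mono) (auto simp: n_def linear_diff[OF bounded_linear.linear[OF bl_l]])
  finally have "\<bar>\<beta>\<bar> * \<bar>Y \<delta> v \<bullet> y\<bar> \<le> M * (\<Lambda> * n) * (norm (Y \<delta> v) * norm y)"
    by (intro mult_mono Cauchy_Schwarz_ineq2) (auto simp: n_def M0 \<Lambda>0)
  moreover have "- (\<beta> * (Y \<delta> v \<bullet> y)) \<le> \<bar>\<beta>\<bar> * \<bar>Y \<delta> v \<bullet> y\<bar>"
    using abs_ge_minus_self[of "\<beta> * (Y \<delta> v \<bullet> y)"] by (simp only: abs_mult)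
  moreover have "M * (\<Lambda> * n) * (norm (Y \<delta> v) * norm y) = (M * \<Lambda> * norm (Y \<delta> v) * n) * norm y"
    by (simp add: mult_ac)
  ultimately have c: "- 2 * (\<beta> * (Y \<delta> v \<bullet> y)) \<le> 2 * (M * \<Lambda> * norm (Y \<delta> v) * n) * norm y"
    by linarith
  have young: "2 * p * q \<le> p\<^sup>2 / m + m * q\<^sup>2" for p q
  proof -
    have "0 \<le> (p - m * q)\<^sup>2" by simp
    then have "m * (2 * p * q) \<le> m * (p\<^sup>2 / m + m * q\<^sup>2)"
      using m0 by (simp add: power2_eq_square algebra_simps)
    then show ?thesis using m0 by simp
  qed
  have "m * (norm y)\<^sup>2 \<le> a (l u) * (norm y)\<^sup>2" by (intro mult_right_mono a_ge) auto
  moreover have "- 2 * (x + p) + q \<le> k" if "q \<le> x" "- 2 * p \<le> c" "c \<le> k + q" for x p q k c :: real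
    using that by simp
  ultimately have 1: "- 2 * (z \<bullet> d) + m * (norm y)\<^sup>2 \<le> (M * \<Lambda> * norm (Y \<delta> v) * n)\<^sup>2 / m"
    using c young[of "M * \<Lambda> * norm (Y \<delta> v) * n" "norm y"] unfolding zd \<beta>_def[symmetric] by blast
  have nz: "norm z \<le> B * (norm (A \<epsilon> u) + norm (A \<delta> v))"
  proof -
    have "norm z \<le> a (l u) * norm (A \<epsilon> u) + a (l v) * norm (A \<delta> v)"
      unfolding z_def using B by (intro order_trans[OF norm_triangle_ineq4]) auto
    also have "\<dots> \<le> B * norm (A \<epsilon> u) + B * norm (A \<delta> v)"
      using B by (intro add_mono mult_right_mono) auto
    finally show ?thesis by (simp add: algebra_simps)
  qed
  have nf: "norm f \<le> \<eta> * (norm (A \<epsilon> u) + norm (A \<delta> v))"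
  proof -
    have "norm f \<le> \<epsilon> * norm (A \<epsilon> u) + \<delta> * norm (A \<delta> v)"
      unfolding f_def using e by (intro order_trans[OF norm_triangle_ineq4]) auto
    also have "\<dots> \<le> \<eta> * norm (A \<epsilon> u) + \<eta> * norm (A \<delta> v)"
      using e by (intro add_mono mult_right_mono) auto
    finally show ?thesis by (simp add: algebra_simps)
  qed
  have "\<bar>z \<bullet> f\<bar> \<le> norm z * norm f" by (rule Cauchy_Schwarz_ineq2)
  also have "\<dots> \<le> (B * (norm (A \<epsilon> u) + norm (A \<delta> v))) * (\<eta> * (norm (A \<epsilon> u) + norm (A \<delta> v)))"
    using B \<eta> by (intro mult_mono nz nf) auto
  also have "\<dots> = B * \<eta> * (norm (A \<epsilon> u) + norm (A \<delta> v))\<^sup>2"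
    by (simp add: power2_eq_square algebra_simps)
  also have "\<dots> \<le> B * \<eta> * (2 * ((norm (A \<epsilon> u))\<^sup>2 + (norm (A \<delta> v))\<^sup>2))"
    using B \<eta> sum_squares_bound[of "norm (A \<epsilon> u)" "norm (A \<delta> v)"]
    by (intro mult_left_mono) (auto simp: power2_sum)
  finally have 2: "- 2 * (z \<bullet> f) \<le> 4 * B * \<eta> * ((norm (A \<epsilon> u))\<^sup>2 + (norm (A \<delta> v))\<^sup>2)" by linarith
  have "- 2 * (z \<bullet> (u - v)) + m * (norm y)\<^sup>2 = (- 2 * (z \<bullet> d) + m * (norm y)\<^sup>2) - 2 * (z \<bullet> f)"
    by (simp add: uv inner_add_right)
  also have "\<dots> \<le> (M * \<Lambda> * norm (Y \<delta> v) * n)\<^sup>2 / m + 4 * B * \<eta> * ((norm (A \<epsilon> u))\<^sup>2 + (norm (A \<delta> v))\<^sup>2)"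
    using 1 2 by simp
  finally show ?thesis by (simp add: z_def y_def n_def B_def power_mult_distrib)
qed

text \<open>
  Gronwall's inequality with the integrable rate \<open>\<parallel>\<nabla>u2\<parallel>\<^sup>2 + \<parallel>\<nabla>v2\<parallel>\<^sup>2\<close>. The exponent \<open>\<Gamma>\<close> depends
  only on a bound for the initial values, and the defect \<open>Q\<close> consists of the initial difference
  and of the parameters times the dissipation. Hence the approximations form a Cauchy sequence,
  and their limit is a strong one.
\<close>
lemma yosida_difference:
  assumes e: "\<epsilon> > 0" "\<delta> > 0" "\<epsilon> \<le> \<eta>" "\<delta> \<le> \<eta>"
    and y1: "yosida_solution \<epsilon> u1 v1" and y2: "yosida_solution \<delta> u2 v2"
    and S: "(norm (u1 0))\<^sup>2 + (norm (v1 0))\<^sup>2 \<le> S" "(norm (u2 0))\<^sup>2 + (norm (v2 0))\<^sup>2 \<le> S"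
  defines "E \<equiv> \<lambda>t. (norm (u1 t - u2 t))\<^sup>2 + (norm (v1 t - v2 t))\<^sup>2"
  defines "Q \<equiv> E 0 + 4 * a_bound (bound_sq S) * \<eta> *
     (integral I (\<lambda>t. (norm (A \<epsilon> (u1 t)))\<^sup>2 + (norm (A \<epsilon> (v1 t)))\<^sup>2) +
      integral I (\<lambda>t. (norm (A \<delta> (u2 t)))\<^sup>2 + (norm (A \<delta> (v2 t)))\<^sup>2))"
  defines "\<Gamma> \<equiv> 4 * L * T + (M * \<Lambda>)\<^sup>2 / m * ((S + T * (4 * (L + 1) * bound_sq S + (norm (N 0))\<^sup>2)) / (2 * m))"
  shows "t \<in> I \<Longrightarrow> E t \<le> exp \<Gamma> * Q"
    and "integral I (\<lambda>t. (norm (Y \<epsilon> (u1 t) - Y \<delta> (u2 t)))\<^sup>2 + (norm (Y \<epsilon> (v1 t) - Y \<delta> (v2 t)))\<^sup>2)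
      \<le> (1 + \<Gamma> * exp \<Gamma>) * Q / m"
proof -
  define R where "R = bound_sq S"
  define B where "B = a_bound R"
  define E' where "E' = (\<lambda>t. 2 * ((u1 t - u2 t) \<bullet> ((- a (l (u1 t)) *\<^sub>R A \<epsilon> (u1 t) + N (u1 t - v1 t)) - (- a (l (u2 t)) *\<^sub>R A \<delta> (u2 t) + N (u2 t - v2 t))))
     + 2 * ((v1 t - v2 t) \<bullet> ((- a (l (v1 t)) *\<^sub>R A \<epsilon> (v1 t) - N (u1 t - v1 t)) - (- a (l (v2 t)) *\<^sub>R A \<delta> (v2 t) - N (u2 t - v2 t)))))"
  define c where "c = (M * \<Lambda>)\<^sup>2 / m"
  have c0: "0 \<le> c" using m0 by (simp add: c_def)
  define g where "g = (\<lambda>t. 4 * L + c * ((norm (Y \<delta> (u2 t)))\<^sup>2 + (norm (Y \<delta> (v2 t)))\<^sup>2))"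
  define r where "r = (\<lambda>t. 4 * B * \<eta> * (((norm (A \<epsilon> (u1 t)))\<^sup>2 + (norm (A \<epsilon> (v1 t)))\<^sup>2) + ((norm (A \<delta> (u2 t)))\<^sup>2 + (norm (A \<delta> (v2 t)))\<^sup>2)))"
  define h where "h = (\<lambda>t. m * ((norm (Y \<epsilon> (u1 t) - Y \<delta> (u2 t)))\<^sup>2 + (norm (Y \<epsilon> (v1 t) - Y \<delta> (v2 t)))\<^sup>2))"
  note co = yosida_continuous_ops[OF e(1) y1] yosida_continuous_ops[OF e(2) y2] yosida_continuous[OF y1] yosida_continuous[OF y2]
  have \<eta>: "0 < \<eta>" using e by simp
  have S0: "0 \<le> S" using S(1) by (smt (verit) zero_le_power2)
  have R0: "0 \<le> R" using S0 T0 by (simp add: R_def bound_sq_def)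
  have B0: "0 \<le> B" using R0 M0 \<Lambda>0 by (simp add: B_def a_bound_def)
  have cont: "continuous_on I g" "continuous_on I r" "continuous_on I h" "continuous_on I E"
    unfolding g_def r_def h_def E_def by (intro continuous_intros co)+
  have Ed: "(E has_real_derivative E' s) (at s within I)" if s: "s \<in> I" for s
  proof -
    have u: "((\<lambda>s. u1 s - u2 s) has_vector_derivative ((- a (l (u1 s)) *\<^sub>R A \<epsilon> (u1 s) + N (u1 s - v1 s)) - (- a (l (u2 s)) *\<^sub>R A \<delta> (u2 s) + N (u2 s - v2 s)))) (at s within I)"
      and v: "((\<lambda>s. v1 s - v2 s) has_vector_derivative ((- a (l (v1 s)) *\<^sub>R A \<epsilon> (v1 s) - N (u1 s - v1 s)) - (- a (l (v2 s)) *\<^sub>R A \<delta> (v2 s) - N (u2 s - v2 s)))) (at s within I)"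
      using y1 y2 s unfolding yosida_solution_def by (auto intro!: has_vector_derivative_diff)
    show ?thesis
      unfolding E_def E'_def power2_norm_eq_inner
      using DERIV_add[OF inner_has_real_derivative[OF u u] inner_has_real_derivative[OF v v]]
      by (simp add: inner_commute)
  qed
  have le: "E' s + h s \<le> g s * E s + r s" if s: "s \<in> I" for s
  proof -
    have nR: "(norm (u1 s))\<^sup>2 \<le> R" "(norm (v1 s))\<^sup>2 \<le> R" "(norm (u2 s))\<^sup>2 \<le> R" "(norm (v2 s))\<^sup>2 \<le> R"
      using order_trans[OF yosida_bound[OF e(1) y1 s] bound_sq_mono[OF S(1)]]
        order_trans[OF yosida_bound[OF e(2) y2 s] bound_sq_mono[OF S(2)]]
        zero_le_power2[of "norm (u1 s)"] zero_le_power2[of "norm (v1 s)"]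
        zero_le_power2[of "norm (u2 s)"] zero_le_power2[of "norm (v2 s)"]
      unfolding R_def by linarith+
    define w where "w = u1 s - u2 s"
    define q where "q = v1 s - v2 s"
    define n where "n = N (u1 s - v1 s) - N (u2 s - v2 s)"
    have "n \<bullet> (w - q) \<le> norm n * norm (w - q)" by (rule norm_cauchy_schwarz)
    also have "\<dots> \<le> L * norm (w - q) * norm (w - q)"
      using N_lip[of "u1 s - v1 s" "u2 s - v2 s"]
      by (intro mult_right_mono) (simp_all add: n_def w_def q_def algebra_simps)
    also have "\<dots> = L * (norm (w - q))\<^sup>2" by (simp add: power2_eq_square)
    also have "\<dots> \<le> L * (2 * ((norm w)\<^sup>2 + (norm q)\<^sup>2))"
      using L0 by (intro mult_left_mono norm_diff_sq) auto
    finally have nn: "2 * (n \<bullet> (w - q)) \<le> 4 * L * ((norm w)\<^sup>2 + (norm q)\<^sup>2)" by (simp add: algebra_simps)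
    define zu where "zu = (a (l (u1 s)) *\<^sub>R A \<epsilon> (u1 s) - a (l (u2 s)) *\<^sub>R A \<delta> (u2 s)) \<bullet> w"
    define zv where "zv = (a (l (v1 s)) *\<^sub>R A \<epsilon> (v1 s) - a (l (v2 s)) *\<^sub>R A \<delta> (v2 s)) \<bullet> q"
    have E's: "E' s = - 2 * zu - 2 * zv + 2 * (n \<bullet> (w - q))"
      unfolding E'_def zu_def zv_def n_def w_def[symmetric] q_def[symmetric]
      by (simp add: inner_diff_left inner_diff_right inner_add_right inner_commute algebra_simps)
    have du: "- 2 * zu + m * (norm (Y \<epsilon> (u1 s) - Y \<delta> (u2 s)))\<^sup>2 \<le> c * (norm (Y \<delta> (u2 s)))\<^sup>2 * (norm w)\<^sup>2
        + 4 * B * \<eta> * ((norm (A \<epsilon> (u1 s)))\<^sup>2 + (norm (A \<delta> (u2 s)))\<^sup>2)"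
      unfolding zu_def w_def B_def c_def by (rule diffusion_difference[OF e nR(1,3)])
    have dv: "- 2 * zv + m * (norm (Y \<epsilon> (v1 s) - Y \<delta> (v2 s)))\<^sup>2 \<le> c * (norm (Y \<delta> (v2 s)))\<^sup>2 * (norm q)\<^sup>2
        + 4 * B * \<eta> * ((norm (A \<epsilon> (v1 s)))\<^sup>2 + (norm (A \<delta> (v2 s)))\<^sup>2)"
      unfolding zv_def q_def B_def c_def by (rule diffusion_difference[OF e nR(2,4)])
    have cross: "c * (norm (Y \<delta> (u2 s)))\<^sup>2 * (norm w)\<^sup>2 + c * (norm (Y \<delta> (v2 s)))\<^sup>2 * (norm q)\<^sup>2
        \<le> c * ((norm (Y \<delta> (u2 s)))\<^sup>2 + (norm (Y \<delta> (v2 s)))\<^sup>2) * ((norm w)\<^sup>2 + (norm q)\<^sup>2)"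
      using c0 by (simp add: algebra_simps)
    have "E' s + h s \<le> c * ((norm (Y \<delta> (u2 s)))\<^sup>2 + (norm (Y \<delta> (v2 s)))\<^sup>2) * ((norm w)\<^sup>2 + (norm q)\<^sup>2)
      + r s + 4 * L * ((norm w)\<^sup>2 + (norm q)\<^sup>2)"
      using du dv nn cross unfolding E's h_def r_def by (simp add: algebra_simps)
    also have "\<dots> = g s * E s + r s" by (simp add: g_def E_def w_def q_def algebra_simps)
    finally show ?thesis .
  qed
  have g0: "0 \<le> g s" for s using c0 L0 by (simp add: g_def)
  have r0: "0 \<le> r s" for s using B0 \<eta> by (simp add: r_def)
  have h0: "0 \<le> h s" for s using m0 by (simp add: h_def)
  have E0: "0 \<le> E s" for s by (simp add: E_def)
  have ig: "integral I g \<le> \<Gamma>"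
  proof -
    have "integral I g = 4 * L * T + c * integral I (\<lambda>t. (norm (Y \<delta> (u2 t)))\<^sup>2 + (norm (Y \<delta> (v2 t)))\<^sup>2)"
      unfolding g_def using T0
      by (subst integral_add) (auto intro!: integrable_continuous_interval continuous_intros co)
    also have "\<dots> \<le> \<Gamma>" unfolding \<Gamma>_def c_def[symmetric]
      by (intro add_left_mono mult_left_mono c0 yosida_gradient_bound[OF e(2) y2 S(2)])
    finally show ?thesis .
  qed
  have Qeq: "E 0 + integral I r = Q"
    unfolding Q_def r_def B_def R_def
    by (subst integral_add[symmetric])
      (auto intro!: integrable_continuous_interval continuous_intros co)
  have Q0: "0 \<le> Q" unfolding Qeq[symmetric]
    using E0 r0 by (auto intro!: add_nonneg_nonneg integral_nonneg integrable_continuous_interval cont)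
  show Et: "E t \<le> exp \<Gamma> * Q" if t: "t \<in> I" for t
  proof -
    have "E t \<le> exp (integral I g) * (E 0 + integral I r)"
      by (rule gronwall_differential[where E'=E'])
        (use T0 Ed cont g0 r0 le h0 E0 t in \<open>auto intro: order_trans[rotated, OF le]\<close>)
    also have "\<dots> \<le> exp \<Gamma> * Q" unfolding Qeq using ig Q0 by (intro mult_right_mono) auto
    finally show ?thesis .
  qed
  have "E T + integral I h \<le> E 0 + integral I (\<lambda>s. g s * E s + r s)"
    by (rule dissipation_integral[where E'=E'])
      (use T0 Ed cont le in \<open>auto intro!: continuous_intros\<close>)
  also have "integral I (\<lambda>s. g s * E s + r s) = integral I (\<lambda>s. g s * E s) + integral I r"
    by (intro integral_add integrable_continuous_interval continuous_intros cont)
  also have "integral I (\<lambda>s. g s * E s) \<le> integral I (\<lambda>s. g s * (exp \<Gamma> * Q))"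
    by (intro integral_le integrable_continuous_interval continuous_intros cont mult_left_mono Et g0)
  also have "\<dots> \<le> \<Gamma> * (exp \<Gamma> * Q)"
    using ig Q0 by (simp add: mult_right_mono)
  finally have "integral I h \<le> Q + \<Gamma> * (exp \<Gamma> * Q)"
    using E0[of T] Qeq by linarith
  moreover have "integral I h = m * integral I (\<lambda>t. (norm (Y \<epsilon> (u1 t) - Y \<delta> (u2 t)))\<^sup>2 + (norm (Y \<epsilon> (v1 t) - Y \<delta> (v2 t)))\<^sup>2)"
    unfolding h_def by (rule integral_mult_right)
  ultimately show "integral I (\<lambda>t. (norm (Y \<epsilon> (u1 t) - Y \<delta> (u2 t)))\<^sup>2 + (norm (Y \<epsilon> (v1 t) - Y \<delta> (v2 t)))\<^sup>2)
      \<le> (1 + \<Gamma> * exp \<Gamma>) * Q / m"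
    using m0 by (simp add: pos_le_divide_eq algebra_simps)
qed

end

section \<open>Sequences that converge at a geometric rate\<close>

text \<open>
  If integrals of nonnegative functions decay geometrically, then so do the functions almost
  everywhere, at a slower rate and up to an integrable factor.
\<close>
lemma fast_decay_majorant:
  fixes f :: "nat \<Rightarrow> 'a \<Rightarrow> real"
  assumes f: "\<And>k. integrable M (f k)" "\<And>k x. 0 \<le> f k x"
    and le: "\<And>k. integral\<^sup>L M (f k) \<le> C / 8 ^ k"
  shows "\<exists>Q. integrable M Q \<and> (\<forall>x. 0 \<le> Q x) \<and> (AE x in M. \<forall>k. f k x \<le> Q x / 4 ^ k)"
proof -
  \<comment> \<open>With this weight the integrals are still summable, by a geometric series of ratio one half.\<close>
  define g where "g = (\<lambda>k x. 4 ^ k * f k x)"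
  have g: "integrable M (g k)" "0 \<le> g k x" for k x using f by (auto simp: g_def)
  have [measurable]: "g k \<in> borel_measurable M" for k using g(1) by auto
  have ig: "integral\<^sup>L M (g k) \<le> C * (1/2) ^ k" for k
  proof -
    have "integral\<^sup>L M (g k) = 4 ^ k * integral\<^sup>L M (f k)" by (simp add: g_def)
    also have "\<dots> \<le> 4 ^ k * (C / 8 ^ k)" by (intro mult_left_mono le) auto
    also have "(4::real) ^ k * (C / 8 ^ k) = C * (1/2) ^ k"
      by (simp add: power_divide field_simps flip: power_mult_distrib)
    finally show ?thesis .
  qed
  have sumC: "summable (\<lambda>k. C * (1/2::real) ^ k)" by (intro summable_mult summable_geometric) auto
  have sumi: "summable (\<lambda>k. integral\<^sup>L M (g k))"
    by (rule summable_comparison_test'[OF sumC]) (use ig g(2) in auto)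
  have "(\<integral>\<^sup>+x. (\<Sum>k. ennreal (g k x)) \<partial>M) = (\<Sum>k. \<integral>\<^sup>+x. ennreal (g k x) \<partial>M)"
    by (rule nn_integral_suminf) auto
  also have "\<dots> = (\<Sum>k. ennreal (integral\<^sup>L M (g k)))"
    using g by (intro suminf_cong nn_integral_eq_integral) auto
  also have "\<dots> \<noteq> \<infinity>"
    using sumi g(2) by (simp add: suminf_ennreal2)
  finally have "AE x in M. (\<Sum>k. ennreal (g k x)) \<noteq> \<infinity>"
    by (intro nn_integral_PInf_AE) auto
  then have sumg: "AE x in M. summable (\<lambda>k. g k x)"
    by eventually_elim (use g(2) in \<open>auto intro: summable_suminf_not_top simp: infinity_ennreal_def\<close>)
  define Q where "Q = (\<lambda>x. \<bar>\<Sum>k. g k x\<bar>)"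
  have "integrable M (\<lambda>x. \<Sum>k. g k x)"
    by (rule integrable_suminf) (use g sumg sumi in auto)
  then have "integrable M Q" by (simp add: Q_def)
  moreover have "AE x in M. \<forall>k. f k x \<le> Q x / 4 ^ k"
    using sumg
  proof eventually_elim
    fix x assume s: "summable (\<lambda>k. g k x)"
    show "\<forall>k. f k x \<le> Q x / 4 ^ k"
    proof
      fix k
      have "g k x \<le> (\<Sum>k. g k x)"
        using sum_le_suminf[OF s, of "{k}"] g(2) by auto
      also have "\<dots> \<le> Q x" by (simp add: Q_def)
      finally show "f k x \<le> Q x / 4 ^ k" by (simp add: g_def field_simps)
    qed
  qed
  moreover have "\<forall>x. 0 \<le> Q x" by (simp add: Q_def)
  ultimately show ?thesis by blast
qed

lemma convergent_if_dyadic: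
  fixes x :: "nat \<Rightarrow> 'b::banach"
  assumes "\<And>k. norm (x (Suc k) - x k) \<le> c / 2 ^ k"
  shows "convergent x" and "norm (x k - x 0) \<le> 2 * c"
proof -
  have sc: "summable (\<lambda>k. c * (1/2) ^ k)" by (intro summable_mult summable_geometric) auto
  have le: "norm (x (Suc k) - x k) \<le> c * (1/2) ^ k" for k
    using assms[of k] by (simp add: power_divide)
  have s: "summable (\<lambda>k. x (Suc k) - x k)"
    by (rule summable_comparison_test'[OF sc]) (use le in auto)
  have tele: "(\<Sum>j<k. x (Suc j) - x j) = x k - x 0" for k by (rule sum_lessThan_telescope)
  have "(\<lambda>k. (x k - x 0) + x 0) \<longlonglongrightarrow> suminf (\<lambda>k. x (Suc k) - x k) + x 0"
    using summable_LIMSEQ[OF s] unfolding tele by (intro tendsto_add tendsto_const)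
  then show "convergent x" by (auto simp: convergent_def)
  have "norm (x k - x 0) \<le> (\<Sum>j<k. norm (x (Suc j) - x j))" unfolding tele[symmetric] by (rule norm_sum)
  also have "\<dots> \<le> (\<Sum>j<k. c * (1/2) ^ j)" by (intro sum_mono le)
  also have "\<dots> \<le> (\<Sum>j. c * (1/2) ^ j)"
    using order_trans[OF norm_ge_zero le[of 0]] by (intro sum_le_suminf sc) auto
  also have "\<dots> = 2 * c" using suminf_mult[of "\<lambda>k. (1/2::real) ^ k" c] suminf_geometric[of "1/2::real"]
    by (simp add: summable_geometric)
  finally show "norm (x k - x 0) \<le> 2 * c" .
qed

lemma sq_le_dyadic:
  assumes "(norm x)\<^sup>2 \<le> Q / 4 ^ k" "0 \<le> Q"
  shows "norm x \<le> sqrt Q / 2 ^ k"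
proof -
  have "norm x \<le> sqrt (Q / 4 ^ k)" using assms by (simp add: real_le_rsqrt)
  also have "\<dots> = sqrt Q / 2 ^ k" by (simp add: real_sqrt_divide real_sqrt_power)
  finally show ?thesis .
qed

lemma borel_measurable_lebesgue_on_AE:
  fixes f g :: "'a::euclidean_space \<Rightarrow> 'b::euclidean_space"
  assumes f: "f \<in> borel_measurable (lebesgue_on S)" and ae: "AE x in lebesgue_on S. f x = g x"
    and S: "S \<in> sets lebesgue"
  shows "g \<in> borel_measurable (lebesgue_on S)"
proof -
  have "(\<lambda>x. if x \<in> S then f x else 0) \<in> borel_measurable lebesgue"
    using f S by (simp add: borel_measurable_if)
  moreover have "AE x in lebesgue. (if x \<in> S then f x else 0) = (if x \<in> S then g x else 0)"
    using ae S by (auto simp: AE_restrict_space_iff)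
  ultimately have "(\<lambda>x. if x \<in> S then g x else 0) \<in> borel_measurable lebesgue"
    by (rule borel_measurable_AE)
  then show ?thesis using S by (simp add: borel_measurable_if)
qed

text \<open>
  Completeness of Lebesgue measure lets measurability survive a limit that exists only almost
  everywhere.
\<close>
lemma borel_measurable_LIMSEQ_AE:
  fixes f :: "nat \<Rightarrow> 'a::euclidean_space \<Rightarrow> real"
  assumes f: "\<And>k. f k \<in> borel_measurable (lebesgue_on S)"
    and ae: "AE x in lebesgue_on S. (\<lambda>k. f k x) \<longlonglongrightarrow> g x" and S: "S \<in> sets lebesgue"
  shows "g \<in> borel_measurable (lebesgue_on S)"
proof (rule borel_measurable_lebesgue_on_AE[OF _ _ S])
  show "(\<lambda>x. lim (\<lambda>k. f k x)) \<in> borel_measurable (lebesgue_on S)"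
    using f by (rule borel_measurable_lim_metric)
  show "AE x in lebesgue_on S. lim (\<lambda>k. f k x) = g x"
    using ae by eventually_elim (rule limI)
qed

lemma continuous_on_lebesgue_integral:
  fixes f :: "real \<Rightarrow> real"
  assumes "continuous_on {0..T} f"
  shows "integrable (lebesgue_on {0..T}) f" "integral\<^sup>L (lebesgue_on {0..T}) f = integral {0..T} f"
  using continuous_imp_integrable_real[OF assms] lebesgue_integral_eq_integral[OF continuous_imp_integrable_real[OF assms]]
  by auto

section \<open>Weak solutions as limits of approximate solutions\<close>

context nonlocal_system
begin

text \<open>
  The pair \<open>(u t, y t)\<close> lies in \<open>G\<close> for almost every time, so \<open>y\<close> is the gradient of \<open>u\<close>.
  It is recorded as a limit of continuous \<open>G\<close>-valued functions, from which strong measurability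
  in the Sobolev norm is read off later. The equation is stated in the sense of distributions in
  time, for each admissible test pair.
\<close>
definition weak_solution :: "(real \<Rightarrow> 'h) \<Rightarrow> (real \<Rightarrow> 'k) \<Rightarrow> (real \<Rightarrow> 'h) \<Rightarrow> bool" where
  "weak_solution u y f \<longleftrightarrow>
     continuous_on I u \<and>
     (\<exists>z. (\<forall>k::nat. continuous_on I (z k) \<and> z k ` I \<subseteq> G) \<and>
          (AE t in lebesgue_on I. (\<lambda>k. z k t) \<longlonglongrightarrow> (u t, y t))) \<and>
     integrable (lebesgue_on I) (\<lambda>t. (norm (y t))\<^sup>2) \<and>
     (\<forall>h. (\<lambda>t. y t \<bullet> h) \<in> borel_measurable (lebesgue_on I)) \<and>
     (\<forall>h1 h2 \<phi> \<phi>'. (h1, h2) \<in> G \<longrightarrow> (\<forall>t\<in>I. (\<phi> has_real_derivative \<phi>' t) (at t within I)) \<longrightarrow>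
        continuous_on I \<phi>' \<longrightarrow> \<phi> 0 = 0 \<longrightarrow> \<phi> T = 0 \<longrightarrow>
        (LINT t|lebesgue_on I. (u t \<bullet> h1) * \<phi>' t +
           (- a (l (u t)) * (y t \<bullet> h2) + f t \<bullet> h1) * \<phi> t) = 0)"

lemma continuous_a_l: "continuous_on UNIV (\<lambda>u. a (l u))"
proof -
  have "continuous_on UNIV a"
    using lipschitz_on_continuous_on[of M UNIV a] a_lip M0
    by (auto simp: lipschitz_on_def dist_real_def)
  moreover have "continuous_on UNIV l" by (rule linear_continuous_on[OF bl_l])
  ultimately show ?thesis by (rule continuous_on_compose2) auto
qed

text \<open>
  Uniform convergence of the states and square integrable domination of the gradients allow
  dominated convergence in the equation tested in space and time. All convergences are strong, so
  the nonlinear coefficient causes no difficulty.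
\<close>
lemma weak_solution_limit:
  fixes U F :: "nat \<Rightarrow> real \<Rightarrow> 'h"
  assumes e: "\<And>k. \<epsilon> k > 0"
    and U: "\<And>k t. t \<in> I \<Longrightarrow> (U k has_vector_derivative (- a (l (U k t)) *\<^sub>R A (\<epsilon> k) (U k t) + F k t)) (at t within I)"
    and F: "\<And>k. continuous_on I (F k)"
    and limU: "uniform_limit I U u sequentially" and limF: "uniform_limit I F f sequentially"
    and bd: "\<And>k t. t \<in> I \<Longrightarrow> (norm (U k t))\<^sup>2 \<le> R" "\<And>k t. t \<in> I \<Longrightarrow> norm (F k t) \<le> R'"
    and dY: "\<And>k. integral I (\<lambda>t. (norm (Y (\<epsilon> (Suc k)) (U (Suc k) t) - Y (\<epsilon> k) (U k t)))\<^sup>2) \<le> C / 8 ^ k"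
    and dA: "\<And>k. integral I (\<lambda>t. (norm (\<epsilon> k *\<^sub>R A (\<epsilon> k) (U k t)))\<^sup>2) \<le> C / 8 ^ k"
  shows "\<exists>y. weak_solution u y f"
proof -
  have T: "0 \<in> I" "T \<in> I" using T0 by auto
  have Is: "I \<in> sets lebesgue" by simp
  have spI: "space (lebesgue_on I) = I" by simp
  have cU: "continuous_on I (U k)" for k
    using U has_vector_derivative_continuous unfolding continuous_on_eq_continuous_within by blast
  have cu: "continuous_on I u" 
    by (rule uniform_limit_theorem[OF always_eventually limU]) (auto simp: cU)
  have cf: "continuous_on I f" 
    by (rule uniform_limit_theorem[OF always_eventually limF]) (auto simp: F)
  define y' where "y' = (\<lambda>k t. Y (\<epsilon> k) (U k t))"
  define z where "z = (\<lambda>k t. (J (\<epsilon> k) (U k t), y' k t))"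
  have cA: "continuous_on I (\<lambda>t. A (\<epsilon> k) (U k t))" and cY: "continuous_on I (y' k)" for k
    unfolding y'_def
    by (intro bounded_linear.continuous_on[OF bounded_linear_A[OF e]]
      bounded_linear.continuous_on[OF bounded_linear_Y[OF e]] cU)+
  have cJ: "continuous_on I (\<lambda>t. J (\<epsilon> k) (U k t))" for k
    unfolding J_eq[OF e] by (intro continuous_intros cU cA)
  \<comment> \<open>The majorants below give pointwise convergence of the gradients and, at the same time, a dominating function.\<close>
  obtain Q1 where Q1: "integrable (lebesgue_on I) Q1" "\<And>x. 0 \<le> Q1 x"
      "AE t in lebesgue_on I. \<forall>k. (norm (y' (Suc k) t - y' k t))\<^sup>2 \<le> Q1 t / 4 ^ k"
  proof -
    have c: "continuous_on I (\<lambda>t. (norm (y' (Suc k) t - y' k t))\<^sup>2)" for k by (intro continuous_intros cY)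
    show thesis
      using fast_decay_majorant[of "lebesgue_on I" "\<lambda>k t. (norm (y' (Suc k) t - y' k t))\<^sup>2" C]
        continuous_on_lebesgue_integral[OF c] dY that unfolding y'_def by auto
  qed
  obtain Q2 where Q2: "AE t in lebesgue_on I. \<forall>k. (norm (\<epsilon> k *\<^sub>R A (\<epsilon> k) (U k t)))\<^sup>2 \<le> Q2 t / 4 ^ k"
       "\<And>x. 0 \<le> Q2 x"
  proof -
    have c: "continuous_on I (\<lambda>t. (norm (\<epsilon> k *\<^sub>R A (\<epsilon> k) (U k t)))\<^sup>2)" for k by (intro continuous_intros cA)
    show thesis
      using fast_decay_majorant[of "lebesgue_on I" "\<lambda>k t. (norm (\<epsilon> k *\<^sub>R A (\<epsilon> k) (U k t)))\<^sup>2" C]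
        continuous_on_lebesgue_integral[OF c] dA that by auto
  qed
  define y where "y = (\<lambda>t. lim (\<lambda>k. y' k t))"
  define W where "W = (\<lambda>t. 2 * (norm (y' 0 t))\<^sup>2 + 8 * Q1 t)"
  have W: "integrable (lebesgue_on I) W"
    unfolding W_def
    by (intro Bochner_Integration.integrable_add integrable_mult_right continuous_on_lebesgue_integral(1) Q1 continuous_intros cY)
  have W0: "0 \<le> W t" for t using Q1(2) by (simp add: W_def)
  have aeY: "AE t in lebesgue_on I. (\<lambda>k. y' k t) \<longlonglongrightarrow> y t \<and> (\<forall>k. (norm (y' k t))\<^sup>2 \<le> W t)"
    using Q1(3)
  proof eventually_elim
    fix t assume q: "\<forall>k. (norm (y' (Suc k) t - y' k t))\<^sup>2 \<le> Q1 t / 4 ^ k"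
    have n: "norm (y' (Suc k) t - y' k t) \<le> sqrt (Q1 t) / 2 ^ k" for k
      using q Q1(2) by (intro sq_le_dyadic) auto
    have "convergent (\<lambda>k. y' k t)" by (rule convergent_if_dyadic[OF n])
    then have "(\<lambda>k. y' k t) \<longlonglongrightarrow> y t" unfolding y_def by (simp add: convergent_LIMSEQ_iff)
    moreover have "(norm (y' k t))\<^sup>2 \<le> W t" for k
    proof -
      have "(norm (y' k t - y' 0 t))\<^sup>2 \<le> (2 * sqrt (Q1 t))\<^sup>2"
        by (intro power_mono convergent_if_dyadic(2)[OF n]) auto
      also have "\<dots> = 4 * Q1 t" using Q1(2) by (simp add: power_mult_distrib)
      finally have d: "(norm (y' k t - y' 0 t))\<^sup>2 \<le> 4 * Q1 t" .
      have "(norm ((y' k t - y' 0 t) - (- y' 0 t)))\<^sup>2 \<le> 2 * ((norm (y' k t - y' 0 t))\<^sup>2 + (norm (- y' 0 t))\<^sup>2)"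
        by (rule norm_diff_sq)
      then show ?thesis using d unfolding W_def by simp
    qed
    ultimately show "(\<lambda>k. y' k t) \<longlonglongrightarrow> y t \<and> (\<forall>k. (norm (y' k t))\<^sup>2 \<le> W t)" by blast
  qed
  have limU': "(\<lambda>k. U k t) \<longlonglongrightarrow> u t" if "t \<in> I" for t
    using tendsto_uniform_limitI[OF limU that] .
  have limF': "(\<lambda>k. F k t) \<longlonglongrightarrow> f t" if "t \<in> I" for t
    using tendsto_uniform_limitI[OF limF that] .
  have aeI: "AE t in lebesgue_on I. t \<in> I" using AE_space[of "lebesgue_on I"] by simp
  have aeZ: "AE t in lebesgue_on I. (\<lambda>k. z k t) \<longlonglongrightarrow> (u t, y t)"
    using aeY Q2(1) aeI
  proof eventually_elim
    fix t assume y: "(\<lambda>k. y' k t) \<longlonglongrightarrow> y t \<and> (\<forall>k. (norm (y' k t))\<^sup>2 \<le> W t)"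
      and q: "\<forall>k. (norm (\<epsilon> k *\<^sub>R A (\<epsilon> k) (U k t)))\<^sup>2 \<le> Q2 t / 4 ^ k" and t: "t \<in> I"
    have n: "norm (\<epsilon> k *\<^sub>R A (\<epsilon> k) (U k t)) \<le> sqrt (Q2 t) * (1/2) ^ k" for k
      using sq_le_dyadic[of "\<epsilon> k *\<^sub>R A (\<epsilon> k) (U k t)"] q Q2(2) by (simp add: power_divide)
    have "(\<lambda>k. sqrt (Q2 t) * (1/2::real) ^ k) \<longlonglongrightarrow> sqrt (Q2 t) * 0"
      by (intro tendsto_mult tendsto_const LIMSEQ_power_zero) simp
    then have "(\<lambda>k. sqrt (Q2 t) * (1/2::real) ^ k) \<longlonglongrightarrow> 0" by simp
    from Lim_null_comparison[OF always_eventually[OF allI[OF n]] this]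
    have "(\<lambda>k. \<epsilon> k *\<^sub>R A (\<epsilon> k) (U k t)) \<longlonglongrightarrow> 0" .
    then have "(\<lambda>k. J (\<epsilon> k) (U k t)) \<longlonglongrightarrow> u t - 0"
      unfolding J_eq[OF e] by (intro tendsto_diff limU' t)
    then show "(\<lambda>k. z k t) \<longlonglongrightarrow> (u t, y t)" unfolding z_def using y by (auto intro!: tendsto_Pair)
  qed
  have inty: "integrable (lebesgue_on I) (\<lambda>t. (norm (y t))\<^sup>2)"
  proof (rule integrable_dominated_convergence[where w=W and s="\<lambda>k t. (norm (y' k t))\<^sup>2"])
    have m: "(\<lambda>t. (norm (y' k t))\<^sup>2) \<in> borel_measurable (lebesgue_on I)" for k
      by (intro continuous_imp_measurable_on_sets_lebesgue Is continuous_intros cY)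
    show "(\<lambda>t. (norm (y' k t))\<^sup>2) \<in> borel_measurable (lebesgue_on I)" for k by (rule m)
    show ae: "AE t in lebesgue_on I. (\<lambda>k. (norm (y' k t))\<^sup>2) \<longlonglongrightarrow> (norm (y t))\<^sup>2"
      using aeY by eventually_elim (auto intro!: tendsto_intros)
    show "(\<lambda>t. (norm (y t))\<^sup>2) \<in> borel_measurable (lebesgue_on I)"
      by (rule borel_measurable_LIMSEQ_AE[OF m ae Is])
    show "AE t in lebesgue_on I. norm ((norm (y' k t))\<^sup>2) \<le> W t" for k
      using aeY by eventually_elim auto
  qed (rule W)
  have measy: "(\<lambda>t. y t \<bullet> h) \<in> borel_measurable (lebesgue_on I)" for h
  proof (rule borel_measurable_LIMSEQ_AE[OF _ _ Is])
    show "(\<lambda>t. y' k t \<bullet> h) \<in> borel_measurable (lebesgue_on I)" for k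
      by (intro continuous_imp_measurable_on_sets_lebesgue Is continuous_intros cY)
    show "AE t in lebesgue_on I. (\<lambda>k. y' k t \<bullet> h) \<longlonglongrightarrow> y t \<bullet> h"
      using aeY by eventually_elim (auto intro!: tendsto_intros)
  qed
  have identity: "(LINT t|lebesgue_on I. (u t \<bullet> h1) * \<phi>' t + (- a (l (u t)) * (y t \<bullet> h2) + f t \<bullet> h1) * \<phi> t) = 0"
    if h: "(h1, h2) \<in> G" and \<phi>: "\<And>t. t \<in> I \<Longrightarrow> (\<phi> has_real_derivative \<phi>' t) (at t within I)"
      and c\<phi>': "continuous_on I \<phi>'" and \<phi>0: "\<phi> 0 = 0" "\<phi> T = 0" for h1 h2 \<phi> \<phi>'
  proof -
    have c\<phi>: "continuous_on I \<phi>"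
      using \<phi> DERIV_continuous_on by blast
    define s where "s = (\<lambda>k t. (U k t \<bullet> h1) * \<phi>' t + (- a (l (U k t)) * (y' k t \<bullet> h2) + F k t \<bullet> h1) * \<phi> t)"
    have cs: "continuous_on I (s k)" for k
      unfolding s_def
      by (intro continuous_intros cU cY F c\<phi> c\<phi>' continuous_on_compose2[OF continuous_a_l cU]) auto
    have int0: "integral\<^sup>L (lebesgue_on I) (s k) = 0" for k
    proof -
      have "((\<lambda>t. (U k t \<bullet> h1) * \<phi> t) has_vector_derivative s k t) (at t within I)" if t: "t \<in> I" for t
      proof -
        have "((\<lambda>t. U k t \<bullet> h1) has_real_derivative (- a (l (U k t)) *\<^sub>R A (\<epsilon> k) (U k t) + F k t) \<bullet> h1) (at t within I)"
          unfolding has_real_derivative_iff_has_vector_derivative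
          by (rule bounded_linear.has_vector_derivative[OF bounded_linear_inner_left U[OF t]])
        from DERIV_mult[OF this \<phi>[OF t]]
        show ?thesis
          unfolding has_real_derivative_iff_has_vector_derivative[symmetric]
          by (simp add: s_def y'_def inner_add_left A_weak[OF e h] algebra_simps)
      qed
      from fundamental_theorem_of_calculus[OF _ this]
      have "(s k has_integral 0) I" using T0 \<phi>0 by auto
      then show ?thesis
        using continuous_on_lebesgue_integral(2)[OF cs] by (simp add: integral_unique)
    qed
    have bdd: "\<exists>B. \<forall>t\<in>I. \<bar>g t\<bar> \<le> B" if "continuous_on I g" for g :: "real \<Rightarrow> real"
      using compact_imp_bounded[OF compact_continuous_image[OF that compact_Icc]] by (auto simp: bounded_iff)
    obtain B1 where B1: "\<And>t. t \<in> I \<Longrightarrow> \<bar>\<phi> t\<bar> \<le> B1" using bdd[OF c\<phi>] by blast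
    obtain B2 where B2: "\<And>t. t \<in> I \<Longrightarrow> \<bar>\<phi>' t\<bar> \<le> B2" using bdd[OF c\<phi>'] by blast
    have B0: "0 \<le> B1" "0 \<le> B2" using B1[OF T(1)] B2[OF T(1)] by linarith+
    have R0: "0 \<le> R" "0 \<le> R'" using bd(1)[OF T(1), of 0] bd(2)[OF T(1), of 0]
      by (auto intro: order_trans[OF zero_le_power2] order_trans[OF norm_ge_zero])
    define w where "w = (\<lambda>t. (sqrt R * norm h1) * B2 + (a_bound R * ((1 + W t) * norm h2) + R' * norm h1) * B1)"
    have "(\<lambda>k. integral\<^sup>L (lebesgue_on I) (s k)) \<longlonglongrightarrow>
        (LINT t|lebesgue_on I. (u t \<bullet> h1) * \<phi>' t + (- a (l (u t)) * (y t \<bullet> h2) + f t \<bullet> h1) * \<phi> t)"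
    proof (rule integral_dominated_convergence[where w=w])
      have m: "s k \<in> borel_measurable (lebesgue_on I)" for k
        by (intro continuous_imp_measurable_on_sets_lebesgue Is cs)
      show "s k \<in> borel_measurable (lebesgue_on I)" for k by (rule m)
      show ae: "AE t in lebesgue_on I. (\<lambda>k. s k t) \<longlonglongrightarrow> (u t \<bullet> h1) * \<phi>' t + (- a (l (u t)) * (y t \<bullet> h2) + f t \<bullet> h1) * \<phi> t"
        using aeY aeI
      proof eventually_elim
        fix t assume "(\<lambda>k. y' k t) \<longlonglongrightarrow> y t \<and> (\<forall>k. (norm (y' k t))\<^sup>2 \<le> W t)" and t: "t \<in> I"
        then have 1: "(\<lambda>k. y' k t) \<longlonglongrightarrow> y t" by blast
        have 2: "(\<lambda>k. a (l (U k t))) \<longlonglongrightarrow> a (l (u t))"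
          using continuous_on_tendsto_compose[OF continuous_a_l limU'[OF t]] by auto
        show "(\<lambda>k. s k t) \<longlonglongrightarrow> (u t \<bullet> h1) * \<phi>' t + (- a (l (u t)) * (y t \<bullet> h2) + f t \<bullet> h1) * \<phi> t"
          unfolding s_def by (intro tendsto_intros 1 2 limU' limF' t)
      qed
      show "(\<lambda>t. (u t \<bullet> h1) * \<phi>' t + (- a (l (u t)) * (y t \<bullet> h2) + f t \<bullet> h1) * \<phi> t) \<in> borel_measurable (lebesgue_on I)"
        by (rule borel_measurable_LIMSEQ_AE[OF m ae Is])
      show "integrable (lebesgue_on I) w"
        unfolding w_def
        by (intro Bochner_Integration.integrable_add integrable_mult_left integrable_mult_right W
            continuous_on_lebesgue_integral(1) continuous_on_const)
      show "AE t in lebesgue_on I. norm (s k t) \<le> w t" for k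
        using aeY aeI
      proof eventually_elim
        fix t assume "(\<lambda>k. y' k t) \<longlonglongrightarrow> y t \<and> (\<forall>k. (norm (y' k t))\<^sup>2 \<le> W t)" and t: "t \<in> I"
        then have "(norm (y' k t))\<^sup>2 \<le> W t" by blast
        then have ny: "norm (y' k t) \<le> 1 + W t"
          using sum_squares_bound[of 1 "norm (y' k t)"] norm_ge_zero[of "y' k t"]
          unfolding power_one mult_1_right by linarith
        have nU: "norm (U k t) \<le> sqrt R" using bd(1)[OF t] by (rule real_le_rsqrt)
        have 1: "\<bar>(U k t \<bullet> h1) * \<phi>' t\<bar> \<le> (sqrt R * norm h1) * B2"
          unfolding abs_mult
          by (intro mult_mono order_trans[OF Cauchy_Schwarz_ineq2] B2 t nU mult_right_mono) (auto simp: B0 R0)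
        have 2: "\<bar>a (l (U k t)) * (y' k t \<bullet> h2)\<bar> \<le> a_bound R * ((1 + W t) * norm h2)"
          unfolding abs_mult
          using a_le[OF bd(1)[OF t], of k] a_pos[of "l (U k t)"] W0[of t]
          by (intro mult_mono order_trans[OF Cauchy_Schwarz_ineq2] mult_right_mono ny) auto
        have 3: "\<bar>F k t \<bullet> h1\<bar> \<le> R' * norm h1"
          by (intro order_trans[OF Cauchy_Schwarz_ineq2] mult_right_mono bd(2) t) auto
        have "\<bar>(- a (l (U k t)) * (y' k t \<bullet> h2) + F k t \<bullet> h1) * \<phi> t\<bar> \<le> (a_bound R * ((1 + W t) * norm h2) + R' * norm h1) * B1"
          unfolding abs_mult[of _ "\<phi> t"]
          using 2 3 by (intro mult_mono B1 t) linarith+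
        then show "norm (s k t) \<le> w t" using 1 unfolding s_def w_def real_norm_def by linarith
      qed
    qed
    then show ?thesis using int0 by (simp add: LIMSEQ_const_iff)
  qed
  have "weak_solution u y f"
    unfolding weak_solution_def
  proof (intro conjI allI impI cu inty measy exI[of _ z] aeZ)
    show "continuous_on I (z k)" for k unfolding z_def by (intro continuous_intros cJ cY)
    show "z k ` I \<subseteq> G" for k using resolvent_spec(1)[OF e] by (auto simp: z_def y'_def)
  qed (use identity in blast)
  then show ?thesis by blast
qed

end

text \<open>
  The tail of a geometric series, applied to the shifted sequence.
\<close>
lemma dyadic_limit_bound:
  fixes x :: "nat \<Rightarrow> 'b::banach"
  assumes "\<And>k. norm (x (Suc k) - x k) \<le> c / 2 ^ k"
  shows "norm (lim x - x k) \<le> 2 * c / 2 ^ k"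
proof -
  have "norm (x (j + k) - x (0 + k)) \<le> 2 * (c / 2 ^ k)" for j
  proof (rule convergent_if_dyadic(2)[where x="\<lambda>j. x (j + k)"])
    show "norm (x (Suc j + k) - x (j + k)) \<le> (c / 2 ^ k) / 2 ^ j" for j
      using assms[of "j + k"] by (simp add: power_add mult.commute)
  qed
  moreover have "x \<longlonglongrightarrow> lim x"
    using convergent_if_dyadic(1)[of x c] assms by (simp add: convergent_LIMSEQ_iff)
  then have "(\<lambda>j. norm (x (j + k) - x (0 + k))) \<longlonglongrightarrow> norm (lim x - x (0 + k))"
    by (intro tendsto_intros LIMSEQ_ignore_initial_segment)
  ultimately have "norm (lim x - x (0 + k)) \<le> 2 * (c / 2 ^ k)"
    by (intro LIMSEQ_le_const2) auto
  then show ?thesis by simp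
qed

lemma uniform_limit_dyadic:
  fixes x :: "nat \<Rightarrow> 'a \<Rightarrow> 'b::banach"
  assumes "\<And>k t. t \<in> S \<Longrightarrow> norm (x (Suc k) t - x k t) \<le> c / 2 ^ k"
  shows "uniform_limit S x (\<lambda>t. lim (\<lambda>k. x k t)) sequentially"
proof (rule uniform_limitI)
  fix e :: real assume e: "e > 0"
  have le: "dist (x k t) (lim (\<lambda>k. x k t)) \<le> 2 * c * (1/2) ^ k" if t: "t \<in> S" for k t
    using dyadic_limit_bound[of "\<lambda>k. x k t" c k] assms[OF t]
    by (simp add: dist_norm norm_minus_commute power_divide)
  have "(\<lambda>k. 2 * c * (1/2::real) ^ k) \<longlonglongrightarrow> 2 * c * 0"
    by (intro tendsto_mult tendsto_const LIMSEQ_power_zero) simp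
  then have "\<forall>\<^sub>F k in sequentially. 2 * c * (1/2::real) ^ k < e"
    using e by (intro order_tendstoD) auto
  then show "\<forall>\<^sub>F k in sequentially. \<forall>t\<in>S. dist (x k t) (lim (\<lambda>k. x k t)) < e"
    by eventually_elim (use le in \<open>auto intro: order_le_less_trans\<close>)
qed

lemma uniform_limit_lipschitz_comp:
  fixes N :: "'b::real_normed_vector \<Rightarrow> 'c::real_normed_vector"
  assumes N: "\<And>x y. norm (N x - N y) \<le> L * norm (x - y)" and w: "uniform_limit S w w' F"
  shows "uniform_limit S (\<lambda>k t. N (w k t)) (\<lambda>t. N (w' t)) F"
proof (rule uniform_limitI)
  fix e :: real assume e: "e > 0"
  have "\<forall>\<^sub>F k in F. \<forall>t\<in>S. dist (w k t) (w' t) < e / (\<bar>L\<bar> + 1)"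
    using w e by (intro uniform_limitD) auto
  then show "\<forall>\<^sub>F k in F. \<forall>t\<in>S. dist (N (w k t)) (N (w' t)) < e"
  proof (eventually_elim, intro ballI)
    fix k t assume "\<forall>t\<in>S. dist (w k t) (w' t) < e / (\<bar>L\<bar> + 1)" and t: "t \<in> S"
    then have d: "norm (w k t - w' t) < e / (\<bar>L\<bar> + 1)" by (simp add: dist_norm)
    have "norm (N (w k t) - N (w' t)) \<le> L * norm (w k t - w' t)" by (rule N)
    also have "\<dots> \<le> (\<bar>L\<bar> + 1) * norm (w k t - w' t)" by (intro mult_right_mono) auto
    also have "\<dots> < (\<bar>L\<bar> + 1) * (e / (\<bar>L\<bar> + 1))" using d by (intro mult_strict_left_mono) auto
    finally show "dist (N (w k t)) (N (w' t)) < e" by (simp add: dist_norm)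
  qed
qed

section \<open>Existence of weak solutions of the abstract system\<close>

context nonlocal_system
begin

lemma approximate_initial_data:
  assumes "x0 \<in> closure (fst ` G)"
  shows "\<exists>x g. \<forall>k::nat. (x k, g k) \<in> G \<and> (norm (x k - x0))\<^sup>2 \<le> 1 / 8 ^ k"
proof -
  have "\<exists>x g. (x, g) \<in> G \<and> (norm (x - x0))\<^sup>2 \<le> 1 / 8 ^ k" for k :: nat
  proof -
    have "sqrt (1 / 8 ^ k) > 0" by simp
    then have "\<exists>y\<in>fst ` G. dist y x0 < sqrt (1 / 8 ^ k)"
      using assms unfolding closure_approachable by blast
    then obtain z where z: "z \<in> G" "dist (fst z) x0 < sqrt (1 / 8 ^ k)" by auto
    have "(norm (fst z - x0))\<^sup>2 \<le> (sqrt (1 / 8 ^ k))\<^sup>2"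
      using z(2) by (intro power_mono) (auto simp: dist_norm)
    then show ?thesis using z(1) by (intro exI[of _ "fst z"] exI[of _ "snd z"]) auto
  qed
  then show ?thesis by metis
qed

text \<open>
  Initial values with a gradient approximate the given ones at the rate \<open>1 / 8 ^ k\<close>. Their
  gradients may blow up, and the Yosida parameters are chosen afterwards to compensate. Only
  consecutive approximations are compared, for which the difference estimate gives a geometric
  rate.
\<close>
theorem weak_solution_exists:
  assumes x0: "x0 \<in> closure (fst ` G)" and y0: "y0 \<in> closure (fst ` G)"
  shows "\<exists>u v p q. weak_solution u p (\<lambda>t. N (u t - v t)) \<and> weak_solution v q (\<lambda>t. - N (u t - v t)) \<and>
    u 0 = x0 \<and> v 0 = y0"
proof -
  obtain x g where x: "\<And>k. (x k, g k) \<in> G" "\<And>k::nat. (norm (x k - x0))\<^sup>2 \<le> 1 / 8 ^ k"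
    using approximate_initial_data[OF x0] by blast
  obtain y h where y: "\<And>k. (y k, h k) \<in> G" "\<And>k::nat. (norm (y k - y0))\<^sup>2 \<le> 1 / 8 ^ k"
    using approximate_initial_data[OF y0] by blast
  define S where "S = 4 + 2 * (norm x0)\<^sup>2 + 2 * (norm y0)\<^sup>2"
  have S: "(norm (x k))\<^sup>2 + (norm (y k))\<^sup>2 \<le> S" for k
  proof -
    have p: "(1::real) / 8 ^ k \<le> 1" by simp
    have "(norm (x k))\<^sup>2 \<le> 2 * ((norm (x k - x0))\<^sup>2 + (norm (- x0))\<^sup>2)"
      using norm_diff_sq[of "x k - x0" "- x0"] by simp
    moreover have "(norm (y k))\<^sup>2 \<le> 2 * ((norm (y k - y0))\<^sup>2 + (norm (- y0))\<^sup>2)"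
      using norm_diff_sq[of "y k - y0" "- y0"] by simp
    ultimately show ?thesis unfolding S_def norm_minus_cancel
      using x(2)[of k] y(2)[of k] p by argo
  qed
  have S0: "0 \<le> S" by (simp add: S_def)
  have bS: "0 \<le> bound_sq S" using S0 T0 by (simp add: bound_sq_def)
  \<comment> \<open>The bound on the dissipation of the k-th approximation; it may grow with k because the initial value has no gradient in general.\<close>
  define K where "K = (\<lambda>k. ((norm (g k))\<^sup>2 + (norm (h k))\<^sup>2 + T * (2 * (2 * (norm (N 0))\<^sup>2 + 4 * L\<^sup>2 * bound_sq S) / m)) / m)"
  have K0: "0 \<le> K k" for k using m0 T0 bS by (simp add: K_def)
  define \<kappa> where "\<kappa> = (\<lambda>k. (K k + K (Suc k) + 1) * 8 ^ k)"
  have \<kappa>1: "1 \<le> \<kappa> k" for k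
  proof -
    have "1 * 1 \<le> (K k + K (Suc k) + 1) * 8 ^ k" using K0[of k] K0[of "Suc k"] by (intro mult_mono) auto
    then show ?thesis by (simp add: \<kappa>_def)
  qed
  \<comment> \<open>The parameters decrease, and each is so small against the dissipation bounds of its own and the next approximation that their product is at most \<open>1 / 8 ^ k\<close>.\<close>
  define \<epsilon> where "\<epsilon> = (\<lambda>k. 1 / (\<Sum>j\<le>k. \<kappa> j))"
  have \<kappa>0: "0 \<le> \<kappa> k" for k using \<kappa>1[of k] by linarith
  have sum\<kappa>: "\<kappa> k \<le> (\<Sum>j\<le>k. \<kappa> j)" for k
    by (rule member_le_sum) (use \<kappa>0 in auto)
  have sp: "0 < (\<Sum>j\<le>k. \<kappa> j)" for k using sum\<kappa>[of k] \<kappa>1[of k] by linarith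
  have \<epsilon>: "0 < \<epsilon> k" for k using sp by (simp add: \<epsilon>_def)
  have \<epsilon>mono: "\<epsilon> (Suc k) \<le> \<epsilon> k" for k
    unfolding \<epsilon>_def using sp[of k] \<kappa>0[of "Suc k"] by (intro divide_left_mono) (auto intro!: mult_pos_pos add_pos_nonneg)
  have \<epsilon>K: "\<epsilon> k * (K k + K (Suc k) + 1) \<le> 1 / 8 ^ k" for k
  proof -
    have "\<epsilon> k \<le> 1 / \<kappa> k" unfolding \<epsilon>_def using sum\<kappa>[of k] \<kappa>1[of k] sp[of k] by (intro divide_left_mono) auto
    then have "\<epsilon> k * (K k + K (Suc k) + 1) \<le> 1 / \<kappa> k * (K k + K (Suc k) + 1)"
      using K0[of k] K0[of "Suc k"] by (intro mult_right_mono) auto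
    also have "\<dots> = 1 / 8 ^ k" unfolding \<kappa>_def using K0[of k] K0[of "Suc k"] by (simp add: add_nonneg_eq_0_iff)
    finally show ?thesis .
  qed
  have \<epsilon>1: "\<epsilon> k \<le> 1" for k
  proof -
    have "\<epsilon> k * 1 \<le> \<epsilon> k * (K k + K (Suc k) + 1)"
      using \<epsilon>[of k] K0[of k] K0[of "Suc k"] by (intro mult_left_mono) auto
    also have "\<dots> \<le> 1 / 8 ^ k" by (rule \<epsilon>K)
    also have "(1::real) / 8 ^ k \<le> 1" by simp
    finally show ?thesis by simp
  qed
  have "\<forall>k. \<exists>u v. yosida_solution (\<epsilon> k) u v \<and> u 0 = x k \<and> v 0 = y k"
    using yosida_exists[OF \<epsilon>] by blast
  then obtain U V where UV: "\<And>k. yosida_solution (\<epsilon> k) (U k) (V k)" "\<And>k. U k 0 = x k" "\<And>k. V k 0 = y k"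
    by metis
  have SUV: "(norm (U k 0))\<^sup>2 + (norm (V k 0))\<^sup>2 \<le> S" for k using S UV by simp
  define IA where "IA = (\<lambda>k. integral I (\<lambda>t. (norm (A (\<epsilon> k) (U k t)))\<^sup>2 + (norm (A (\<epsilon> k) (V k t)))\<^sup>2))"
  have IA: "IA k \<le> K k" for k
    unfolding IA_def K_def by (rule yosida_A_bound[OF \<epsilon> UV(1) SUV]) (use UV x y in auto)
  note co = yosida_continuous_ops[OF \<epsilon> UV(1)] yosida_continuous[OF UV(1)]
  define B where "B = a_bound (bound_sq S)"
  have B0: "0 \<le> B" using bS M0 \<Lambda>0 by (simp add: B_def a_bound_def)
  define \<Gamma> where "\<Gamma> = 4 * L * T + (M * \<Lambda>)\<^sup>2 / m * ((S + T * (4 * (L + 1) * bound_sq S + (norm (N 0))\<^sup>2)) / (2 * m))"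
  have \<Gamma>0: "0 \<le> \<Gamma>" unfolding \<Gamma>_def using L0 T0 m0 S0 bS by simp
  define E where "E = (\<lambda>k t. (norm (U (Suc k) t - U k t))\<^sup>2 + (norm (V (Suc k) t - V k t))\<^sup>2)"
  define Q where "Q = (\<lambda>k. E k 0 + 4 * B * \<epsilon> k * (IA (Suc k) + IA k))"
  have Q: "Q k \<le> (8 + 4 * B) / 8 ^ k" for k
  proof -
    have *: "(norm (w (Suc k) - w k))\<^sup>2 \<le> 4 / 8 ^ k" if w: "\<And>k::nat. (norm (w k - w0))\<^sup>2 \<le> 1 / 8 ^ k" for w :: "nat \<Rightarrow> 'h" and w0
    proof -
      have "(norm (w (Suc k) - w k))\<^sup>2 = (norm ((w (Suc k) - w0) - (w k - w0)))\<^sup>2" by simp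
      also have "\<dots> \<le> 2 * ((norm (w (Suc k) - w0))\<^sup>2 + (norm (w k - w0))\<^sup>2)" by (rule norm_diff_sq)
      also have "\<dots> \<le> 2 * (1 / 8 ^ Suc k + 1 / 8 ^ k)" by (intro mult_left_mono add_mono w) auto
      also have "\<dots> \<le> 4 / 8 ^ k" by (simp add: field_simps)
      finally show ?thesis .
    qed
    have "E k 0 \<le> 4 / 8 ^ k + 4 / 8 ^ k"
      unfolding E_def UV by (intro add_mono *[OF x(2)] *[OF y(2)])
    moreover have "\<epsilon> k * (IA (Suc k) + IA k) \<le> 1 / 8 ^ k"
    proof -
      have "\<epsilon> k * (IA (Suc k) + IA k) \<le> \<epsilon> k * (K k + K (Suc k) + 1)"
        using IA[of k] IA[of "Suc k"] \<epsilon>[of k] by (intro mult_left_mono) auto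
      then show ?thesis using \<epsilon>K[of k] by linarith
    qed
    then have "4 * B * (\<epsilon> k * (IA (Suc k) + IA k)) \<le> 4 * B * (1 / 8 ^ k)"
      using B0 by (intro mult_left_mono) auto
    ultimately show ?thesis unfolding Q_def by (simp add: add_divide_distrib mult.assoc)
  qed
  define C1 where "C1 = exp \<Gamma> * (8 + 4 * B)"
  define C2 where "C2 = (1 + \<Gamma> * exp \<Gamma>) * (8 + 4 * B) / m"
  have Et: "E k t \<le> C1 / 8 ^ k" if "t \<in> I" for k t
  proof -
    have "E k t \<le> exp \<Gamma> * Q k"
      unfolding E_def Q_def \<Gamma>_def B_def IA_def
      by (rule yosida_difference(1)[OF \<epsilon> \<epsilon> \<epsilon>mono order_refl UV(1) UV(1) SUV SUV that])
    also have "\<dots> \<le> exp \<Gamma> * ((8 + 4 * B) / 8 ^ k)" by (intro mult_left_mono Q) auto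
    finally show ?thesis by (simp add: C1_def)
  qed
  have Eint: "integral I (\<lambda>t. (norm (Y (\<epsilon> (Suc k)) (U (Suc k) t) - Y (\<epsilon> k) (U k t)))\<^sup>2
      + (norm (Y (\<epsilon> (Suc k)) (V (Suc k) t) - Y (\<epsilon> k) (V k t)))\<^sup>2) \<le> C2 / 8 ^ k" (is "?i \<le> _") for k
  proof -
    have "?i \<le> (1 + \<Gamma> * exp \<Gamma>) * Q k / m"
      unfolding E_def Q_def \<Gamma>_def B_def IA_def
      by (rule yosida_difference(2)[OF \<epsilon> \<epsilon> \<epsilon>mono order_refl UV(1) UV(1) SUV SUV])
    also have "\<dots> \<le> (1 + \<Gamma> * exp \<Gamma>) * ((8 + 4 * B) / 8 ^ k) / m"
      using \<Gamma>0 m0 by (intro divide_right_mono mult_left_mono Q) auto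
    finally show ?thesis by (simp add: C2_def mult.commute)
  qed
  have C10: "0 \<le> C1" using B0 by (simp add: C1_def)
  have C20: "0 \<le> C2" using B0 \<Gamma>0 m0 by (simp add: C2_def)
  have d84: "C / 8 ^ k \<le> C / 4 ^ k" if "0 \<le> C" for C :: real and k :: nat
    using that by (intro divide_left_mono power_mono) auto
  have dU: "norm (U (Suc k) t - U k t) \<le> sqrt C1 / 2 ^ k" "norm (V (Suc k) t - V k t) \<le> sqrt C1 / 2 ^ k" if "t \<in> I" for k t
    using Et[OF that, of k] d84[OF C10, of k] zero_le_power2[of "norm (U (Suc k) t - U k t)"] zero_le_power2[of "norm (V (Suc k) t - V k t)"]
    unfolding E_def by (intro sq_le_dyadic C10; linarith)+
  define u where "u = (\<lambda>t. lim (\<lambda>k. U k t))"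
  define v where "v = (\<lambda>t. lim (\<lambda>k. V k t))"
  have limU: "uniform_limit I U u sequentially" and limV: "uniform_limit I V v sequentially"
    unfolding u_def v_def by (rule uniform_limit_dyadic[OF dU(1)] uniform_limit_dyadic[OF dU(2)]; assumption)+
  have limN: "uniform_limit I (\<lambda>k t. N (U k t - V k t)) (\<lambda>t. N (u t - v t)) sequentially"
    by (rule uniform_limit_lipschitz_comp[OF N_lip uniform_limit_minus[OF limU limV]])
  have limN': "uniform_limit I (\<lambda>k t. - N (U k t - V k t)) (\<lambda>t. - N (u t - v t)) sequentially"
    by (rule uniform_limit_lipschitz_comp[of "\<lambda>w. - N w" L, OF _ uniform_limit_minus[OF limU limV]])
      (use N_lip in \<open>simp add: norm_minus_commute\<close>)
  have contN: "continuous_on I (\<lambda>t. N (U k t - V k t))" for k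
  proof -
    have "continuous_on UNIV N"
      using lipschitz_on_continuous_on[of L UNIV N] N_lip L0 by (auto simp: lipschitz_on_def dist_norm)
    then show ?thesis by (rule continuous_on_compose2) (intro continuous_intros co, auto)
  qed
  have bd: "(norm (U k t))\<^sup>2 + (norm (V k t))\<^sup>2 \<le> bound_sq S" if "t \<in> I" for k t
    using order_trans[OF yosida_bound[OF \<epsilon> UV(1) that] bound_sq_mono[OF SUV]] .
  have bdU: "(norm (U k t))\<^sup>2 \<le> bound_sq S" "(norm (V k t))\<^sup>2 \<le> bound_sq S" if "t \<in> I" for k t
    using bd[OF that, of k] zero_le_power2[of "norm (U k t)"] zero_le_power2[of "norm (V k t)"] by linarith+
  define R' where "R' = sqrt (2 * (norm (N 0))\<^sup>2 + 4 * L\<^sup>2 * bound_sq S)"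
  have bdN: "norm (N (U k t - V k t)) \<le> R'" if "t \<in> I" for k t
    unfolding R'_def by (rule real_le_rsqrt[OF N_bound[OF bd[OF that]]])
  have split: "integral I f \<le> integral I (\<lambda>t. f t + g t)" "integral I g \<le> integral I (\<lambda>t. f t + g t)"
    if "continuous_on I f" "continuous_on I g" "\<And>t. 0 \<le> f t" "\<And>t. 0 \<le> g t" for f g :: "real \<Rightarrow> real"
    by (intro integral_le integrable_continuous_interval continuous_intros that; use that in simp)+
  define C where "C = C2 + 1"
  have CC: "C2 / 8 ^ k \<le> C / 8 ^ k" "1 / 8 ^ k \<le> C / 8 ^ k" for k :: nat
    using C20 by (auto simp: C_def intro!: divide_right_mono)
  have dA: "integral I (\<lambda>t. (norm (\<epsilon> k *\<^sub>R A (\<epsilon> k) (U k t)))\<^sup>2) \<le> C / 8 ^ k"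
    "integral I (\<lambda>t. (norm (\<epsilon> k *\<^sub>R A (\<epsilon> k) (V k t)))\<^sup>2) \<le> C / 8 ^ k" for k
  proof -
    have eq: "(norm (\<epsilon> k *\<^sub>R w))\<^sup>2 = (\<epsilon> k)\<^sup>2 * (norm w)\<^sup>2" for w :: 'h
      by (simp add: power_mult_distrib)
    have i: "(\<epsilon> k)\<^sup>2 * IA k \<le> 1 / 8 ^ k"
    proof -
      have "(\<epsilon> k)\<^sup>2 * IA k \<le> \<epsilon> k * (\<epsilon> k * (K k + K (Suc k) + 1))"
        unfolding power2_eq_square mult.assoc using IA[of k] K0[of "Suc k"] \<epsilon>[of k] by (intro mult_left_mono) auto
      also have "\<dots> \<le> 1 * (1 / 8 ^ k)" using \<epsilon>[of k] K0[of "Suc k"] K0[of k] by (intro mult_mono \<epsilon>1 \<epsilon>K) auto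
      finally show ?thesis by simp
    qed
    have "(\<epsilon> k)\<^sup>2 * integral I (\<lambda>t. (norm (A (\<epsilon> k) (U k t)))\<^sup>2) \<le> (\<epsilon> k)\<^sup>2 * IA k"
      "(\<epsilon> k)\<^sup>2 * integral I (\<lambda>t. (norm (A (\<epsilon> k) (V k t)))\<^sup>2) \<le> (\<epsilon> k)\<^sup>2 * IA k"
      unfolding IA_def by (intro mult_left_mono split continuous_intros co; simp)+
    then show "integral I (\<lambda>t. (norm (\<epsilon> k *\<^sub>R A (\<epsilon> k) (U k t)))\<^sup>2) \<le> C / 8 ^ k"
      "integral I (\<lambda>t. (norm (\<epsilon> k *\<^sub>R A (\<epsilon> k) (V k t)))\<^sup>2) \<le> C / 8 ^ k"
      unfolding eq integral_mult_right using i CC(2)[of k] by linarith+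
  qed
  have dY: "integral I (\<lambda>t. (norm (Y (\<epsilon> (Suc k)) (U (Suc k) t) - Y (\<epsilon> k) (U k t)))\<^sup>2) \<le> C / 8 ^ k"
    "integral I (\<lambda>t. (norm (Y (\<epsilon> (Suc k)) (V (Suc k) t) - Y (\<epsilon> k) (V k t)))\<^sup>2) \<le> C / 8 ^ k" for k
    by (rule order_trans[OF _ order_trans[OF Eint CC(1)]], intro split continuous_intros co; simp)+
  have "\<exists>p. weak_solution u p (\<lambda>t. N (u t - v t))"
    by (rule weak_solution_limit[OF \<epsilon> _ contN limU limN bdU(1) bdN dY(1) dA(1)])
      (use UV(1) in \<open>auto simp: yosida_solution_def\<close>)
  moreover have "\<exists>q. weak_solution v q (\<lambda>t. - N (u t - v t))"
    by (rule weak_solution_limit[OF \<epsilon> _ continuous_on_minus[OF contN] limV limN' bdU(2) _ dY(2) dA(2)])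
      (use UV(1) bdN in \<open>auto simp: yosida_solution_def\<close>)
  moreover have lim0: "w \<longlonglongrightarrow> w0" if w: "\<And>k::nat. (norm (w k - w0))\<^sup>2 \<le> 1 / 8 ^ k" for w :: "nat \<Rightarrow> 'h" and w0
  proof -
    have n: "norm (w k - w0) \<le> (1/2) ^ k" for k
      using sq_le_dyadic[of "w k - w0" 1 k] order_trans[OF w d84[of 1]] by (simp add: power_divide)
    have "(\<lambda>k. (1/2::real) ^ k) \<longlonglongrightarrow> 0" by (intro LIMSEQ_power_zero) simp
    from Lim_null_comparison[OF always_eventually[OF allI[OF n]] this]
    show ?thesis by (simp add: LIM_zero_iff)
  qed
  moreover have "u 0 = x0" "v 0 = y0"
    unfolding u_def v_def UV by (rule limI[OF lim0[OF x(2)]] limI[OF lim0[OF y(2)]])+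
  ultimately show ?thesis by blast
qed

end

section \<open>The Hilbert space of square integrable functions\<close>

lemma L2_measurable: "u \<in> L2 \<Omega> \<Longrightarrow> u \<in> borel_measurable (lebesgue_on \<Omega>)"
  and L2_integrable_sq: "u \<in> L2 \<Omega> \<Longrightarrow> integrable (lebesgue_on \<Omega>) (\<lambda>x. (norm (u x))\<^sup>2)"
  by (auto simp: L2_def)

lemma L2_I:
  assumes m: "u \<in> borel_measurable (lebesgue_on \<Omega>)" and i: "integrable (lebesgue_on \<Omega>) g"
    and le: "AE x in lebesgue_on \<Omega>. (norm (u x))\<^sup>2 \<le> g x"
  shows "u \<in> L2 \<Omega>"
  unfolding L2_def
proof (intro CollectI conjI m)
  note [measurable] = m
  show "integrable (lebesgue_on \<Omega>) (\<lambda>x. (norm (u x))\<^sup>2)"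
    by (rule Bochner_Integration.integrable_bound[OF i]) (use le in \<open>measurable, auto\<close>)
qed

lemma L2_inner_integrable:
  assumes "u \<in> L2 \<Omega>" "v \<in> L2 \<Omega>"
  shows "integrable (lebesgue_on \<Omega>) (\<lambda>x. u x \<bullet> v x)"
proof (rule Bochner_Integration.integrable_bound)
  note [measurable] = assms[THEN L2_measurable]
  show "integrable (lebesgue_on \<Omega>) (\<lambda>x. (norm (u x))\<^sup>2 + (norm (v x))\<^sup>2)"
    by (intro Bochner_Integration.integrable_add assms[THEN L2_integrable_sq])
  show "(\<lambda>x. u x \<bullet> v x) \<in> borel_measurable (lebesgue_on \<Omega>)" by measurable
  have "\<bar>u x \<bullet> v x\<bar> \<le> (norm (u x))\<^sup>2 + (norm (v x))\<^sup>2" for x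
    using Cauchy_Schwarz_ineq2[of "u x" "v x"] sum_squares_bound[of "norm (u x)" "norm (v x)"]
      mult_nonneg_nonneg[OF norm_ge_zero[of "u x"] norm_ge_zero[of "v x"]] by linarith
  then show "AE x in lebesgue_on \<Omega>. norm (u x \<bullet> v x) \<le> norm ((norm (u x))\<^sup>2 + (norm (v x))\<^sup>2)"
    by (auto intro: order_trans)
qed

lemma L2_zero: "(\<lambda>x. 0) \<in> L2 \<Omega>" by (simp add: L2_def)

lemma L2_scaleR: "u \<in> L2 \<Omega> \<Longrightarrow> (\<lambda>x. c *\<^sub>R u x) \<in> L2 \<Omega>"
  by (auto simp: L2_def power_mult_distrib)

lemma L2_add:
  assumes "u \<in> L2 \<Omega>" "v \<in> L2 \<Omega>" shows "(\<lambda>x. u x + v x) \<in> L2 \<Omega>"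
proof (rule L2_I)
  note [measurable] = assms[THEN L2_measurable]
  show "(\<lambda>x. u x + v x) \<in> borel_measurable (lebesgue_on \<Omega>)" by measurable
  show "integrable (lebesgue_on \<Omega>) (\<lambda>x. 2 * ((norm (u x))\<^sup>2 + (norm (v x))\<^sup>2))"
    by (intro integrable_mult_right Bochner_Integration.integrable_add assms[THEN L2_integrable_sq])
  have "(norm (u x + v x))\<^sup>2 \<le> 2 * ((norm (u x))\<^sup>2 + (norm (v x))\<^sup>2)" for x
  proof -
    have "0 \<le> (norm (u x - v x))\<^sup>2" by simp
    then show ?thesis unfolding power2_norm_eq_inner
      by (simp add: inner_diff_left inner_diff_right inner_add_left inner_add_right inner_commute)
  qed
  then show "AE x in lebesgue_on \<Omega>. (norm (u x + v x))\<^sup>2 \<le> 2 * ((norm (u x))\<^sup>2 + (norm (v x))\<^sup>2)" by simp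
qed

lemma L2_diff: 
  assumes "u \<in> L2 \<Omega>" "v \<in> L2 \<Omega>" shows "(\<lambda>x. u x - v x) \<in> L2 \<Omega>"
  using L2_add[OF assms(1) L2_scaleR[OF assms(2), of "-1"]] by simp

lemma L2_minus: "u \<in> L2 \<Omega> \<Longrightarrow> (\<lambda>x. - u x) \<in> L2 \<Omega>"
  using L2_scaleR[of u \<Omega> "-1"] by simp

text \<open>
  Equality almost everywhere, restricted to square integrable functions. The quotient is taken over
  the whole space, so that the resulting type does not depend on a domain; a domain enters as the
  closed subspace of functions that vanish outside it.
\<close>
definition l2_eq :: "('a::euclidean_space \<Rightarrow> 'b::euclidean_space) \<Rightarrow> ('a \<Rightarrow> 'b) \<Rightarrow> bool" where
  "l2_eq f g \<longleftrightarrow> f \<in> L2 UNIV \<and> g \<in> L2 UNIV \<and> (AE x in lebesgue. f x = g x)"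

lemma l2_eq_part_equivp: "part_equivp l2_eq"
proof (rule part_equivpI)
  show "\<exists>x. l2_eq x x" by (intro exI[of _ "\<lambda>x. 0"]) (simp add: l2_eq_def L2_zero)
  show "symp l2_eq" by (auto simp: symp_def l2_eq_def elim!: eventually_mono)
  show "transp l2_eq" by (auto simp: transp_def l2_eq_def elim!: eventually_elim2)
qed

quotient_type (overloaded) ('a, 'b) l2 = "'a::euclidean_space \<Rightarrow> 'b::euclidean_space" / partial: l2_eq
  morphisms fn of_fn
  by (rule l2_eq_part_equivp)

instantiation l2 :: (euclidean_space, euclidean_space) real_inner
begin

lift_definition zero_l2 :: "('a, 'b) l2" is "\<lambda>x. 0" by (simp add: l2_eq_def L2_zero)

lift_definition plus_l2 :: "('a, 'b) l2 \<Rightarrow> ('a, 'b) l2 \<Rightarrow> ('a, 'b) l2" is "\<lambda>f g x. f x + g x"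
  unfolding l2_eq_def by (auto intro: L2_add elim!: eventually_elim2)

lift_definition minus_l2 :: "('a, 'b) l2 \<Rightarrow> ('a, 'b) l2 \<Rightarrow> ('a, 'b) l2" is "\<lambda>f g x. f x - g x"
  unfolding l2_eq_def by (auto intro: L2_diff elim!: eventually_elim2)

lift_definition uminus_l2 :: "('a, 'b) l2 \<Rightarrow> ('a, 'b) l2" is "\<lambda>f x. - f x"
  unfolding l2_eq_def by (auto intro: L2_minus elim!: eventually_mono)

lift_definition scaleR_l2 :: "real \<Rightarrow> ('a, 'b) l2 \<Rightarrow> ('a, 'b) l2" is "\<lambda>c f x. c *\<^sub>R f x"
  unfolding l2_eq_def by (auto intro: L2_scaleR elim!: eventually_mono)

lift_definition inner_l2 :: "('a, 'b) l2 \<Rightarrow> ('a, 'b) l2 \<Rightarrow> real" is "\<lambda>f g. L2_inner UNIV f g"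
  unfolding l2_eq_def L2_inner_def lebesgue_on_UNIV_eq
proof (elim conjE)
  fix f f' g g' :: "'a \<Rightarrow> 'b"
  assume ae: "AE x in lebesgue. f x = f' x" "AE x in lebesgue. g x = g' x"
    and m: "f \<in> L2 UNIV" "f' \<in> L2 UNIV" "g \<in> L2 UNIV" "g' \<in> L2 UNIV"
  note [measurable] = m[THEN L2_measurable, unfolded lebesgue_on_UNIV_eq]
  show "(LINT x|lebesgue. f x \<bullet> g x) = (LINT x|lebesgue. f' x \<bullet> g' x)"
    by (rule integral_cong_AE; (measurable)?) (use ae in eventually_elim, simp)
qed

definition norm_l2 :: "('a, 'b) l2 \<Rightarrow> real" where "norm_l2 u = sqrt (u \<bullet> u)"
definition dist_l2 :: "('a, 'b) l2 \<Rightarrow> ('a, 'b) l2 \<Rightarrow> real" where "dist_l2 u v = norm (u - v)"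
definition sgn_l2 :: "('a, 'b) l2 \<Rightarrow> ('a, 'b) l2" where "sgn_l2 u = scaleR (inverse (norm u)) u"
definition uniformity_l2 :: "(('a, 'b) l2 \<times> ('a, 'b) l2) filter" where
  "uniformity_l2 = (INF e\<in>{0 <..}. principal {(x, y). dist x y < e})"
definition open_l2 :: "('a, 'b) l2 set \<Rightarrow> bool" where
  "open_l2 U = (\<forall>x\<in>U. eventually (\<lambda>(x', y). x' = x \<longrightarrow> y \<in> U) uniformity)"

instance
proof
  fix u v w :: "('a, 'b) l2" and c d :: real
  show "u + v + w = u + (v + w)"
    by transfer (auto simp: l2_eq_def algebra_simps intro!: L2_add)
  show "u + v = v + u"
    by transfer (auto simp: l2_eq_def algebra_simps intro!: L2_add)
  show "0 + u = u"
    by transfer (auto simp: l2_eq_def)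
  show "- u + u = 0"
    by transfer (auto simp: l2_eq_def L2_zero)
  show "u - v = u + - v"
    by transfer (auto simp: l2_eq_def intro!: L2_diff)
  show "c *\<^sub>R (u + v) = c *\<^sub>R u + c *\<^sub>R v"
    by transfer (auto simp: l2_eq_def algebra_simps intro!: L2_add L2_scaleR)
  show "(c + d) *\<^sub>R u = c *\<^sub>R u + d *\<^sub>R u"
    by transfer (auto simp: l2_eq_def algebra_simps intro!: L2_add L2_scaleR)
  show "c *\<^sub>R d *\<^sub>R u = (c * d) *\<^sub>R u"
    by transfer (auto simp: l2_eq_def intro!: L2_scaleR)
  show "1 *\<^sub>R u = u"
    by transfer (auto simp: l2_eq_def)
  show "u \<bullet> v = v \<bullet> u"
    by transfer (simp add: L2_inner_def inner_commute)
  show "(u + v) \<bullet> w = u \<bullet> w + v \<bullet> w"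
    by transfer (auto simp: l2_eq_def L2_inner_def inner_add_left intro!: Bochner_Integration.integral_add L2_inner_integrable)
  show "c *\<^sub>R u \<bullet> v = c * (u \<bullet> v)"
    by transfer (simp add: L2_inner_def)
  show "0 \<le> u \<bullet> u"
    by transfer (simp add: L2_inner_def)
  show "u \<bullet> u = 0 \<longleftrightarrow> u = 0"
  proof transfer
    fix f :: "'a \<Rightarrow> 'b" assume "l2_eq f f"
    then have f: "f \<in> L2 UNIV" by (simp add: l2_eq_def)
    have "L2_inner UNIV f f = 0 \<longleftrightarrow> (AE x in lebesgue. f x \<bullet> f x = 0)"
      unfolding L2_inner_def lebesgue_on_UNIV_eq
      using L2_inner_integrable[OF f f, unfolded lebesgue_on_UNIV_eq] by (intro integral_nonneg_eq_0_iff_AE) auto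
    then show "(L2_inner UNIV f f = 0) = l2_eq f (\<lambda>x. 0)"
      using f by (simp add: l2_eq_def L2_zero)
  qed
qed (auto simp: norm_l2_def dist_l2_def sgn_l2_def uniformity_l2_def open_l2_def)

end

lemma fn_L2: "fn U \<in> L2 UNIV"
  and of_fn_fn: "of_fn (fn U) = U"
  using Quotient3_rep_reflp[OF Quotient3_l2, of U] Quotient3_abs_rep[OF Quotient3_l2, of U]
  by (auto simp: l2_eq_def)

lemma of_fn_eq_iff: "f \<in> L2 UNIV \<Longrightarrow> g \<in> L2 UNIV \<Longrightarrow> of_fn f = of_fn g \<longleftrightarrow> (AE x in lebesgue. f x = g x)"
  using Quotient3_rel[OF Quotient3_l2, of f g] by (auto simp: l2_eq_def)

lemma fn_of_fn: "f \<in> L2 UNIV \<Longrightarrow> AE x in lebesgue. fn (of_fn f) x = f x"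
  using of_fn_eq_iff[OF fn_L2] of_fn_fn by blast

lemma of_fn_add: "f \<in> L2 UNIV \<Longrightarrow> g \<in> L2 UNIV \<Longrightarrow> of_fn f + of_fn g = of_fn (\<lambda>x. f x + g x)"
  and of_fn_diff: "f \<in> L2 UNIV \<Longrightarrow> g \<in> L2 UNIV \<Longrightarrow> of_fn f - of_fn g = of_fn (\<lambda>x. f x - g x)"
  and of_fn_scaleR: "f \<in> L2 UNIV \<Longrightarrow> c *\<^sub>R of_fn f = of_fn (\<lambda>x. c *\<^sub>R f x)"
  and of_fn_inner: "f \<in> L2 UNIV \<Longrightarrow> g \<in> L2 UNIV \<Longrightarrow> of_fn f \<bullet> of_fn g = (LINT x|lebesgue. f x \<bullet> g x)"
  by (simp_all add: plus_l2.abs_eq minus_l2.abs_eq scaleR_l2.abs_eq inner_l2.abs_eq l2_eq_def L2_inner_def lebesgue_on_UNIV_eq)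

lemma fn_add: "AE x in lebesgue. fn (U + V) x = fn U x + fn V x"
  using fn_of_fn[OF L2_add[OF fn_L2[of U] fn_L2[of V]]]
  by (simp add: of_fn_add[OF fn_L2 fn_L2, symmetric] of_fn_fn)

lemma fn_diff: "AE x in lebesgue. fn (U - V) x = fn U x - fn V x"
  using fn_of_fn[OF L2_diff[OF fn_L2[of U] fn_L2[of V]]]
  by (simp add: of_fn_diff[OF fn_L2 fn_L2, symmetric] of_fn_fn)

lemma fn_scaleR: "AE x in lebesgue. fn (c *\<^sub>R U) x = c *\<^sub>R fn U x"
  using fn_of_fn[OF L2_scaleR[OF fn_L2[of U], of c]]
  by (simp add: of_fn_scaleR[OF fn_L2, symmetric] of_fn_fn)

lemma l2_norm_sq: "f \<in> L2 UNIV \<Longrightarrow> (norm (of_fn f))\<^sup>2 = (LINT x|lebesgue. (norm (f x))\<^sup>2)"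
  by (simp add: power2_norm_eq_inner of_fn_inner)

text \<open>
  Any prescribed rate can be reached along a subsequence; the rate \<open>1 / 8 ^ k\<close> is used for
  completeness of the space of square integrable functions.
\<close>
lemma fast_subsequence:
  fixes X :: "nat \<Rightarrow> 'b::metric_space"
  assumes "Cauchy X" and "\<And>k. 0 < \<delta> k"
  shows "\<exists>r::nat\<Rightarrow>nat. strict_mono r \<and> (\<forall>k. dist (X (r (Suc k))) (X (r k)) < \<delta> k)"
proof -
  have "\<forall>k. \<exists>N. \<forall>m\<ge>N. \<forall>n\<ge>N. dist (X m) (X n) < \<delta> k"
    using assms unfolding Cauchy_def by blast
  then obtain N where N: "\<And>k m n. m \<ge> N k \<Longrightarrow> n \<ge> N k \<Longrightarrow> dist (X m) (X n) < \<delta> k" by metis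
  \<comment> \<open>Partial sums are strictly increasing and dominate every single threshold.\<close>
  define r where "r = (\<lambda>k. \<Sum>j\<le>k. N j + (1::nat))"
  have "strict_mono r" by (rule strict_mono_Suc_iff[THEN iffD2]) (simp add: r_def)
  moreover have "N k \<le> r k" for k
    unfolding r_def using member_le_sum[of k "{..k}" "\<lambda>j. N j + 1"] by simp
  moreover have "r k \<le> r (Suc k)" for k by (simp add: r_def)
  ultimately show ?thesis using N order_trans by metis
qed

text \<open>
  Riesz-Fischer: a rapidly converging subsequence converges almost everywhere, and the integrable
  majorant of its increments turns pointwise into mean square convergence.
\<close>
instance l2 :: (euclidean_space, euclidean_space) banach
proof
  fix X :: "nat \<Rightarrow> ('a, 'b) l2" assume C: "Cauchy X"
  obtain r where r: "strict_mono r" "\<And>k. dist (X (r (Suc k))) (X (r k)) < sqrt (1 / 8 ^ k)"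
    using fast_subsequence[OF C, of "\<lambda>k. sqrt (1 / 8 ^ k)"] by auto
  define f where "f = (\<lambda>k. fn (X (r k)))"
  have f: "f k \<in> L2 UNIV" and of_f: "of_fn (f k) = X (r k)" for k by (simp_all add: f_def fn_L2 of_fn_fn)
  note fm[measurable] = L2_measurable[OF f, unfolded lebesgue_on_UNIV_eq]
  have i8: "(LINT x|lebesgue. (norm (f (Suc k) x - f k x))\<^sup>2) \<le> 1 / 8 ^ k" for k
  proof -
    have "(LINT x|lebesgue. (norm (f (Suc k) x - f k x))\<^sup>2) = (norm (X (r (Suc k)) - X (r k)))\<^sup>2"
      by (simp add: l2_norm_sq[OF L2_diff[OF f f], symmetric] of_fn_diff[OF f f, symmetric] of_f)
    also have "\<dots> \<le> (sqrt (1 / 8 ^ k))\<^sup>2"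
      using r(2)[of k] by (intro power_mono) (auto simp: dist_norm)
    finally show ?thesis by simp
  qed
  obtain Q where Q: "integrable lebesgue Q" "\<And>x. 0 \<le> Q x"
      "AE x in lebesgue. \<forall>k. (norm (f (Suc k) x - f k x))\<^sup>2 \<le> Q x / 4 ^ k"
    using fast_decay_majorant[of lebesgue "\<lambda>k x. (norm (f (Suc k) x - f k x))\<^sup>2" 1]
      L2_integrable_sq[OF L2_diff[OF f f], unfolded lebesgue_on_UNIV_eq] i8 by auto
  define g where "g = (\<lambda>x. lim (\<lambda>k. f k x))"
  have gm[measurable]: "g \<in> borel_measurable lebesgue" unfolding g_def by measurable
  have ae: "AE x in lebesgue. \<forall>k. (norm (g x - f k x))\<^sup>2 \<le> 4 * Q x / 4 ^ k"
    using Q(3)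
  proof eventually_elim
    fix x assume q: "\<forall>k. (norm (f (Suc k) x - f k x))\<^sup>2 \<le> Q x / 4 ^ k"
    have n: "norm (f (Suc k) x - f k x) \<le> sqrt (Q x) / 2 ^ k" for k
      using q Q(2) by (intro sq_le_dyadic) auto
    have two: "(2 ^ k)\<^sup>2 = (4::real) ^ k" for k
      by (simp add: power2_eq_square flip: power_mult_distrib)
    from n have "norm (g x - f k x) \<le> 2 * sqrt (Q x) / 2 ^ k" for k
      unfolding g_def by (rule dyadic_limit_bound)
    then have "(norm (g x - f k x))\<^sup>2 \<le> (2 * sqrt (Q x) / 2 ^ k)\<^sup>2" for k
      by (intro power_mono) auto
    also have "(2 * sqrt (Q x) / 2 ^ k)\<^sup>2 = 4 * Q x / 4 ^ k" for k
      using Q(2)[of x] two by (simp add: power_divide power_mult_distrib)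
    finally show "\<forall>k. (norm (g x - f k x))\<^sup>2 \<le> 4 * Q x / 4 ^ k" by blast
  qed
  have gf: "(\<lambda>x. g x - f k x) \<in> L2 UNIV" for k
    by (rule L2_I[where g="\<lambda>x. 4 * Q x / 4 ^ k"], unfold lebesgue_on_UNIV_eq, measurable)
      (use Q ae in \<open>auto elim: eventually_mono\<close>)
  have g: "g \<in> L2 UNIV" using L2_add[OF gf[of 0] f[of 0]] by simp
  have "(\<lambda>k. X (r k)) \<longlonglongrightarrow> of_fn g"
  proof -
    have n: "(norm (of_fn g - X (r k)))\<^sup>2 \<le> 4 * integral\<^sup>L lebesgue Q * (1/4) ^ k" for k
    proof -
      have "(norm (of_fn g - X (r k)))\<^sup>2 = (LINT x|lebesgue. (norm (g x - f k x))\<^sup>2)"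
        by (simp add: l2_norm_sq[OF gf, symmetric] of_fn_diff[OF g f, symmetric] of_f)
      also have "\<dots> \<le> (LINT x|lebesgue. 4 * Q x / 4 ^ k)"
        by (rule integral_mono_AE) (use L2_integrable_sq[OF gf, unfolded lebesgue_on_UNIV_eq] Q ae in \<open>auto elim: eventually_mono\<close>)
      finally show ?thesis using Q(1) by (simp add: power_divide)
    qed
    have "(\<lambda>k. 4 * integral\<^sup>L lebesgue Q * (1/4::real) ^ k) \<longlonglongrightarrow> 4 * integral\<^sup>L lebesgue Q * 0"
      by (intro tendsto_mult tendsto_const LIMSEQ_power_zero) simp
    then have "(\<lambda>k. 4 * integral\<^sup>L lebesgue Q * (1/4::real) ^ k) \<longlonglongrightarrow> 0" by simp
    then have "(\<lambda>k. (norm (of_fn g - X (r k)))\<^sup>2) \<longlonglongrightarrow> 0"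
      by (rule Lim_null_comparison[OF always_eventually, rotated]) (use n in simp)
    then have "(\<lambda>k. sqrt ((norm (of_fn g - X (r k)))\<^sup>2)) \<longlonglongrightarrow> sqrt 0" by (rule tendsto_real_sqrt)
    then show ?thesis by (simp add: LIM_zero_iff tendsto_norm_zero_iff norm_minus_commute tendsto_iff dist_norm)
  qed
  then have "X \<longlonglongrightarrow> of_fn g"
    using Cauchy_converges_subseq[OF C r(1)] by (simp add: o_def)
  then show "convergent X" by (auto simp: convergent_def)
qed

section \<open>Bump functions and the fundamental lemma\<close>

lemma C_k_Suc_imp: "C_k (Suc k) f \<Longrightarrow> C_k k f"
proof (induction k arbitrary: f)
  case 0
  then show ?case by (auto simp: continuous_on_eq_continuous_at differentiable_imp_continuous_within)
next
  case (Suc k)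
  from Suc.prems have "\<forall>x. f differentiable (at x)" "\<And>h. C_k (Suc k) (\<lambda>x. frechet_derivative f (at x) h)"
    unfolding C_k.simps(2)[of "Suc k"] by blast+
  then show ?case using Suc.IH by simp
qed

lemma C_k_const: "C_k k (\<lambda>x. c)"
  by (induction k arbitrary: c) auto

lemma C_k_add: "C_k k f \<Longrightarrow> C_k k g \<Longrightarrow> C_k k (\<lambda>x. f x + g x)"
proof (induction k arbitrary: f g)
  case (Suc k)
  then have d: "\<And>x. f differentiable (at x)" "\<And>x. g differentiable (at x)" by auto
  have e: "((\<lambda>x. f x + g x) has_derivative (\<lambda>h. frechet_derivative f (at x) h + frechet_derivative g (at x) h)) (at x)" for x
    using d by (intro has_derivative_add) (simp_all add: frechet_derivative_works[symmetric])
  have "frechet_derivative (\<lambda>x. f x + g x) (at x) = (\<lambda>h. frechet_derivative f (at x) h + frechet_derivative g (at x) h)" for x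
    using frechet_derivative_at[OF e] by simp
  moreover have "(\<lambda>x. f x + g x) differentiable (at x)" for x using e by (auto simp: differentiable_def)
  ultimately show ?case using Suc by simp
qed (auto intro: continuous_intros)

lemma frechet_derivative_mult_real:
  fixes f g :: "'a::euclidean_space \<Rightarrow> real"
  assumes "f differentiable (at x)" "g differentiable (at x)"
  shows "frechet_derivative (\<lambda>x. f x * g x) (at x) h =
    f x * frechet_derivative g (at x) h + frechet_derivative f (at x) h * g x"
proof -
  have "((\<lambda>x. f x * g x) has_derivative
      (\<lambda>h. f x * frechet_derivative g (at x) h + frechet_derivative f (at x) h * g x)) (at x)"
    using assms by (intro has_derivative_mult) (simp_all add: frechet_derivative_works[symmetric])
  from frechet_derivative_at[OF this] show ?thesis by metis
qed

lemma C_k_mult: "C_k k f \<Longrightarrow> C_k k g \<Longrightarrow> C_k k (\<lambda>x. f x * g x)"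
proof (induction k arbitrary: f g)
  case (Suc k)
  then have d: "\<And>x. f differentiable (at x)" "\<And>x. g differentiable (at x)" by auto
  have "C_k k f" "C_k k g" using Suc.prems C_k_Suc_imp by auto
  then have "C_k k (\<lambda>x. f x * frechet_derivative g (at x) h + frechet_derivative f (at x) h * g x)" for h
    using Suc by (intro C_k_add Suc.IH) auto
  then show ?case using d by (auto simp: frechet_derivative_mult_real)
qed (auto intro: continuous_intros)

lemma C_k_prod: "finite B \<Longrightarrow> (\<And>b. b \<in> B \<Longrightarrow> C_k k (f b)) \<Longrightarrow> C_k k (\<lambda>x. \<Prod>b\<in>B. f b x)"
  by (induction B rule: finite_induct) (auto intro: C_k_const C_k_mult)

text \<open>
  The directional derivatives of such a composition are again compositions of a derivative of \<open>F\<close>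
  with the same affine map, which makes the induction work.
\<close>
lemma C_k_comp_affine:
  fixes F :: "real \<Rightarrow> real" and b :: "'a::euclidean_space"
  shows "C_k k F \<Longrightarrow> C_k k (\<lambda>x. F (x \<bullet> b + d))"
proof (induction k arbitrary: F)
  case 0
  then have "continuous_on UNIV F" by simp
  then show ?case by (auto intro!: continuous_intros continuous_on_compose2[of UNIV F])
next
  case (Suc k)
  have "((\<lambda>x. F (x \<bullet> b + d)) has_derivative (\<lambda>h. frechet_derivative F (at (x \<bullet> b + d)) (h \<bullet> b))) (at x)" for x :: 'a
  proof (rule has_derivative_compose[where g=F and f="\<lambda>x. x \<bullet> b + d" and f'="\<lambda>h. h \<bullet> b"
        and g'="frechet_derivative F (at (x \<bullet> b + d))"])
    show "((\<lambda>x. x \<bullet> b + d) has_derivative (\<lambda>h. h \<bullet> b)) (at x)"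
      by (auto intro!: derivative_eq_intros)
    show "(F has_derivative frechet_derivative F (at (x \<bullet> b + d))) (at (x \<bullet> b + d))"
      using Suc.prems by (simp add: frechet_derivative_works[symmetric])
  qed
  from this frechet_derivative_at[OF this] have d: "(\<lambda>x. F (x \<bullet> b + d)) differentiable (at x)"
    "frechet_derivative (\<lambda>x. F (x \<bullet> b + d)) (at x) = (\<lambda>h. frechet_derivative F (at (x \<bullet> b + d)) (h \<bullet> b))" for x :: 'a
    by (auto simp: differentiable_def)
  have "C_k k (\<lambda>x. frechet_derivative F (at (x \<bullet> b + d)) (h \<bullet> b))" for h :: 'a
    by (rule Suc.IH[of "\<lambda>s. frechet_derivative F (at s) (h \<bullet> b)"]) (use Suc.prems in simp)
  then show ?case using d by simp
qed

text \<open>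
  The family \<open>t \<mapsto> t\<^sup>-\<^sup>j exp (- 1 / t)\<close>, extended by zero, is closed under differentiation up to
  linear combinations. This gives smoothness of the classical flat function \<open>j = 0\<close>.
\<close>
definition flat_exp :: "nat \<Rightarrow> real \<Rightarrow> real" where
  "flat_exp j t = (if 0 < t then (1 / t) ^ j * exp (- (1 / t)) else 0)"

lemma flat_exp_at_right: "(flat_exp j \<longlongrightarrow> 0) (at_right 0)"
proof -
  have "((\<lambda>s::real. s ^ j / exp s) \<longlongrightarrow> 0) at_top" by (rule tendsto_power_div_exp_0)
  then have "((\<lambda>t::real. (inverse t) ^ j / exp (inverse t)) \<longlongrightarrow> 0) (at_right 0)"
    by (rule filterlim_compose[OF _ filterlim_inverse_at_top_right])
  moreover have "\<forall>\<^sub>F t in at_right 0. (inverse t) ^ j / exp (inverse t) = flat_exp j t"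
    by (auto simp: eventually_at_filter flat_exp_def exp_minus field_simps intro!: always_eventually)
  ultimately show ?thesis by (rule Lim_transform_eventually)
qed

lemma flat_exp_deriv:
  "(flat_exp j has_real_derivative (flat_exp (j + 2) t - real j * flat_exp (j + 1) t)) (at t)"
proof -
  consider "t > 0" | "t < 0" | "t = 0" by linarith
  then show ?thesis
  proof cases
    case 1
    have "((\<lambda>t. (1 / t) ^ j * exp (- (1 / t))) has_real_derivative
        (flat_exp (j + 2) t - real j * flat_exp (j + 1) t)) (at t)"
    proof -
      have D: "((\<lambda>t. 1 / t) has_real_derivative - ((1 / t)\<^sup>2)) (at t)"
        using 1 by (auto intro!: derivative_eq_intros simp: power2_eq_square)
      have P: "((\<lambda>t. (1 / t) ^ j) has_real_derivative - (real j * (1 / t) ^ (j + 1))) (at t)"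
        using DERIV_power[OF D, of j] by (cases j) (simp_all add: power2_eq_square mult_ac)
      have X: "((\<lambda>t. exp (- (1 / t))) has_real_derivative exp (- (1 / t)) * (1 / t)\<^sup>2) (at t)"
        using DERIV_fun_exp[OF DERIV_minus[OF D]] by simp
      show ?thesis
        using DERIV_mult[OF P X] 1 by (simp add: flat_exp_def power2_eq_square algebra_simps)
    qed
    moreover have "\<forall>\<^sub>F s in nhds t. flat_exp j s = (1 / s) ^ j * exp (- (1 / s))"
      using order_tendstoD(1)[OF tendsto_ident_at 1] eventually_nhds_in_open[of "{0<..}" t] 1
      by (auto elim!: eventually_mono simp: flat_exp_def)
    ultimately show ?thesis by (subst DERIV_cong_ev[OF refl _ refl])
  next
    case 2
    have "\<forall>\<^sub>F s in nhds t. flat_exp j s = 0"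
      using eventually_nhds_in_open[of "{..<0}" t] 2
      by (auto elim!: eventually_mono simp: flat_exp_def)
    moreover have "((\<lambda>s. 0) has_real_derivative (flat_exp (j + 2) t - real j * flat_exp (j + 1) t)) (at t)"
      using 2 by (simp add: flat_exp_def)
    ultimately show ?thesis by (subst DERIV_cong_ev[OF refl _ refl])
  next
    case 3
    have r: "((\<lambda>s. (flat_exp j s - flat_exp j 0) / (s - 0)) \<longlongrightarrow> 0) (at_right 0)"
    proof (rule Lim_transform_eventually[OF flat_exp_at_right[of "j + 1"]])
      show "\<forall>\<^sub>F s in at_right 0. flat_exp (j + 1) s = (flat_exp j s - flat_exp j 0) / (s - 0)"
        by (auto simp: eventually_at_filter flat_exp_def field_simps intro!: always_eventually)
    qed
    have l: "((\<lambda>s. (flat_exp j s - flat_exp j 0) / (s - 0)) \<longlongrightarrow> 0) (at_left 0)"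
    proof (rule Lim_transform_eventually[OF tendsto_const])
      show "\<forall>\<^sub>F s in at_left 0. 0 = (flat_exp j s - flat_exp j 0) / (s - 0)"
        by (auto simp: eventually_at_filter flat_exp_def intro!: always_eventually)
    qed
    show ?thesis unfolding 3 has_field_derivative_iff
      using filterlim_split_at[OF l r] by (simp add: flat_exp_def)
  qed
qed

lemma C_k_flat_exp: "C_k k (flat_exp j)"
proof (induction k arbitrary: j)
  case 0
  show ?case using flat_exp_deriv by (auto simp: continuous_on_eq_continuous_at intro: DERIV_isCont)
next
  case (Suc k)
  have d: "(flat_exp j has_derivative (\<lambda>h. (flat_exp (j + 2) t - real j * flat_exp (j + 1) t) * h)) (at t)" for t
    using flat_exp_deriv[of j t] by (simp add: has_field_derivative_def)
  from frechet_derivative_at[OF this]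
  have "frechet_derivative (flat_exp j) (at t) = (\<lambda>h. (flat_exp (j + 2) t - real j * flat_exp (j + 1) t) * h)" for t
    by simp
  moreover have "C_k k (\<lambda>t. (flat_exp (j + 2) t + (- real j) * flat_exp (j + 1) t) * h)" for h
    by (intro C_k_mult C_k_add C_k_const Suc)
  ultimately show ?case using d by (auto simp: differentiable_def)
qed

definition step_approx :: "nat \<Rightarrow> real \<Rightarrow> real" where
  "step_approx n s = flat_exp 0 (real (Suc n) * s)"

lemma step_approx_bounds: "0 \<le> step_approx n s" "step_approx n s \<le> 1"
  by (auto simp: step_approx_def flat_exp_def)

lemma step_approx_nonzero: "step_approx n s \<noteq> 0 \<longleftrightarrow> 0 < s"
  by (auto simp: step_approx_def flat_exp_def zero_less_mult_iff)

lemma step_approx_limit: "(\<lambda>n. step_approx n s) \<longlonglongrightarrow> (if 0 < s then 1 else 0)"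
proof (cases "0 < s")
  case True
  have "(\<lambda>n. 1 / s * inverse (real (Suc n))) \<longlonglongrightarrow> 1 / s * 0"
    by (intro tendsto_mult tendsto_const LIMSEQ_inverse_real_of_nat)
  then have "(\<lambda>n. exp (- (1 / s * inverse (real (Suc n))))) \<longlonglongrightarrow> exp (- (1 / s * 0))"
    by (rule tendsto_exp[OF tendsto_minus])
  moreover have "exp (- (1 / s * inverse (real (Suc n)))) = step_approx n s" for n
    using True by (simp add: step_approx_def flat_exp_def zero_less_mult_iff divide_inverse mult.commute del: of_nat_Suc)
  ultimately show ?thesis using True by simp
next
  case False
  then show ?thesis using step_approx_nonzero[of _ s] by simp
qed

text \<open>
  For each \<open>n\<close> a smooth function that is positive exactly on the open box with corners \<open>c\<close> and \<open>d\<close>.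
  As \<open>n\<close> grows it increases to the indicator of the box.
\<close>
definition bump :: "'a::euclidean_space \<Rightarrow> 'a \<Rightarrow> nat \<Rightarrow> 'a \<Rightarrow> real" where
  "bump c d n x = (\<Prod>b\<in>Basis. step_approx n (x \<bullet> b - c \<bullet> b) * step_approx n (d \<bullet> b - x \<bullet> b))"

lemma bump_nonzero: "bump c d n x \<noteq> 0 \<longleftrightarrow> x \<in> box c d"
  by (auto simp: bump_def mem_box step_approx_nonzero)

lemma bump_bounds: "0 \<le> bump c d n x" "bump c d n x \<le> 1"
  unfolding bump_def
  by (auto intro!: prod_nonneg mult_nonneg_nonneg prod_le_1 mult_le_one step_approx_bounds)

lemma bump_limit: "(\<lambda>n. bump c d n x) \<longlonglongrightarrow> indicat_real (box c d) x"
proof -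
  have "(\<lambda>n. bump c d n x) \<longlonglongrightarrow>
      (\<Prod>b\<in>Basis. (if 0 < x \<bullet> b - c \<bullet> b then 1 else 0) * (if 0 < d \<bullet> b - x \<bullet> b then 1 else 0))"
    unfolding bump_def by (intro tendsto_prod tendsto_mult step_approx_limit)
  also have "(\<Prod>b\<in>Basis. (if 0 < x \<bullet> b - c \<bullet> b then 1 else 0) * (if 0 < d \<bullet> b - x \<bullet> b then 1 else (0::real)))
      = indicat_real (box c d) x"
    by (cases "x \<in> box c d") (auto simp: mem_box)
  finally show ?thesis .
qed

lemma bump_test_function:
  assumes "cbox c d \<subseteq> \<Omega>"
  shows "bump c d n \<in> test_functions \<Omega>"
proof -
  have C: "C_k k (bump c d n)" for k
  proof -
    have 1: "C_k k (\<lambda>x::'a. flat_exp 0 (x \<bullet> (real (Suc n) *\<^sub>R b) + (- (real (Suc n) * (c \<bullet> b)))))" for b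
      by (intro C_k_comp_affine C_k_flat_exp)
    have 2: "C_k k (\<lambda>x::'a. flat_exp 0 (x \<bullet> (- real (Suc n) *\<^sub>R b) + real (Suc n) * (d \<bullet> b)))" for b
      by (intro C_k_comp_affine C_k_flat_exp)
    have "bump c d n = (\<lambda>x. \<Prod>b\<in>Basis. flat_exp 0 (x \<bullet> (real (Suc n) *\<^sub>R b) + (- (real (Suc n) * (c \<bullet> b))))
       * flat_exp 0 (x \<bullet> (- real (Suc n) *\<^sub>R b) + real (Suc n) * (d \<bullet> b)))"
      by (intro ext, unfold bump_def step_approx_def, intro prod.cong refl arg_cong2[where f="(*)"] arg_cong[where f="flat_exp 0"])
        (simp_all add: algebra_simps)
    then show ?thesis using C_k_prod[OF finite_Basis C_k_mult[OF 1 2]] by simp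
  qed
  have cl: "closure {x. bump c d n x \<noteq> 0} \<subseteq> cbox c d"
    unfolding bump_nonzero Collect_mem_eq
    by (rule closure_minimal[OF box_subset_cbox closed_cbox])
  then have "compact (closure {x. bump c d n x \<noteq> 0})"
    unfolding compact_eq_bounded_closed using bounded_subset[OF bounded_cbox] by blast
  then show ?thesis using C cl assms by (auto simp: test_functions_def)
qed

lemma test_function_continuous: "\<phi> \<in> test_functions \<Omega> \<Longrightarrow> continuous_on UNIV \<phi>"
  by (auto simp: test_functions_def dest: spec[of _ 0])

lemma test_function_deriv:
  assumes "\<phi> \<in> test_functions \<Omega>"
  shows "\<phi> differentiable (at x)" "continuous_on UNIV (\<lambda>x. frechet_derivative \<phi> (at x) h)"
proof -
  have "C_k (Suc 0) \<phi>" using assms unfolding test_functions_def by blast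
  then show "\<phi> differentiable (at x)" "continuous_on UNIV (\<lambda>x. frechet_derivative \<phi> (at x) h)" by auto
qed

lemma test_function_support: "\<phi> \<in> test_functions \<Omega> \<Longrightarrow> x \<notin> closure {x. \<phi> x \<noteq> 0} \<Longrightarrow> \<phi> x = 0"
  using closure_subset[of "{x. \<phi> x \<noteq> 0}"] by auto

lemma frechet_derivative_zero_outside:
  assumes "\<phi> differentiable (at x)" "x \<notin> closure {x. \<phi> x \<noteq> 0}"
  shows "frechet_derivative \<phi> (at x) h = 0"
proof -
  define S where "S = - closure {x. \<phi> x \<noteq> 0}"
  have S: "open S" "x \<in> S" and z: "\<And>y. y \<in> S \<Longrightarrow> 0 = \<phi> y"
    using assms(2) closure_subset[of "{x. \<phi> x \<noteq> 0}"] by (auto simp: S_def)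
  have "(\<phi> has_derivative (\<lambda>h. 0)) (at x)"
    by (rule has_derivative_transform_within_open[OF has_derivative_const S z])
  from frechet_derivative_at[OF this] show ?thesis by metis
qed

lemma integrable_compact_support:
  fixes F :: "'a::euclidean_space \<Rightarrow> 'b::euclidean_space"
  assumes F: "continuous_on UNIV F" and K: "compact K" "\<And>x. x \<notin> K \<Longrightarrow> F x = 0"
  shows "integrable lebesgue F" "integrable lborel F"
proof -
  have "integrable lborel (\<lambda>x. indicator K x *\<^sub>R F x)"
    by (rule borel_integrable_compact[OF K(1)]) (use F continuous_on_subset in blast)
  moreover have "(\<lambda>x. indicator K x *\<^sub>R F x) = F" using K(2) by (auto simp: indicator_def fun_eq_iff)
  ultimately show i: "integrable lborel F" by simp
  then show "integrable lebesgue F"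
    using integrable_completion[of F lborel] by (simp add: borel_measurable_integrable)
qed

lemma L2_compact_support:
  fixes F :: "'a::euclidean_space \<Rightarrow> 'b::euclidean_space"
  assumes F: "continuous_on UNIV F" and K: "compact K" "\<And>x. x \<notin> K \<Longrightarrow> F x = 0"
  shows "F \<in> L2 UNIV"
proof -
  have "integrable lebesgue (\<lambda>x. (norm (F x))\<^sup>2)"
    by (rule integrable_compact_support(1)[OF _ K(1)]) (use K(2) F in \<open>auto intro!: continuous_intros\<close>)
  then show ?thesis
    using integrable_compact_support(1)[OF F K] by (simp add: L2_def lebesgue_on_UNIV_eq borel_measurable_integrable)
qed

text \<open>
  Testing with bump functions shows that the integral over every box in the domain vanishes, and
  differentiation of integrals recovers the function from them almost everywhere.
\<close>
lemma fundamental_lemma_calculus_of_variations: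
  fixes g :: "'a::euclidean_space \<Rightarrow> real"
  assumes \<Omega>: "open \<Omega>" and g: "g \<in> L2 \<Omega>"
    and zero: "\<And>\<phi>. \<phi> \<in> test_functions \<Omega> \<Longrightarrow> (LINT x|lebesgue_on \<Omega>. g x * \<phi> x) = 0"
  shows "AE x in lebesgue_on \<Omega>. g x = 0"
proof -
  have [simp]: "\<Omega> \<in> sets lebesgue" using \<Omega> by (simp add: borel_open)
  define G where "G = (\<lambda>x. if x \<in> \<Omega> then g x else 0)"
  have Gm: "G \<in> borel_measurable lebesgue"
    unfolding G_def using L2_measurable[OF g] by (simp add: borel_measurable_if)
  have G2: "integrable lebesgue (\<lambda>x. (G x)\<^sup>2)"
  proof -
    have "integrable lebesgue (\<lambda>x. indicator \<Omega> x *\<^sub>R (norm (g x))\<^sup>2)"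
      using L2_integrable_sq[OF g] by (simp add: integrable_restrict_space)
    moreover have "(\<lambda>x. indicator \<Omega> x *\<^sub>R (norm (g x))\<^sup>2) = (\<lambda>x. (G x)\<^sup>2)"
      by (auto simp: G_def indicator_def fun_eq_iff)
    ultimately show ?thesis by simp
  qed
  have Gbox: "integrable lebesgue (\<lambda>x. indicator (cbox c d) x * (1 + (G x)\<^sup>2))" for c d
  proof -
    have "integrable lebesgue (indicat_real (cbox c d))"
      by (rule integrable_real_indicator) (auto simp: emeasure_lborel_cbox_finite emeasure_lborel_cbox_eq)
    moreover have "integrable lebesgue (\<lambda>x. indicator (cbox c d) x *\<^sub>R (G x)\<^sup>2)"
      by (rule integrable_mult_indicator[OF _ G2]) auto
    ultimately have "integrable lebesgue (\<lambda>x. indicat_real (cbox c d) x + indicator (cbox c d) x *\<^sub>R (G x)\<^sup>2)"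
      by (rule Bochner_Integration.integrable_add)
    then show ?thesis by (simp add: distrib_left)
  qed
  have absG: "\<bar>G x\<bar> \<le> 1 + (G x)\<^sup>2" for x
    using sum_squares_bound[of 1 "\<bar>G x\<bar>"] by simp
  have Gcbox: "integrable lebesgue (\<lambda>x. indicator (cbox c d) x *\<^sub>R G x)" for c d
  proof (rule Bochner_Integration.integrable_bound[OF Gbox[of c d]])
    show "(\<lambda>x. indicator (cbox c d) x *\<^sub>R G x) \<in> borel_measurable lebesgue"
      by (intro borel_measurable_scaleR borel_measurable_indicator Gm) auto
    show "AE x in lebesgue. norm (indicat_real (cbox c d) x *\<^sub>R G x) \<le> norm (indicat_real (cbox c d) x * (1 + (G x)\<^sup>2))"
      using absG by (auto simp: indicator_def)
  qed
  have "G integrable_on cbox c d" for c d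
    by (rule set_lebesgue_integral_eq_integral(1)) (unfold set_integrable_def, rule Gcbox)
  then obtain N where N: "negligible N"
    "\<And>x e. \<lbrakk>x \<notin> N; 0 < e\<rbrakk> \<Longrightarrow> \<exists>d>0. \<forall>h. 0 < h \<and> h < d \<longrightarrow>
       norm (integral (cbox x (x + h *\<^sub>R One)) G /\<^sub>R h ^ DIM('a) - G x) < e"
    using integrable_ccontinuous_explicit[of G] by metis
  \<comment> \<open>Testing with bump functions that increase to the indicator of a box shows that every box in the domain has integral zero.\<close>
  have int0: "integral (cbox c d) G = 0" if cd: "cbox c d \<subseteq> \<Omega>" for c d
  proof -
    have sub: "box c d \<subseteq> \<Omega>" using cd box_subset_cbox by blast
    have "(\<lambda>n. LINT x|lebesgue. G x * bump c d n x) \<longlonglongrightarrow> (LINT x|lebesgue. G x * indicat_real (box c d) x)"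
    proof (rule integral_dominated_convergence[OF _ _ Gbox[of c d]])
      show "(\<lambda>x. G x * indicat_real (box c d) x) \<in> borel_measurable lebesgue"
        using Gm by (intro borel_measurable_times borel_measurable_indicator) auto
      show "(\<lambda>x. G x * bump c d n x) \<in> borel_measurable lebesgue" for n
        using Gm continuous_imp_measurable_on_sets_lebesgue[OF test_function_continuous[OF bump_test_function[OF cd]]]
        by (intro borel_measurable_times) (auto simp: lebesgue_on_UNIV_eq)
      show "AE x in lebesgue. (\<lambda>n. G x * bump c d n x) \<longlonglongrightarrow> G x * indicat_real (box c d) x"
        by (intro AE_I2 tendsto_mult tendsto_const bump_limit)
      have "\<bar>G x\<bar> * bump c d n x \<le> indicator (cbox c d) x * (1 + (G x)\<^sup>2)" for x n
      proof (cases "x \<in> box c d")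
        case True
        then have "\<bar>G x\<bar> * bump c d n x \<le> (1 + (G x)\<^sup>2) * 1"
          by (intro mult_mono absG bump_bounds) auto
        then show ?thesis using True box_subset_cbox[of c d] by (auto simp: indicator_def)
      next
        case False
        then show ?thesis using bump_nonzero[of c d n x] by (simp add: indicator_def)
      qed
      then show "AE x in lebesgue. norm (G x * bump c d n x) \<le> indicator (cbox c d) x * (1 + (G x)\<^sup>2)" for n
        unfolding real_norm_def abs_mult abs_of_nonneg[OF bump_bounds(1)] by (intro AE_I2)
    qed
    moreover have "(LINT x|lebesgue. G x * bump c d n x) = 0" for n
    proof -
      have "(LINT x|lebesgue_on \<Omega>. g x * bump c d n x) = (LINT x|lebesgue. indicator \<Omega> x *\<^sub>R (g x * bump c d n x))"
        by (simp add: integral_restrict_space)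
      also have "\<dots> = (LINT x|lebesgue. G x * bump c d n x)"
        by (intro Bochner_Integration.integral_cong) (auto simp: G_def indicator_def)
      finally show ?thesis using zero[OF bump_test_function[OF cd]] by simp
    qed
    ultimately have "(LINT x|lebesgue. G x * indicat_real (box c d) x) = 0"
      by (simp add: LIMSEQ_const_iff)
    then have "(LINT x:box c d|lebesgue. G x) = 0"
      by (simp add: set_lebesgue_integral_def mult.commute)
    moreover have "set_integrable lebesgue (box c d) G"
      unfolding set_integrable_def
    proof -
      have "(\<lambda>x. indicat_real (box c d) x *\<^sub>R (indicat_real (cbox c d) x *\<^sub>R G x)) = (\<lambda>x. indicat_real (box c d) x *\<^sub>R G x)"
        using box_subset_cbox[of c d] by (auto simp: indicator_def fun_eq_iff)
      then show "integrable lebesgue (\<lambda>x. indicat_real (box c d) x *\<^sub>R G x)"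
        using integrable_mult_indicator[OF _ Gcbox[of c d], of "box c d"] by simp
    qed
    ultimately have "integral (box c d) G = 0"
      using set_lebesgue_integral_eq_integral(2) by metis
    then show ?thesis by (simp add: integral_open_interval)
  qed
  \<comment> \<open>Lebesgue differentiation: almost every value is a limit of averages over small cubes, and these averages vanish.\<close>
  have G0: "G x = 0" if x: "x \<in> \<Omega>" "x \<notin> N" for x
  proof (rule ccontr)
    assume "G x \<noteq> 0"
    then obtain d where d: "d > 0" "\<And>h. 0 < h \<Longrightarrow> h < d \<Longrightarrow>
       norm (integral (cbox x (x + h *\<^sub>R One)) G /\<^sub>R h ^ DIM('a) - G x) < \<bar>G x\<bar>"
      using N(2)[OF x(2), of "\<bar>G x\<bar>"] by auto
    obtain r where r: "r > 0" "cball x r \<subseteq> \<Omega>"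
      using \<Omega> x(1) open_contains_cball by blast
    have nO: "norm (One::'a) > 0" by simp
    define h where "h = min (d / 2) (r / norm (One::'a))"
    have "h \<le> d / 2" unfolding h_def by (rule min.cobounded1)
    moreover have "0 < h" using d(1) r(1) nO unfolding h_def by (simp only: min_less_iff_conj) (auto intro!: divide_pos_pos)
    ultimately have h: "0 < h" "h < d" using d(1) by simp_all
    have "cbox x (x + h *\<^sub>R One) \<subseteq> cball x r"
    proof
      fix y assume y: "y \<in> cbox x (x + h *\<^sub>R One)"
      have "norm (y - x) \<le> norm (h *\<^sub>R (One::'a))"
        by (rule norm_le_componentwise) (use y h in \<open>auto simp: mem_box inner_diff_left inner_add_left\<close>)
      also have "\<dots> = h * norm (One::'a)" using h by simp
      also have "\<dots> \<le> (r / norm (One::'a)) * norm (One::'a)"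
        by (intro mult_right_mono) (auto simp: h_def)
      also have "\<dots> = r" using nO by simp
      finally show "y \<in> cball x r" by (simp add: dist_norm norm_minus_commute)
    qed
    then have "integral (cbox x (x + h *\<^sub>R One)) G = 0" using r(2) by (intro int0) blast
    then show False using d(2)[OF h] by simp
  qed
  have "N \<in> null_sets lebesgue" using N(1) by (simp add: negligible_iff_null_sets)
  then have "AE x in lebesgue. x \<notin> N" by (rule AE_not_in)
  then have "AE x in lebesgue. x \<in> \<Omega> \<longrightarrow> g x = 0"
    by eventually_elim (use G0 in \<open>auto simp: G_def split: if_splits\<close>)
  then show ?thesis by (simp add: AE_restrict_space_iff)
qed

section \<open>Integration by parts for test functions\<close>

lemma lborel_integral_translation:
  fixes F :: "'a::euclidean_space \<Rightarrow> real"
  assumes "F \<in> borel_measurable borel"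
  shows "(LINT x|lborel. F (x + t)) = (LINT x|lborel. F x)"
proof -
  have "(LINT x|lborel. F x) = (LINT x|distr lborel borel ((+) t). F x)"
    by (simp add: lborel_distr_plus)
  also have "\<dots> = (LINT x|lborel. F (t + x))"
    using assms by (intro integral_distr) auto
  finally show ?thesis by (simp add: add.commute)
qed

text \<open>
  The divergence theorem for compact support, from translation invariance of Lebesgue measure: the
  integral of \<open>x \<mapsto> F (x + h b)\<close> does not depend on \<open>h\<close>.
\<close>
lemma integral_directional_derivative_zero:
  fixes F :: "'a::euclidean_space \<Rightarrow> real"
  assumes d: "\<And>x. F differentiable (at x)" and c: "continuous_on UNIV (\<lambda>x. frechet_derivative F (at x) b)"
    and K: "compact K" "\<And>x. x \<notin> K \<Longrightarrow> F x = 0"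
  shows "(LINT x|lebesgue. frechet_derivative F (at x) b) = 0"
proof -
  define D where "D = (\<lambda>x. frechet_derivative F (at x) b)"
  have Fd: "(F has_derivative frechet_derivative F (at x)) (at x)" for x
    using d by (simp add: frechet_derivative_works)
  have cF: "continuous_on UNIV F"
    using d by (simp add: continuous_on_eq_continuous_at differentiable_imp_continuous_within)
  have D_K: "D x = 0" if "x \<notin> K" for x
  proof -
    have "closure {x. F x \<noteq> 0} \<subseteq> K"
      using K by (intro closure_minimal) (auto simp: compact_imp_closed)
    then show ?thesis unfolding D_def using that d by (intro frechet_derivative_zero_outside) auto
  qed
  have "bounded (D ` K)"
    using c K(1) unfolding D_def
    by (intro compact_imp_bounded compact_continuous_image) (auto intro: continuous_on_subset)
  then obtain C where C: "\<And>x. x \<in> K \<Longrightarrow> \<bar>D x\<bar> \<le> C" by (auto simp: bounded_iff)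
  have Cb: "\<bar>D x\<bar> \<le> max C 0" for x using C[of x] D_K[of x] by (cases "x \<in> K") auto
  have line: "((\<lambda>s. F (x + s *\<^sub>R b)) has_real_derivative D (x + s *\<^sub>R b)) (at s)" for x s
  proof -
    have "((\<lambda>s. x + s *\<^sub>R b) has_derivative (\<lambda>h. h *\<^sub>R b)) (at s)"
      by (auto intro!: derivative_eq_intros)
    from has_derivative_compose[OF this Fd]
    have "((\<lambda>s. F (x + s *\<^sub>R b)) has_derivative (\<lambda>h. frechet_derivative F (at (x + s *\<^sub>R b)) (h *\<^sub>R b))) (at s)" .
    moreover have "frechet_derivative F (at y) (h *\<^sub>R b) = D y * h" for y h
      unfolding D_def using linear_scale[OF has_derivative_linear[OF Fd]] by simp
    ultimately show ?thesis by (simp add: has_field_derivative_def)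
  qed
  define h where "h = (\<lambda>n. inverse (real (Suc n)))"
  have h: "0 < h n" "h n \<le> 1" for n by (auto simp: h_def inverse_le_1_iff)
  \<comment> \<open>Difference quotients have integral zero by translation invariance and converge boundedly to the derivative.\<close>
  define q where "q = (\<lambda>n x. (F (x + h n *\<^sub>R b) - F x) / h n)"
  have q_lim: "(\<lambda>n. q n x) \<longlonglongrightarrow> D x" for x
  proof -
    have "((\<lambda>s. (F (x + s *\<^sub>R b) - F (x + 0 *\<^sub>R b)) / (s - 0)) \<longlongrightarrow> D (x + 0 *\<^sub>R b)) (at 0)"
      using line[of x 0] unfolding has_field_derivative_iff .
    moreover have "filterlim h (at 0) sequentially"
      unfolding filterlim_at using h LIMSEQ_inverse_real_of_nat by (auto simp: h_def less_imp_neq[symmetric])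
    ultimately have "(\<lambda>n. (F (x + h n *\<^sub>R b) - F (x + 0 *\<^sub>R b)) / (h n - 0)) \<longlonglongrightarrow> D (x + 0 *\<^sub>R b)"
      by (rule filterlim_compose)
    then show ?thesis by (simp add: q_def)
  qed
  obtain R where R: "\<And>x. x \<in> K \<Longrightarrow> norm x \<le> R" using compact_imp_bounded[OF K(1)] by (auto simp: bounded_iff)
  define K' where "K' = cball (0::'a) (R + norm b)"
  have q_supp: "q n x = 0" if "x \<notin> K'" for n x
  proof -
    have nx: "norm x > R + norm b" using that by (simp add: K'_def)
    have "norm (h n *\<^sub>R b) \<le> norm b" using h[of n] by (simp add: mult_left_le_one_le)
    moreover have "norm x \<le> norm (x + h n *\<^sub>R b) + norm (h n *\<^sub>R b)"
      using norm_triangle_ineq4[of "x + h n *\<^sub>R b" "h n *\<^sub>R b"] by simp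
    ultimately have "norm (x + h n *\<^sub>R b) > R" using nx by linarith
    moreover have "norm x > R" using nx norm_ge_zero[of b] by linarith
    ultimately have "x \<notin> K" "x + h n *\<^sub>R b \<notin> K" using R by fastforce+
    then show ?thesis by (simp add: q_def K)
  qed
  have q_bd: "\<bar>q n x\<bar> \<le> max C 0" for n x
  proof -
    obtain z where "F (x + h n *\<^sub>R b) - F (x + 0 *\<^sub>R b) = (h n - 0) * D (x + z *\<^sub>R b)"
      using MVT2[OF h(1)[of n], of "\<lambda>s. F (x + s *\<^sub>R b)" "\<lambda>s. D (x + s *\<^sub>R b)"] line by blast
    then have "q n x = D (x + z *\<^sub>R b)" using h(1)[of n] by (simp add: q_def)
    then show ?thesis using Cb by simp
  qed
  have cq: "continuous_on UNIV (q n)" for n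
    unfolding q_def using h(1)[of n]
    by (intro continuous_intros continuous_on_compose2[OF cF]) auto
  have Fb: "F \<in> borel_measurable borel" by (rule borel_measurable_continuous_onI[OF cF])
  have iF: "integrable lborel F" by (rule integrable_compact_support(2)[OF cF K])
  have "(\<lambda>n. integral\<^sup>L lborel (q n)) \<longlonglongrightarrow> integral\<^sup>L lborel D"
  proof (rule integral_dominated_convergence[where w="\<lambda>x. indicat_real K' x * max C 0"])
    show "D \<in> borel_measurable lborel" using c unfolding D_def by (simp add: borel_measurable_continuous_onI)
    show "q n \<in> borel_measurable lborel" for n using cq by (simp add: borel_measurable_continuous_onI)
    show "integrable lborel (\<lambda>x. indicat_real K' x * max C 0)"
      using emeasure_bounded_finite[OF bounded_cball, of 0 "R + norm b"]
      by (intro integrable_mult_left integrable_real_indicator) (simp_all add: K'_def)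
    show "AE x in lborel. (\<lambda>n. q n x) \<longlonglongrightarrow> D x" using q_lim by simp
    show "AE x in lborel. norm (q n x) \<le> indicat_real K' x * max C 0" for n
      using q_bd[of n] q_supp[of _ n] by (auto simp: indicator_def)
  qed
  moreover have "integral\<^sup>L lborel (q n) = 0" for n
  proof -
    have "integrable lborel (\<lambda>x. F (x + h n *\<^sub>R b))"
    proof (rule integrable_compact_support(2)[where K="K'"])
      show "continuous_on UNIV (\<lambda>x. F (x + h n *\<^sub>R b))"
        by (intro continuous_intros continuous_on_compose2[OF cF]) auto
      show "compact K'" by (simp add: K'_def)
      show "F (x + h n *\<^sub>R b) = 0" if x: "x \<notin> K'" for x
      proof -
        have "x \<notin> K" using x R norm_ge_zero[of b] by (fastforce simp: K'_def)
        then have "F x = 0" by (rule K)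
        then show ?thesis using q_supp[OF x, of n] h(1)[of n] by (simp add: q_def)
      qed
    qed
    then have "integral\<^sup>L lborel (q n) = ((LINT x|lborel. F (x + h n *\<^sub>R b)) - integral\<^sup>L lborel F) / h n"
      unfolding q_def using iF by simp
    then show ?thesis by (simp add: lborel_integral_translation[OF Fb])
  qed
  ultimately have "integral\<^sup>L lborel D = 0" by (simp add: LIMSEQ_const_iff)
  moreover have "integral\<^sup>L lebesgue D = integral\<^sup>L lborel D"
    using c unfolding D_def by (intro integral_completion) (simp add: borel_measurable_continuous_onI)
  ultimately show ?thesis by (simp add: D_def)
qed

lemma integral_lebesgue_on_support:
  fixes F :: "'a::euclidean_space \<Rightarrow> real"
  assumes "\<And>x. x \<notin> \<Omega> \<Longrightarrow> F x = 0" and "\<Omega> \<in> sets lebesgue"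
  shows "(LINT x|lebesgue_on \<Omega>. F x) = (LINT x|lebesgue. F x)"
proof -
  have "(LINT x|lebesgue_on \<Omega>. F x) = (LINT x|lebesgue. indicator \<Omega> x *\<^sub>R F x)"
    using assms(2) by (simp add: integral_restrict_space)
  also have "\<dots> = (LINT x|lebesgue. F x)"
    using assms(1) by (intro Bochner_Integration.integral_cong) (auto simp: indicator_def)
  finally show ?thesis .
qed

definition classical_gradient :: "('a::euclidean_space \<Rightarrow> real) \<Rightarrow> 'a \<Rightarrow> 'a" where
  "classical_gradient \<phi> x = (\<Sum>b\<in>Basis. frechet_derivative \<phi> (at x) b *\<^sub>R b)"

lemma classical_gradient_inner:
  "b \<in> Basis \<Longrightarrow> classical_gradient \<phi> x \<bullet> b = frechet_derivative \<phi> (at x) b"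
  unfolding classical_gradient_def
  by (simp add: inner_sum_left inner_Basis if_distrib cong: if_cong)

lemma test_function_zero_outside:
  assumes "\<phi> \<in> test_functions \<Omega>" "x \<notin> \<Omega>"
  shows "\<phi> x = 0" "frechet_derivative \<phi> (at x) b = 0" "classical_gradient \<phi> x = 0"
proof -
  have x: "x \<notin> closure {x. \<phi> x \<noteq> 0}" using assms by (auto simp: test_functions_def)
  show "\<phi> x = 0" by (rule test_function_support[OF assms(1) x])
  have "frechet_derivative \<phi> (at x) b = 0" for b
    by (rule frechet_derivative_zero_outside[OF test_function_deriv(1)[OF assms(1)] x])
  then show "frechet_derivative \<phi> (at x) b = 0" "classical_gradient \<phi> x = 0"
    by (simp_all add: classical_gradient_def)
qed

lemma test_function_L2:
  assumes "\<phi> \<in> test_functions \<Omega>"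
  shows "\<phi> \<in> L2 UNIV" "(\<lambda>x. frechet_derivative \<phi> (at x) b) \<in> L2 UNIV" "classical_gradient \<phi> \<in> L2 UNIV"
proof -
  let ?K = "closure {x. \<phi> x \<noteq> 0}"
  have K: "compact ?K" using assms by (auto simp: test_functions_def)
  note c = test_function_continuous[OF assms] test_function_deriv[OF assms]
  note z = test_function_support[OF assms] frechet_derivative_zero_outside[OF c(2)]
  show "\<phi> \<in> L2 UNIV" by (rule L2_compact_support[OF c(1) K z(1)])
  show "(\<lambda>x. frechet_derivative \<phi> (at x) b) \<in> L2 UNIV"
    by (rule L2_compact_support[OF c(3) K z(2)])
  show "classical_gradient \<phi> \<in> L2 UNIV"
  proof (rule L2_compact_support[OF _ K])
    show "continuous_on UNIV (classical_gradient \<phi>)"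
      unfolding classical_gradient_def
      by (intro continuous_on_sum continuous_on_scaleR continuous_on_const c(3))
    show "classical_gradient \<phi> x = 0" if "x \<notin> closure {x. \<phi> x \<noteq> 0}" for x
      using z(2)[OF that] by (simp add: classical_gradient_def)
  qed
qed

lemma test_function_integration_by_parts:
  assumes \<phi>: "\<phi> \<in> test_functions \<Omega>" and \<psi>: "\<psi> \<in> test_functions \<Omega>"
  shows "(LINT x|lebesgue. \<phi> x * frechet_derivative \<psi> (at x) b)
    = - (LINT x|lebesgue. frechet_derivative \<phi> (at x) b * \<psi> x)"
proof -
  let ?F = "\<lambda>x. \<phi> x * \<psi> x"
  note d = test_function_deriv[OF \<phi>] test_function_deriv[OF \<psi>] test_function_continuous[OF \<phi>] test_function_continuous[OF \<psi>]
  have eq: "frechet_derivative ?F (at x) b = \<phi> x * frechet_derivative \<psi> (at x) b + frechet_derivative \<phi> (at x) b * \<psi> x" for x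
    by (rule frechet_derivative_mult_real[OF d(1,3)])
  have 0: "(LINT x|lebesgue. frechet_derivative ?F (at x) b) = 0"
  proof (rule integral_directional_derivative_zero[where K="closure {x. \<phi> x \<noteq> 0}"])
    show "?F differentiable (at x)" for x using d by (auto intro: differentiable_mult)
    show "continuous_on UNIV (\<lambda>x. frechet_derivative ?F (at x) b)"
      unfolding eq using d by (intro continuous_intros) auto
    show "compact (closure {x. \<phi> x \<noteq> 0})" using \<phi> by (auto simp: test_functions_def)
    show "?F x = 0" if "x \<notin> closure {x. \<phi> x \<noteq> 0}" for x
      using test_function_support[OF \<phi> that] by simp
  qed
  have i: "integrable lebesgue (\<lambda>x. \<phi> x * frechet_derivative \<psi> (at x) b)"
    "integrable lebesgue (\<lambda>x. frechet_derivative \<phi> (at x) b * \<psi> x)"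
    using L2_inner_integrable[OF test_function_L2(1)[OF \<phi>] test_function_L2(2)[OF \<psi>, of b]]
      L2_inner_integrable[OF test_function_L2(2)[OF \<phi>, of b] test_function_L2(1)[OF \<psi>]]
    by (simp_all add: lebesgue_on_UNIV_eq)
  show ?thesis using 0 unfolding eq by (simp add: Bochner_Integration.integral_add[OF i])
qed

section \<open>The graph of the weak gradient\<close>

definition zero_ext :: "'a set \<Rightarrow> ('a \<Rightarrow> 'b::zero) \<Rightarrow> 'a \<Rightarrow> 'b" where
  "zero_ext \<Omega> u x = (if x \<in> \<Omega> then u x else 0)"

text \<open>
  A function on the domain is identified with the class of its extension by zero. This embeds the
  square integrable functions on the domain isometrically into those on the whole space.
\<close>
definition class_on :: "'a::euclidean_space set \<Rightarrow> ('a \<Rightarrow> 'b::euclidean_space) \<Rightarrow> ('a, 'b) l2" where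
  "class_on \<Omega> u = of_fn (zero_ext \<Omega> u)"

lemma L2_subset: "u \<in> L2 UNIV \<Longrightarrow> \<Omega> \<in> sets lebesgue \<Longrightarrow> u \<in> L2 \<Omega>"
  using integrable_restrict_space[of \<Omega> lebesgue "\<lambda>x. (norm (u x))\<^sup>2"]
    integrable_mult_indicator[of \<Omega> lebesgue "\<lambda>x. (norm (u x))\<^sup>2"]
  by (auto simp: L2_def lebesgue_on_UNIV_eq measurable_restrict_space1)

context
  fixes \<Omega> :: "'a::euclidean_space set"
  assumes \<Omega>: "\<Omega> \<in> sets lebesgue"
begin

lemma zero_ext_L2: "u \<in> L2 \<Omega> \<Longrightarrow> zero_ext \<Omega> u \<in> L2 UNIV"
proof -
  assume u: "u \<in> L2 \<Omega>"
  have "zero_ext \<Omega> u \<in> borel_measurable lebesgue"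
    using L2_measurable[OF u] \<Omega> unfolding zero_ext_def by (simp add: borel_measurable_if)
  moreover have "integrable lebesgue (\<lambda>x. indicator \<Omega> x *\<^sub>R (norm (u x))\<^sup>2)"
    using L2_integrable_sq[OF u] \<Omega> by (simp add: integrable_restrict_space)
  moreover have "(\<lambda>x. indicator \<Omega> x *\<^sub>R (norm (u x))\<^sup>2) = (\<lambda>x. (norm (zero_ext \<Omega> u x))\<^sup>2)"
    by (auto simp: zero_ext_def indicator_def fun_eq_iff)
  ultimately show ?thesis by (simp add: L2_def lebesgue_on_UNIV_eq)
qed

lemma fn_L2_on: "fn U \<in> L2 \<Omega>"
  by (rule L2_subset[OF fn_L2 \<Omega>])

lemma class_on_eq_iff:
  assumes "u \<in> L2 \<Omega>" "v \<in> L2 \<Omega>"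
  shows "class_on \<Omega> u = class_on \<Omega> v \<longleftrightarrow> (AE x in lebesgue_on \<Omega>. u x = v x)"
  unfolding class_on_def of_fn_eq_iff[OF assms[THEN zero_ext_L2]]
  using \<Omega> by (auto simp: AE_restrict_space_iff zero_ext_def elim!: eventually_mono)

lemma class_on_add: "u \<in> L2 \<Omega> \<Longrightarrow> v \<in> L2 \<Omega> \<Longrightarrow> class_on \<Omega> (\<lambda>x. u x + v x) = class_on \<Omega> u + class_on \<Omega> v"
  unfolding class_on_def by (subst of_fn_add) (auto intro!: zero_ext_L2 arg_cong[where f=of_fn] simp: zero_ext_def)

lemma class_on_diff: "u \<in> L2 \<Omega> \<Longrightarrow> v \<in> L2 \<Omega> \<Longrightarrow> class_on \<Omega> (\<lambda>x. u x - v x) = class_on \<Omega> u - class_on \<Omega> v"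
  unfolding class_on_def by (subst of_fn_diff) (auto intro!: zero_ext_L2 arg_cong[where f=of_fn] simp: zero_ext_def)

lemma class_on_scaleR: "u \<in> L2 \<Omega> \<Longrightarrow> class_on \<Omega> (\<lambda>x. c *\<^sub>R u x) = c *\<^sub>R class_on \<Omega> u"
  unfolding class_on_def by (subst of_fn_scaleR) (auto intro!: zero_ext_L2 arg_cong[where f=of_fn] simp: zero_ext_def)

lemma lebesgue_on_zero_ext:
  fixes F :: "'a \<Rightarrow> real"
  assumes "\<And>x. x \<in> \<Omega> \<Longrightarrow> F x = H x" "\<And>x. x \<notin> \<Omega> \<Longrightarrow> H x = 0"
  shows "(LINT x|lebesgue_on \<Omega>. F x) = (LINT x|lebesgue. H x)"
proof -
  have "(LINT x|lebesgue_on \<Omega>. F x) = (LINT x|lebesgue_on \<Omega>. H x)"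
    using assms(1) by (intro Bochner_Integration.integral_cong) auto
  also have "\<dots> = (LINT x|lebesgue. H x)" by (rule integral_lebesgue_on_support[OF assms(2) \<Omega>])
  finally show ?thesis .
qed

lemma class_on_inner: "u \<in> L2 \<Omega> \<Longrightarrow> v \<in> L2 \<Omega> \<Longrightarrow> class_on \<Omega> u \<bullet> class_on \<Omega> v = L2_inner \<Omega> u v"
  unfolding class_on_def L2_inner_def
  by (subst of_fn_inner) (auto intro!: zero_ext_L2 lebesgue_on_zero_ext[symmetric] simp: zero_ext_def)

lemma class_on_norm: "u \<in> L2 \<Omega> \<Longrightarrow> norm (class_on \<Omega> u) = L2_norm \<Omega> u"
  by (simp add: norm_eq_sqrt_inner class_on_inner L2_norm_def)

lemma fn_class_on: "u \<in> L2 \<Omega> \<Longrightarrow> AE x in lebesgue_on \<Omega>. fn (class_on \<Omega> u) x = u x"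
  using fn_of_fn[OF zero_ext_L2] \<Omega>
  by (fastforce simp: AE_restrict_space_iff class_on_def zero_ext_def elim!: eventually_mono)

lemma inner_class_on: "h \<in> L2 \<Omega> \<Longrightarrow> U \<bullet> class_on \<Omega> h = L2_inner \<Omega> (fn U) h"
proof -
  assume h: "h \<in> L2 \<Omega>"
  have "U \<bullet> class_on \<Omega> h = of_fn (fn U) \<bullet> of_fn (zero_ext \<Omega> h)" by (simp add: of_fn_fn class_on_def)
  also have "\<dots> = (LINT x|lebesgue. fn U x \<bullet> zero_ext \<Omega> h x)"
    by (rule of_fn_inner[OF fn_L2 zero_ext_L2[OF h]])
  also have "\<dots> = L2_inner \<Omega> (fn U) h"
    unfolding L2_inner_def by (rule lebesgue_on_zero_ext[symmetric]) (auto simp: zero_ext_def)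
  finally show ?thesis .
qed

definition restrict_l2 :: "('a, 'b::euclidean_space) l2 \<Rightarrow> ('a, 'b) l2" where
  "restrict_l2 U = class_on \<Omega> (fn U)"

lemma restrict_l2_norm: "norm (restrict_l2 U) \<le> norm U"
proof -
  have "(norm (restrict_l2 U))\<^sup>2 = U \<bullet> restrict_l2 U"
    unfolding power2_norm_eq_inner restrict_l2_def class_on_inner[OF fn_L2_on fn_L2_on]
    by (rule inner_class_on[OF fn_L2_on, symmetric])
  also have "\<dots> \<le> norm U * norm (restrict_l2 U)" by (rule norm_cauchy_schwarz)
  finally have "norm (restrict_l2 U) * norm (restrict_l2 U) \<le> norm U * norm (restrict_l2 U)"
    by (simp add: power2_eq_square)
  then show ?thesis by (cases "norm (restrict_l2 U) = 0") (auto simp: mult_le_cancel_right)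
qed

lemma class_on_cong_lebesgue:
  assumes "AE x in lebesgue. u x = v x" "u \<in> L2 \<Omega>" "v \<in> L2 \<Omega>"
  shows "class_on \<Omega> u = class_on \<Omega> v"
  using assms \<Omega> by (subst class_on_eq_iff) (auto simp: AE_restrict_space_iff)

lemma bounded_linear_restrict_l2: "bounded_linear (restrict_l2 :: ('a, 'b::euclidean_space) l2 \<Rightarrow> _)"
proof (rule bounded_linear_intro[where K=1])
  fix U V :: "('a, 'b) l2" and c :: real
  show "restrict_l2 (U + V) = restrict_l2 U + restrict_l2 V"
    unfolding restrict_l2_def class_on_add[OF fn_L2_on fn_L2_on, symmetric]
    by (rule class_on_cong_lebesgue[OF fn_add fn_L2_on L2_add[OF fn_L2_on fn_L2_on]])
  show "restrict_l2 (c *\<^sub>R U) = c *\<^sub>R restrict_l2 U"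
    unfolding restrict_l2_def class_on_scaleR[OF fn_L2_on, symmetric]
    by (rule class_on_cong_lebesgue[OF fn_scaleR fn_L2_on L2_scaleR[OF fn_L2_on]])
  show "norm (restrict_l2 U) \<le> norm U * 1" using restrict_l2_norm[of U] by simp
qed

lemma restrict_class_on: "u \<in> L2 \<Omega> \<Longrightarrow> restrict_l2 (class_on \<Omega> u) = class_on \<Omega> u"
  unfolding restrict_l2_def by (subst class_on_eq_iff) (auto intro: fn_L2_on fn_class_on)

text \<open>
  Vanishing outside the domain is a closed condition, so it passes to closures of sets of test
  functions.
\<close>
lemma closed_restrict_fixed: "closed {U :: ('a, 'b::euclidean_space) l2. restrict_l2 U = U}"
  by (intro closed_Collect_eq linear_continuous_on bounded_linear_restrict_l2 continuous_on_id)

end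

lemma subspace_closure_normed:
  fixes S :: "'v::real_normed_vector set"
  assumes "subspace S" shows "subspace (closure S)"
  unfolding subspace_def
proof (intro conjI ballI allI)
  show "0 \<in> closure S" using subspace_0[OF assms] closure_subset by blast
next
  fix x y assume "x \<in> closure S" "y \<in> closure S"
  then obtain f g where "\<And>n. f n \<in> S" "f \<longlonglongrightarrow> x" "\<And>n. g n \<in> S" "g \<longlonglongrightarrow> y"
    unfolding closure_sequential by blast
  then have "\<And>n. f n + g n \<in> S" "(\<lambda>n. f n + g n) \<longlonglongrightarrow> x + y"
    using assms by (auto intro: tendsto_add subspace_add)
  then show "x + y \<in> closure S" unfolding closure_sequential by (intro exI[of _ "\<lambda>n. f n + g n"]) auto
next
  fix c x assume "x \<in> closure S"
  then obtain f where "\<And>n. f n \<in> S" "f \<longlonglongrightarrow> x" unfolding closure_sequential by blast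
  then have "\<And>n. c *\<^sub>R f n \<in> S" "(\<lambda>n. c *\<^sub>R f n) \<longlonglongrightarrow> c *\<^sub>R x"
    using assms by (auto intro: tendsto_scaleR subspace_scale)
  then show "c *\<^sub>R x \<in> closure S" unfolding closure_sequential by (intro exI[of _ "\<lambda>n. c *\<^sub>R f n"]) auto
qed

lemma test_functions_add:
  assumes "\<phi> \<in> test_functions \<Omega>" "\<psi> \<in> test_functions \<Omega>"
  shows "(\<lambda>x. \<phi> x + \<psi> x) \<in> test_functions \<Omega>"
proof -
  have "{x. \<phi> x + \<psi> x \<noteq> 0} \<subseteq> {x. \<phi> x \<noteq> 0} \<union> {x. \<psi> x \<noteq> 0}" by auto
  then have sub: "closure {x. \<phi> x + \<psi> x \<noteq> 0} \<subseteq> closure {x. \<phi> x \<noteq> 0} \<union> closure {x. \<psi> x \<noteq> 0}"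
    unfolding closure_Un[symmetric] by (rule closure_mono)
  moreover have "compact (closure {x. \<phi> x \<noteq> 0} \<union> closure {x. \<psi> x \<noteq> 0})"
    using assms by (intro compact_Un) (auto simp: test_functions_def)
  then have "compact (closure {x. \<phi> x + \<psi> x \<noteq> 0})"
    using bounded_subset[OF compact_imp_bounded sub] by (simp add: compact_eq_bounded_closed)
  ultimately show ?thesis using assms by (auto simp: test_functions_def intro: C_k_add)
qed

lemma test_functions_scale:
  assumes "\<phi> \<in> test_functions \<Omega>"
  shows "(\<lambda>x. c * \<phi> x) \<in> test_functions \<Omega>"
proof -
  have sub: "closure {x. c * \<phi> x \<noteq> 0} \<subseteq> closure {x. \<phi> x \<noteq> 0}"
    by (rule closure_mono) auto
  moreover have "compact (closure {x. c * \<phi> x \<noteq> 0})"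
    using bounded_subset[OF compact_imp_bounded sub] assms by (simp add: compact_eq_bounded_closed test_functions_def)
  ultimately show ?thesis using assms by (auto simp: test_functions_def intro: C_k_mult C_k_const)
qed

lemma test_functions_zero: "(\<lambda>x. 0) \<in> test_functions \<Omega>"
  by (simp add: test_functions_def C_k_const)

lemma classical_gradient_add:
  assumes "\<phi> \<in> test_functions \<Omega>" "\<psi> \<in> test_functions \<Omega>"
  shows "classical_gradient (\<lambda>x. \<phi> x + \<psi> x) x = classical_gradient \<phi> x + classical_gradient \<psi> x"
proof -
  have "((\<lambda>x. \<phi> x + \<psi> x) has_derivative (\<lambda>h. frechet_derivative \<phi> (at x) h + frechet_derivative \<psi> (at x) h)) (at x)"
    using test_function_deriv(1)[OF assms(1)] test_function_deriv(1)[OF assms(2)]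
    by (intro has_derivative_add) (simp_all add: frechet_derivative_works[symmetric])
  from frechet_derivative_at[OF this, symmetric] show ?thesis
    by (simp add: classical_gradient_def scaleR_add_left sum.distrib)
qed

lemma classical_gradient_scale:
  assumes "\<phi> \<in> test_functions \<Omega>"
  shows "classical_gradient (\<lambda>x. c * \<phi> x) x = c *\<^sub>R classical_gradient \<phi> x"
proof -
  have "((\<lambda>x. c * \<phi> x) has_derivative (\<lambda>h. c * frechet_derivative \<phi> (at x) h)) (at x)"
    using test_function_deriv(1)[OF assms(1)]
    by (intro has_derivative_mult_right) (simp_all add: frechet_derivative_works[symmetric])
  from frechet_derivative_at[OF this, symmetric] show ?thesis
    by (simp add: classical_gradient_def scaleR_sum_right)
qed

definition smooth_graph :: "'a::euclidean_space set \<Rightarrow> (('a, real) l2 \<times> ('a, 'a) l2) set" where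
  "smooth_graph \<Omega> = (\<lambda>\<phi>. (of_fn \<phi>, of_fn (classical_gradient \<phi>))) ` test_functions \<Omega>"

text \<open>
  The space \<open>H\<^sub>0\<^sup>1\<close> in the form of pairs \<open>(u, \<nabla>u)\<close>: the closure of the test functions with their
  classical gradients.
\<close>
definition gradient_graph :: "'a::euclidean_space set \<Rightarrow> (('a, real) l2 \<times> ('a, 'a) l2) set" where
  "gradient_graph \<Omega> = closure (smooth_graph \<Omega>)"

lemma subspace_gradient_graph: "subspace (gradient_graph \<Omega>)"
proof -
  have "subspace (smooth_graph \<Omega>)"
    unfolding subspace_def
  proof (intro conjI ballI allI)
    have "classical_gradient (\<lambda>x::'a. 0::real) = (\<lambda>x. 0)" by (simp add: classical_gradient_def fun_eq_iff)
    then show "0 \<in> smooth_graph \<Omega>"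
      unfolding smooth_graph_def zero_prod_def zero_l2.abs_eq
      by (intro image_eqI[OF _ test_functions_zero]) (simp add: zero_l2_def)
  next
    fix x y assume "x \<in> smooth_graph \<Omega>" "y \<in> smooth_graph \<Omega>"
    then obtain \<phi> \<psi> where t: "\<phi> \<in> test_functions \<Omega>" "\<psi> \<in> test_functions \<Omega>"
      "x = (of_fn \<phi>, of_fn (classical_gradient \<phi>))" "y = (of_fn \<psi>, of_fn (classical_gradient \<psi>))"
      by (auto simp: smooth_graph_def)
    then show "x + y \<in> smooth_graph \<Omega>" unfolding smooth_graph_def
      by (intro image_eqI[OF _ test_functions_add[OF t(1,2)]])
        (simp add: of_fn_add[OF test_function_L2(1) test_function_L2(1)] of_fn_add[OF test_function_L2(3) test_function_L2(3)]
          ext[OF classical_gradient_add[OF t(1,2)]])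
  next
    fix c x assume "x \<in> smooth_graph \<Omega>"
    then obtain \<phi> where t: "\<phi> \<in> test_functions \<Omega>" "x = (of_fn \<phi>, of_fn (classical_gradient \<phi>))"
      by (auto simp: smooth_graph_def)
    then show "c *\<^sub>R x \<in> smooth_graph \<Omega>" unfolding smooth_graph_def
      by (intro image_eqI[OF _ test_functions_scale[OF t(1), of c]])
        (simp add: of_fn_scaleR[OF test_function_L2(1)] of_fn_scaleR[OF test_function_L2(3)] ext[OF classical_gradient_scale[OF t(1)]])
  qed
  then show ?thesis unfolding gradient_graph_def by (rule subspace_closure_normed)
qed

text \<open>
  Closed properties of pairs need to be checked only for test functions.
\<close>
lemma gradient_graph_induct:
  assumes "z \<in> gradient_graph \<Omega>" and "closed {z. P z}"
    and "\<And>\<phi>. \<phi> \<in> test_functions \<Omega> \<Longrightarrow> P (of_fn \<phi>, of_fn (classical_gradient \<phi>))"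
  shows "P z"
proof -
  have "smooth_graph \<Omega> \<subseteq> {z. P z}" using assms(3) by (auto simp: smooth_graph_def)
  then have "gradient_graph \<Omega> \<subseteq> {z. P z}" unfolding gradient_graph_def by (rule closure_minimal[OF _ assms(2)])
  then show ?thesis using assms(1) by blast
qed

lemma grad_spec: "u \<in> H1 \<Omega> \<Longrightarrow> grad \<Omega> u \<in> L2 \<Omega>" "u \<in> H1 \<Omega> \<Longrightarrow> weak_gradient \<Omega> u (grad \<Omega> u)"
proof -
  assume "u \<in> H1 \<Omega>"
  then have "\<exists>g. g \<in> L2 \<Omega> \<and> weak_gradient \<Omega> u g" by (auto simp: H1_def)
  from someI_ex[OF this] show "grad \<Omega> u \<in> L2 \<Omega>" "weak_gradient \<Omega> u (grad \<Omega> u)"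
    by (simp_all add: grad_def)
qed

lemma L2_component: "u \<in> L2 \<Omega> \<Longrightarrow> (\<lambda>x. u x \<bullet> b) \<in> L2 \<Omega>"
proof (rule L2_I[where g="\<lambda>x. (norm b)\<^sup>2 * (norm (u x))\<^sup>2"])
  assume u: "u \<in> L2 \<Omega>"
  show "(\<lambda>x. u x \<bullet> b) \<in> borel_measurable (lebesgue_on \<Omega>)"
    using L2_measurable[OF u] by (intro borel_measurable_inner) auto
  show "integrable (lebesgue_on \<Omega>) (\<lambda>x. (norm b)\<^sup>2 * (norm (u x))\<^sup>2)"
    by (intro integrable_mult_right L2_integrable_sq u)
  have "(u x \<bullet> b)\<^sup>2 \<le> (norm b)\<^sup>2 * (norm (u x))\<^sup>2" for x
    using Cauchy_Schwarz_ineq[of "u x" b] by (simp add: power2_norm_eq_inner mult.commute)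
  then show "AE x in lebesgue_on \<Omega>. (norm (u x \<bullet> b))\<^sup>2 \<le> (norm b)\<^sup>2 * (norm (u x))\<^sup>2" by simp
qed

text \<open>
  The fundamental lemma applied to the components of the difference. Together with
  the choice operator in the definition of \<open>grad\<close> this makes \<open>grad\<close> a linear operation almost
  everywhere.
\<close>
lemma weak_gradient_unique:
  assumes \<Omega>: "open \<Omega>" and L: "g \<in> L2 \<Omega>" "h \<in> L2 \<Omega>" and w: "weak_gradient \<Omega> u g" "weak_gradient \<Omega> u h"
  shows "AE x in lebesgue_on \<Omega>. g x = h x"
proof -
  have \<Omega>s: "\<Omega> \<in> sets lebesgue" using \<Omega> by (simp add: borel_open)
  have "AE x in lebesgue_on \<Omega>. g x \<bullet> b - h x \<bullet> b = 0" if b: "b \<in> Basis" for b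
  proof (rule fundamental_lemma_calculus_of_variations[OF \<Omega>])
    show "(\<lambda>x. g x \<bullet> b - h x \<bullet> b) \<in> L2 \<Omega>" by (intro L2_diff L2_component L)
    fix \<phi> assume \<phi>: "\<phi> \<in> test_functions \<Omega>"
    have \<phi>L: "\<phi> \<in> L2 \<Omega>" by (rule L2_subset[OF test_function_L2(1)[OF \<phi>] \<Omega>s])
    have i: "integrable (lebesgue_on \<Omega>) (\<lambda>x. (k x \<bullet> b) * \<phi> x)" if "k \<in> L2 \<Omega>" for k
      using L2_inner_integrable[OF L2_component[OF that] \<phi>L] by simp
    have "(LINT x|lebesgue_on \<Omega>. (g x \<bullet> b) * \<phi> x) = (LINT x|lebesgue_on \<Omega>. (h x \<bullet> b) * \<phi> x)"
      using w \<phi> b by (auto simp: weak_gradient_def)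
    then show "(LINT x|lebesgue_on \<Omega>. (g x \<bullet> b - h x \<bullet> b) * \<phi> x) = 0"
      using i[OF L(1)] i[OF L(2)] by (simp add: left_diff_distrib)
  qed
  then have "AE x in lebesgue_on \<Omega>. \<forall>b\<in>Basis. g x \<bullet> b - h x \<bullet> b = 0"
    by (intro AE_finite_allI) auto
  then show ?thesis by eventually_elim (auto intro: euclidean_eqI)
qed

context
  fixes \<Omega> :: "'a::euclidean_space set"
  assumes open_\<Omega>: "open \<Omega>"
begin

lemma \<Omega>_sets: "\<Omega> \<in> sets lebesgue" using open_\<Omega> by (simp add: borel_open)

lemma test_function_L2_on:
  assumes "\<phi> \<in> test_functions \<Omega>"
  shows "\<phi> \<in> L2 \<Omega>" "classical_gradient \<phi> \<in> L2 \<Omega>" "(\<lambda>x. frechet_derivative \<phi> (at x) b) \<in> L2 \<Omega>"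
  using test_function_L2[OF assms] L2_subset[OF _ \<Omega>_sets] by auto

lemma test_function_class:
  assumes "\<phi> \<in> test_functions \<Omega>"
  shows "class_on \<Omega> \<phi> = of_fn \<phi>" "class_on \<Omega> (classical_gradient \<phi>) = of_fn (classical_gradient \<phi>)"
proof -
  have "zero_ext \<Omega> \<phi> = \<phi>" "zero_ext \<Omega> (classical_gradient \<phi>) = classical_gradient \<phi>"
    using test_function_zero_outside[OF assms] by (auto simp: zero_ext_def fun_eq_iff)
  then show "class_on \<Omega> \<phi> = of_fn \<phi>" "class_on \<Omega> (classical_gradient \<phi>) = of_fn (classical_gradient \<phi>)"
    by (simp_all add: class_on_def)
qed

lemma gradient_graph_restrict:
  assumes "(U, g) \<in> gradient_graph \<Omega>"
  shows "class_on \<Omega> (fn U) = U" "class_on \<Omega> (fn g) = g"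
proof -
  have "restrict_l2 \<Omega> (fst (U, g)) = fst (U, g) \<and> restrict_l2 \<Omega> (snd (U, g)) = snd (U, g)"
  proof (rule gradient_graph_induct[OF assms])
    have "closed (fst -` {U. restrict_l2 \<Omega> U = U} \<inter> snd -` {U. restrict_l2 \<Omega> U = U}
        :: (('a, real) l2 \<times> ('a, 'a) l2) set)"
      by (intro closed_Int closed_vimage closed_restrict_fixed \<Omega>_sets continuous_intros)
    moreover have "(fst -` {U. restrict_l2 \<Omega> U = U} \<inter> snd -` {U. restrict_l2 \<Omega> U = U}
        :: (('a, real) l2 \<times> ('a, 'a) l2) set) = {z. restrict_l2 \<Omega> (fst z) = fst z \<and> restrict_l2 \<Omega> (snd z) = snd z}"
      by auto
    ultimately show "closed {z :: ('a, real) l2 \<times> ('a, 'a) l2. restrict_l2 \<Omega> (fst z) = fst z \<and> restrict_l2 \<Omega> (snd z) = snd z}" by simp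
    fix \<phi> assume \<phi>: "\<phi> \<in> test_functions \<Omega>"
    show "restrict_l2 \<Omega> (fst (of_fn \<phi>, of_fn (classical_gradient \<phi>))) = fst (of_fn \<phi>, of_fn (classical_gradient \<phi>)) \<and>
         restrict_l2 \<Omega> (snd (of_fn \<phi>, of_fn (classical_gradient \<phi>))) = snd (of_fn \<phi>, of_fn (classical_gradient \<phi>))"
      using restrict_class_on[OF \<Omega>_sets test_function_L2_on(1)[OF \<phi>]] restrict_class_on[OF \<Omega>_sets test_function_L2_on(2)[OF \<phi>]]
      by (simp add: test_function_class[OF \<phi>])
  qed
  then show "class_on \<Omega> (fn U) = U" "class_on \<Omega> (fn g) = g" by (simp_all add: restrict_l2_def[OF \<Omega>_sets])
qed

text \<open>
  Integration by parts against a fixed test function is a closed condition on the pair.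
\<close>
lemma gradient_graph_weak:
  assumes "(U, g) \<in> gradient_graph \<Omega>" and \<psi>: "\<psi> \<in> test_functions \<Omega>" and b: "b \<in> Basis"
  shows "U \<bullet> class_on \<Omega> (\<lambda>x. frechet_derivative \<psi> (at x) b) = - (g \<bullet> class_on \<Omega> (\<lambda>x. \<psi> x *\<^sub>R b))"
proof -
  have "(\<lambda>x. \<psi> x *\<^sub>R b) \<in> L2 \<Omega>"
    using test_function_L2_on(1)[OF \<psi>] by (auto simp: L2_def power_mult_distrib)
  note L = test_function_L2_on(3)[OF \<psi>, of b] this
  let ?D = "class_on \<Omega> (\<lambda>x. frechet_derivative \<psi> (at x) b)" and ?E = "class_on \<Omega> (\<lambda>x. \<psi> x *\<^sub>R b)"
  have "fst (U, g) \<bullet> ?D = - (snd (U, g) \<bullet> ?E)"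
  proof (rule gradient_graph_induct[OF assms(1)])
    show "closed {z. fst z \<bullet> ?D = - (snd z \<bullet> ?E)}"
      by (intro closed_Collect_eq continuous_intros)
    fix \<phi> assume \<phi>: "\<phi> \<in> test_functions \<Omega>"
    have "class_on \<Omega> \<phi> \<bullet> ?D = (LINT x|lebesgue. \<phi> x * frechet_derivative \<psi> (at x) b)"
      unfolding class_on_inner[OF \<Omega>_sets test_function_L2_on(1)[OF \<phi>] L(1)] L2_inner_def
      using test_function_zero_outside[OF \<phi>] by (intro lebesgue_on_zero_ext \<Omega>_sets) auto
    also have "\<dots> = - (LINT x|lebesgue. frechet_derivative \<phi> (at x) b * \<psi> x)"
      by (rule test_function_integration_by_parts[OF \<phi> \<psi>])
    also have "(LINT x|lebesgue. frechet_derivative \<phi> (at x) b * \<psi> x) = class_on \<Omega> (classical_gradient \<phi>) \<bullet> ?E"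
      unfolding class_on_inner[OF \<Omega>_sets test_function_L2_on(2)[OF \<phi>] L(2)] L2_inner_def
      using test_function_zero_outside[OF \<phi>]
      by (intro lebesgue_on_zero_ext[symmetric] \<Omega>_sets) (auto simp: classical_gradient_inner[OF b])
    finally show "fst (of_fn \<phi>, of_fn (classical_gradient \<phi>)) \<bullet> ?D = - (snd (of_fn \<phi>, of_fn (classical_gradient \<phi>)) \<bullet> ?E)"
      by (simp add: test_function_class[OF \<phi>])
  qed
  then show ?thesis by simp
qed

text \<open>
  The second component of a pair in the graph is a weak gradient, hence by uniqueness it is the
  chosen one. Thus the Sobolev norm is the norm of the product Hilbert space.
\<close>
lemma gradient_graph_H1:
  assumes G: "(U, g) \<in> gradient_graph \<Omega>" and f: "f \<in> L2 \<Omega>" "class_on \<Omega> f = U"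
  shows "f \<in> H1 \<Omega>" "class_on \<Omega> (grad \<Omega> f) = g" "H1_norm \<Omega> f = norm (U, g)"
proof -
  have w: "weak_gradient \<Omega> f (fn g)"
    unfolding weak_gradient_def
  proof (intro ballI)
    fix \<psi> and b :: 'a assume \<psi>: "\<psi> \<in> test_functions \<Omega>" and b: "b \<in> Basis"
    have "(\<lambda>x. \<psi> x *\<^sub>R b) \<in> L2 \<Omega>"
      using test_function_L2_on(1)[OF \<psi>] by (auto simp: L2_def power_mult_distrib)
    note L = test_function_L2_on(3)[OF \<psi>, of b] this
    show "(LINT x|lebesgue_on \<Omega>. f x * frechet_derivative \<psi> (at x) b) =
        - (LINT x|lebesgue_on \<Omega>. (fn g x \<bullet> b) * \<psi> x)"
      using gradient_graph_weak[OF G \<psi> b] class_on_inner[OF \<Omega>_sets f(1) L(1)] inner_class_on[OF \<Omega>_sets L(2), of g]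
      by (simp add: f(2) L2_inner_def mult.commute)
  qed
  show H1: "f \<in> H1 \<Omega>" using f(1) w fn_L2_on[OF \<Omega>_sets, of g] by (auto simp: H1_def)
  have "AE x in lebesgue_on \<Omega>. grad \<Omega> f x = fn g x"
    by (rule weak_gradient_unique[OF open_\<Omega> grad_spec(1)[OF H1] fn_L2_on[OF \<Omega>_sets] grad_spec(2)[OF H1] w])
  then show cg: "class_on \<Omega> (grad \<Omega> f) = g"
    using class_on_eq_iff[OF \<Omega>_sets grad_spec(1)[OF H1] fn_L2_on[OF \<Omega>_sets, of g]] gradient_graph_restrict(2)[OF G] by simp
  show "H1_norm \<Omega> f = norm (U, g)"
    unfolding H1_norm_def norm_Pair
    by (simp add: class_on_norm[OF \<Omega>_sets f(1), symmetric] class_on_norm[OF \<Omega>_sets grad_spec(1)[OF H1], symmetric] f(2) cg)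
qed

lemma smooth_in_gradient_graph: "\<phi> \<in> test_functions \<Omega> \<Longrightarrow> (of_fn \<phi>, of_fn (classical_gradient \<phi>)) \<in> gradient_graph \<Omega>"
  using closure_subset[of "smooth_graph \<Omega>"] by (auto simp: gradient_graph_def smooth_graph_def)

lemma gradient_graph_H10:
  assumes G: "(U, g) \<in> gradient_graph \<Omega>" and f: "f \<in> L2 \<Omega>" "class_on \<Omega> f = U"
  shows "f \<in> H10 \<Omega>"
proof -
  obtain z where z: "\<And>n. z n \<in> smooth_graph \<Omega>" "z \<longlonglongrightarrow> (U, g)"
    using G unfolding gradient_graph_def closure_sequential by blast
  then have "\<forall>n. \<exists>\<phi>. \<phi> \<in> test_functions \<Omega> \<and> z n = (of_fn \<phi>, of_fn (classical_gradient \<phi>))"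
    by (auto simp: smooth_graph_def)
  then obtain \<phi> where \<phi>: "\<And>n. \<phi> n \<in> test_functions \<Omega>" "\<And>n. z n = (of_fn (\<phi> n), of_fn (classical_gradient (\<phi> n)))"
    by metis
  have "H1_norm \<Omega> (\<lambda>x. \<phi> n x - f x) = norm (z n - (U, g))" for n
  proof -
    have "z n - (U, g) \<in> gradient_graph \<Omega>"
      unfolding \<phi>(2) by (intro subspace_diff subspace_gradient_graph smooth_in_gradient_graph \<phi> G)
    then have "(of_fn (\<phi> n) - U, of_fn (classical_gradient (\<phi> n)) - g) \<in> gradient_graph \<Omega>" by (simp add: \<phi>(2))
    from gradient_graph_H1(3)[OF this L2_diff[OF test_function_L2_on(1)[OF \<phi>(1)] f(1)]]
    show ?thesis
      by (simp add: class_on_diff[OF \<Omega>_sets test_function_L2_on(1)[OF \<phi>(1)] f(1)] test_function_class[OF \<phi>(1)] f(2) \<phi>(2))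
  qed
  moreover have "(\<lambda>n. norm (z n - (U, g))) \<longlonglongrightarrow> 0" using z(2) by (simp add: LIM_zero_iff tendsto_norm_zero_iff)
  ultimately have "(\<lambda>n. H1_norm \<Omega> (\<lambda>x. \<phi> n x - f x)) \<longlonglongrightarrow> 0" by simp
  then show ?thesis using \<phi>(1) gradient_graph_H1(1)[OF G f] by (auto simp: H10_def)
qed

text \<open>
  The converse inclusion: approximation by test functions in the Sobolev norm is convergence of
  the pairs, because the chosen gradient of a difference is the difference of the gradients almost
  everywhere.
\<close>
lemma H10_gradient_graph:
  assumes "f \<in> H10 \<Omega>"
  shows "f \<in> L2 \<Omega>" "(class_on \<Omega> f, class_on \<Omega> (grad \<Omega> f)) \<in> gradient_graph \<Omega>"
proof -
  have H1: "f \<in> H1 \<Omega>" using assms by (simp add: H10_def)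
  then show f: "f \<in> L2 \<Omega>" by (simp add: H1_def)
  note g = grad_spec[OF H1]
  obtain \<phi> where \<phi>: "\<And>k. \<phi> k \<in> test_functions \<Omega>" "(\<lambda>k::nat. H1_norm \<Omega> (\<lambda>x. \<phi> k x - f x)) \<longlonglongrightarrow> 0"
    using assms by (auto simp: H10_def)
  define z where "z = (\<lambda>k. (of_fn (\<phi> k), of_fn (classical_gradient (\<phi> k))))"
  let ?w = "(class_on \<Omega> f, class_on \<Omega> (grad \<Omega> f))"
  have "H1_norm \<Omega> (\<lambda>x. \<phi> k x - f x) = norm (z k - ?w)" for k
  proof -
    let ?d = "\<lambda>x. \<phi> k x - f x" and ?e = "\<lambda>x. classical_gradient (\<phi> k) x - grad \<Omega> f x"
    note L = test_function_L2_on[OF \<phi>(1)[of k]]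
    have dL: "?d \<in> L2 \<Omega>" and eL: "?e \<in> L2 \<Omega>" by (intro L2_diff L f g)+
    have w1: "weak_gradient \<Omega> (\<phi> k) (classical_gradient (\<phi> k))"
    proof -
      note H = gradient_graph_H1[OF smooth_in_gradient_graph[OF \<phi>(1)] L(1) test_function_class(1)[OF \<phi>(1)]]
      have ae: "AE x in lebesgue_on \<Omega>. grad \<Omega> (\<phi> k) x = classical_gradient (\<phi> k) x"
        using H(2) class_on_eq_iff[OF \<Omega>_sets grad_spec(1)[OF H(1)] L(2)] test_function_class(2)[OF \<phi>(1)] by simp
      show ?thesis unfolding weak_gradient_def
      proof (intro ballI)
        fix \<psi> and b :: 'a assume \<psi>: "\<psi> \<in> test_functions \<Omega>" and b: "b \<in> Basis"
        have "(LINT x|lebesgue_on \<Omega>. (grad \<Omega> (\<phi> k) x \<bullet> b) * \<psi> x) = (LINT x|lebesgue_on \<Omega>. (classical_gradient (\<phi> k) x \<bullet> b) * \<psi> x)"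
          using L2_measurable[OF grad_spec(1)[OF H(1)]] L2_measurable[OF L(2)] L2_measurable[OF test_function_L2_on(1)[OF \<psi>]]
          by (intro integral_cong_AE borel_measurable_times borel_measurable_inner) (use ae in \<open>auto elim!: eventually_mono\<close>)
        then show "(LINT x|lebesgue_on \<Omega>. \<phi> k x * frechet_derivative \<psi> (at x) b) =
            - (LINT x|lebesgue_on \<Omega>. (classical_gradient (\<phi> k) x \<bullet> b) * \<psi> x)"
          using grad_spec(2)[OF H(1)] \<psi> b by (simp add: weak_gradient_def)
      qed
    qed
    have w: "weak_gradient \<Omega> ?d ?e" unfolding weak_gradient_def
    proof (intro ballI)
      fix \<psi> and b :: 'a assume \<psi>: "\<psi> \<in> test_functions \<Omega>" and b: "b \<in> Basis"
      note P = test_function_L2_on[OF \<psi>]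
      have "(LINT x|lebesgue_on \<Omega>. ?d x * frechet_derivative \<psi> (at x) b) =
         (LINT x|lebesgue_on \<Omega>. \<phi> k x * frechet_derivative \<psi> (at x) b) - (LINT x|lebesgue_on \<Omega>. f x * frechet_derivative \<psi> (at x) b)"
        unfolding left_diff_distrib
        using L2_inner_integrable[OF L(1) P(3)[of b]] L2_inner_integrable[OF f P(3)[of b]]
        by (intro Bochner_Integration.integral_diff) simp_all
      moreover have "(LINT x|lebesgue_on \<Omega>. (?e x \<bullet> b) * \<psi> x) =
         (LINT x|lebesgue_on \<Omega>. (classical_gradient (\<phi> k) x \<bullet> b) * \<psi> x) - (LINT x|lebesgue_on \<Omega>. (grad \<Omega> f x \<bullet> b) * \<psi> x)"
        unfolding left_diff_distrib inner_diff_left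
        using L2_inner_integrable[OF L2_component[OF L(2)] P(1), of b] L2_inner_integrable[OF L2_component[OF g(1)] P(1), of b]
        by (intro Bochner_Integration.integral_diff) simp_all
      ultimately show "(LINT x|lebesgue_on \<Omega>. ?d x * frechet_derivative \<psi> (at x) b) = - (LINT x|lebesgue_on \<Omega>. (?e x \<bullet> b) * \<psi> x)"
        using w1 g(2) \<psi> b by (simp add: weak_gradient_def)
    qed
    have H1d: "?d \<in> H1 \<Omega>" using dL eL w by (auto simp: H1_def)
    have "AE x in lebesgue_on \<Omega>. grad \<Omega> ?d x = ?e x"
      by (rule weak_gradient_unique[OF open_\<Omega> grad_spec(1)[OF H1d] eL grad_spec(2)[OF H1d] w])
    then have "class_on \<Omega> (grad \<Omega> ?d) = class_on \<Omega> ?e"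
      using class_on_eq_iff[OF \<Omega>_sets grad_spec(1)[OF H1d] eL] by simp
    then show ?thesis
      unfolding H1_norm_def z_def
      by (simp add: norm_Pair class_on_norm[OF \<Omega>_sets dL, symmetric] class_on_norm[OF \<Omega>_sets grad_spec(1)[OF H1d], symmetric]
          class_on_diff[OF \<Omega>_sets L(1) f] class_on_diff[OF \<Omega>_sets L(2) g(1)] test_function_class[OF \<phi>(1)])
  qed
  then have "(\<lambda>k. z k - ?w) \<longlonglongrightarrow> 0" using \<phi>(2) by (simp add: tendsto_norm_zero_iff)
  then have "z \<longlonglongrightarrow> ?w" by (simp add: LIM_zero_iff)
  moreover have "z k \<in> smooth_graph \<Omega>" for k using \<phi>(1) by (auto simp: z_def smooth_graph_def)
  ultimately show "?w \<in> gradient_graph \<Omega>" unfolding gradient_graph_def closure_sequential by blast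
qed

text \<open>
  Test functions are dense in the square integrable functions on the domain. A function orthogonal
  to all of them vanishes by the fundamental lemma, and the projection theorem turns this into
  density.
\<close>
lemma class_on_in_closure:
  assumes u: "u \<in> L2 \<Omega>"
  shows "class_on \<Omega> u \<in> closure (fst ` gradient_graph \<Omega>)"
proof -
  let ?S = "closure (fst ` gradient_graph \<Omega>)"
  have "subspace (fst ` gradient_graph \<Omega>)"
    by (intro linear_subspace_image subspace_gradient_graph bounded_linear.linear[OF bounded_linear_fst])
  then have "subspace ?S" by (rule subspace_closure_normed)
  then obtain p where p: "p \<in> ?S" "\<And>s. s \<in> ?S \<Longrightarrow> (class_on \<Omega> u - p) \<bullet> s = 0"
    using closed_subspace_projection[of ?S "class_on \<Omega> u"] by auto
  \<comment> \<open>The component orthogonal to the closure is orthogonal to all test functions.\<close>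
  define r where "r = class_on \<Omega> u - p"
  have "fst ` gradient_graph \<Omega> \<subseteq> {U. restrict_l2 \<Omega> U = U}"
    using gradient_graph_restrict(1) by (auto simp: restrict_l2_def[OF \<Omega>_sets])
  then have "?S \<subseteq> {U. restrict_l2 \<Omega> U = U}"
    by (rule closure_minimal[OF _ closed_restrict_fixed[OF \<Omega>_sets]])
  then have "restrict_l2 \<Omega> p = p" using p(1) by blast
  then have rr: "restrict_l2 \<Omega> r = r"
    unfolding r_def using restrict_class_on[OF \<Omega>_sets u]
    by (simp add: linear_diff[OF bounded_linear.linear[OF bounded_linear_restrict_l2[OF \<Omega>_sets]]])
  have "AE x in lebesgue_on \<Omega>. fn r x = 0"
  proof (rule fundamental_lemma_calculus_of_variations[OF open_\<Omega> fn_L2_on[OF \<Omega>_sets]])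
    fix \<phi> assume \<phi>: "\<phi> \<in> test_functions \<Omega>"
    have "class_on \<Omega> \<phi> \<in> fst ` gradient_graph \<Omega>"
      using smooth_in_gradient_graph[OF \<phi>] unfolding test_function_class(1)[OF \<phi>] by force
    then have "class_on \<Omega> \<phi> \<in> ?S" by (rule subsetD[OF closure_subset])
    then have "r \<bullet> class_on \<Omega> \<phi> = 0" unfolding r_def by (rule p(2))
    then show "(LINT x|lebesgue_on \<Omega>. fn r x * \<phi> x) = 0"
      by (simp add: inner_class_on[OF \<Omega>_sets test_function_L2_on(1)[OF \<phi>]] L2_inner_def)
  qed
  then have "class_on \<Omega> (fn r) = class_on \<Omega> (\<lambda>x. 0)"
    using class_on_eq_iff[OF \<Omega>_sets fn_L2_on[OF \<Omega>_sets] L2_zero] by blast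
  also have "\<dots> = 0"
    using class_on_scaleR[OF \<Omega>_sets L2_zero, of 0] by simp
  finally have "r = 0" using rr by (simp add: restrict_l2_def[OF \<Omega>_sets])
  then show ?thesis using p(1) by (simp add: r_def)
qed

end

section \<open>Nonlinearity and linear form on the space of square integrable functions\<close>

lemma L2_norm_mono:
  assumes u: "u \<in> L2 \<Omega>" and v: "v \<in> L2 \<Omega>" and K: "0 \<le> K"
    and le: "AE x in lebesgue_on \<Omega>. norm (u x) \<le> K * norm (v x)"
  shows "L2_norm \<Omega> u \<le> K * L2_norm \<Omega> v"
proof -
  have "(LINT x|lebesgue_on \<Omega>. (norm (u x))\<^sup>2) \<le> (LINT x|lebesgue_on \<Omega>. K\<^sup>2 * (norm (v x))\<^sup>2)"
  proof (rule integral_mono_AE)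
    show "AE x in lebesgue_on \<Omega>. (norm (u x))\<^sup>2 \<le> K\<^sup>2 * (norm (v x))\<^sup>2"
      using le
    proof eventually_elim
      fix x assume "norm (u x) \<le> K * norm (v x)"
      then have "(norm (u x))\<^sup>2 \<le> (K * norm (v x))\<^sup>2" by (intro power_mono) auto
      then show "(norm (u x))\<^sup>2 \<le> K\<^sup>2 * (norm (v x))\<^sup>2" by (simp add: power_mult_distrib)
    qed
  qed (intro integrable_mult_right L2_integrable_sq u v)+
  then have "sqrt (LINT x|lebesgue_on \<Omega>. (norm (u x))\<^sup>2) \<le> sqrt (K\<^sup>2 * (LINT x|lebesgue_on \<Omega>. (norm (v x))\<^sup>2))"
    by simp
  then show ?thesis using K by (simp add: L2_norm_def L2_inner_def power2_norm_eq_inner real_sqrt_mult)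
qed

lemma lipschitz_real_continuous:
  fixes F :: "real \<Rightarrow> real"
  assumes "\<And>s t. \<bar>F s - F t\<bar> \<le> K * \<bar>s - t\<bar>"
  shows "continuous_on UNIV F"
proof -
  have "\<bar>F s - F t\<bar> \<le> \<bar>K\<bar> * \<bar>s - t\<bar>" for s t
    by (rule order_trans[OF assms]) (auto intro: mult_right_mono)
  then show ?thesis
    using lipschitz_on_continuous_on[of "\<bar>K\<bar>" UNIV F] by (auto simp: lipschitz_on_def dist_real_def)
qed

text \<open>
  A Lipschitz function grows at most linearly, and its value at zero is square integrable because
  the domain has finite measure.
\<close>
lemma nemytskii_L2:
  fixes F :: "real \<Rightarrow> real"
  assumes \<Omega>: "\<Omega> \<in> sets lebesgue" "bounded \<Omega>" and u: "u \<in> L2 \<Omega>"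
    and F: "\<And>s t. \<bar>F s - F t\<bar> \<le> K * \<bar>s - t\<bar>"
  shows "(\<lambda>x. F (u x)) \<in> L2 \<Omega>"
proof (rule L2_I[where g="\<lambda>x. 2 * (K\<^sup>2 * (norm (u x))\<^sup>2 + \<bar>F 0\<bar>\<^sup>2)"])
  have "F \<in> borel_measurable borel"
    by (rule borel_measurable_continuous_onI[OF lipschitz_real_continuous[OF F]])
  then show "(\<lambda>x. F (u x)) \<in> borel_measurable (lebesgue_on \<Omega>)"
    using L2_measurable[OF u] by (rule measurable_compose[rotated])
  have "finite_measure (lebesgue_on \<Omega>)"
    using bounded_set_imp_lmeasurable[OF \<Omega>(2,1)] by (rule finite_measure_lebesgue_on)
  then have "integrable (lebesgue_on \<Omega>) (\<lambda>x. \<bar>F 0\<bar>\<^sup>2)" by (rule finite_measure.integrable_const)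
  then show "integrable (lebesgue_on \<Omega>) (\<lambda>x. 2 * (K\<^sup>2 * (norm (u x))\<^sup>2 + \<bar>F 0\<bar>\<^sup>2))"
    by (intro integrable_mult_right Bochner_Integration.integrable_add L2_integrable_sq u)
  have "(norm (F (u x)))\<^sup>2 \<le> 2 * (K\<^sup>2 * (norm (u x))\<^sup>2 + \<bar>F 0\<bar>\<^sup>2)" for x
  proof -
    have "\<bar>F (u x) - F 0\<bar>\<^sup>2 \<le> (K * \<bar>u x\<bar>)\<^sup>2"
      using F[of "u x" 0] by (intro power_mono) auto
    then have "(F (u x) - F 0)\<^sup>2 \<le> K\<^sup>2 * (u x)\<^sup>2" by (simp add: power_mult_distrib)
    moreover have "(F (u x))\<^sup>2 \<le> 2 * ((F (u x) - F 0)\<^sup>2 + (F 0)\<^sup>2)"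
      using zero_le_power2[of "F (u x) - 2 * F 0"] by (simp add: power2_eq_square algebra_simps)
    ultimately show ?thesis by (simp add: power_mult_distrib)
  qed
  then show "AE x in lebesgue_on \<Omega>. (norm (F (u x)))\<^sup>2 \<le> 2 * (K\<^sup>2 * (norm (u x))\<^sup>2 + \<bar>F 0\<bar>\<^sup>2)" by simp
qed

lemma nemytskii_lipschitz:
  fixes F :: "real \<Rightarrow> real" and U V :: "('a::euclidean_space, real) l2"
  assumes \<Omega>: "\<Omega> \<in> sets lebesgue" "bounded \<Omega>" and K: "0 \<le> K"
    and F: "\<And>s t. \<bar>F s - F t\<bar> \<le> K * \<bar>s - t\<bar>"
  shows "norm (class_on \<Omega> (\<lambda>x. F (fn U x)) - class_on \<Omega> (\<lambda>x. F (fn V x))) \<le> K * norm (U - V)"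
proof -
  note L = fn_L2_on[OF \<Omega>(1), of U] fn_L2_on[OF \<Omega>(1), of V]
  note FL = nemytskii_L2[OF \<Omega> L(1) F] nemytskii_L2[OF \<Omega> L(2) F]
  have "norm (class_on \<Omega> (\<lambda>x. F (fn U x)) - class_on \<Omega> (\<lambda>x. F (fn V x))) = L2_norm \<Omega> (\<lambda>x. F (fn U x) - F (fn V x))"
    by (simp add: class_on_diff[OF \<Omega>(1) FL, symmetric] class_on_norm[OF \<Omega>(1) L2_diff[OF FL]])
  also have "\<dots> \<le> K * L2_norm \<Omega> (\<lambda>x. fn U x - fn V x)"
    by (rule L2_norm_mono[OF L2_diff[OF FL] L2_diff[OF L] K]) (use F in auto)
  also have "L2_norm \<Omega> (\<lambda>x. fn U x - fn V x) = norm (restrict_l2 \<Omega> (U - V))"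
    by (simp add: class_on_norm[OF \<Omega>(1) L2_diff[OF L], symmetric] class_on_diff[OF \<Omega>(1) L] restrict_l2_def[OF \<Omega>(1), symmetric]
        linear_diff[OF bounded_linear.linear[OF bounded_linear_restrict_l2[OF \<Omega>(1)]]])
  also have "\<dots> \<le> norm (U - V)" by (rule restrict_l2_norm[OF \<Omega>(1)])
  finally show ?thesis using K by (simp add: mult_left_mono)
qed

text \<open>
  Continuity at zero and homogeneity give a bound for the form; continuity at a function shows
  that the form cannot distinguish representatives of the same class.
\<close>
lemma continuous_linear_form_L2:
  assumes \<Omega>: "\<Omega> \<in> sets lebesgue" and l: "continuous_linear_form (L2 \<Omega>) (L2_norm \<Omega>) l"
  shows "\<And>u v. u \<in> L2 \<Omega> \<Longrightarrow> v \<in> L2 \<Omega> \<Longrightarrow> class_on \<Omega> u = class_on \<Omega> v \<Longrightarrow> l u = l (v :: 'a::euclidean_space \<Rightarrow> real)"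
    and "\<exists>\<Lambda>\<ge>0. \<forall>u\<in>L2 \<Omega>. \<bar>l u\<bar> \<le> \<Lambda> * L2_norm \<Omega> u"
proof -
  have add: "\<And>u v. u \<in> L2 \<Omega> \<Longrightarrow> v \<in> L2 \<Omega> \<Longrightarrow> l (\<lambda>x. u x + v x) = l u + l v"
    and scale: "\<And>c u. u \<in> L2 \<Omega> \<Longrightarrow> l (\<lambda>x. c * u x) = c * l u"
    and cont: "\<And>u \<epsilon>. u \<in> L2 \<Omega> \<Longrightarrow> \<epsilon> > 0 \<Longrightarrow> \<exists>\<delta>>0. \<forall>v\<in>L2 \<Omega>. L2_norm \<Omega> (\<lambda>x. v x - u x) < \<delta> \<longrightarrow> \<bar>l v - l u\<bar> < \<epsilon>"
    using l unfolding continuous_linear_form_def by blast+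
  show cong: "l u = l v" if uv: "u \<in> L2 \<Omega>" "v \<in> L2 \<Omega>" and eq: "class_on \<Omega> u = class_on \<Omega> v" for u v
  proof (rule ccontr)
    assume "l u \<noteq> l v"
    then obtain \<delta> where \<delta>: "\<delta> > 0" "\<And>w. w \<in> L2 \<Omega> \<Longrightarrow> L2_norm \<Omega> (\<lambda>x. w x - u x) < \<delta> \<Longrightarrow> \<bar>l w - l u\<bar> < \<bar>l v - l u\<bar>"
      using cont[OF uv(1), of "\<bar>l v - l u\<bar>"] by auto
    have "L2_norm \<Omega> (\<lambda>x. v x - u x) = 0"
      by (simp add: class_on_norm[OF \<Omega> L2_diff[OF uv(2,1)], symmetric] class_on_diff[OF \<Omega> uv(2,1)] eq)
    then show False using \<delta>(2)[OF uv(2)] \<delta>(1) by simp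
  qed
  have l0: "l (\<lambda>x. 0) = 0" using scale[OF L2_zero, of 0] by simp
  obtain \<delta> where \<delta>: "\<delta> > 0" "\<And>w. w \<in> L2 \<Omega> \<Longrightarrow> L2_norm \<Omega> w < \<delta> \<Longrightarrow> \<bar>l w\<bar> < 1"
    using cont[OF L2_zero, of 1] l0 by auto
  have "\<bar>l u\<bar> \<le> 2 / \<delta> * L2_norm \<Omega> u" if u: "u \<in> L2 \<Omega>" for u
  proof (cases "L2_norm \<Omega> u = 0")
    case True
    then have "class_on \<Omega> u = class_on \<Omega> (\<lambda>x. 0)"
      using class_on_norm[OF \<Omega> u] class_on_norm[OF \<Omega> L2_zero[where 'b=real]] by (simp add: L2_norm_def L2_inner_def)
    then show ?thesis using cong[OF u L2_zero] l0 True by simp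
  next
    case False
    define n where "n = L2_norm \<Omega> u"
    have n: "n > 0" using False by (simp add: n_def L2_norm_def L2_inner_def order_less_le)
    \<comment> \<open>Half of the radius given by continuity at zero, so that the rescaled function stays strictly inside the ball.\<close>
    define c where "c = \<delta> / (2 * n)"
    have c: "c > 0" using n \<delta>(1) by (simp add: c_def)
    have cu: "(\<lambda>x. c * u x) \<in> L2 \<Omega>" using L2_scaleR[OF u, of c] by simp
    have "L2_norm \<Omega> (\<lambda>x. c * u x) = c * n"
      using class_on_norm[OF \<Omega> cu] class_on_scaleR[OF \<Omega> u, of c] class_on_norm[OF \<Omega> u] c by (simp add: n_def)
    also have "\<dots> < \<delta>" using n \<delta>(1) by (simp add: c_def)
    finally have "\<bar>c * l u\<bar> < 1" using \<delta>(2)[OF cu] scale[OF u, of c] by simp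
    then have "c * \<bar>l u\<bar> < 1" using c by (simp add: abs_mult)
    then have "\<bar>l u\<bar> < 1 / c" using c by (simp add: field_simps)
    also have "1 / c = 2 / \<delta> * n" by (simp add: c_def)
    finally show ?thesis by (simp add: n_def)
  qed
  then show "\<exists>\<Lambda>\<ge>0. \<forall>u\<in>L2 \<Omega>. \<bar>l u\<bar> \<le> \<Lambda> * L2_norm \<Omega> u"
    using \<delta>(1) by (intro exI[of _ "2 / \<delta>"]) auto
qed

lemma bounded_linear_l_fn:
  fixes l :: "('a::euclidean_space \<Rightarrow> real) \<Rightarrow> real"
  assumes \<Omega>: "\<Omega> \<in> sets lebesgue" and l: "continuous_linear_form (L2 \<Omega>) (L2_norm \<Omega>) l"
  shows "\<exists>\<Lambda>\<ge>0. bounded_linear (\<lambda>U. l (fn U)) \<and> (\<forall>U. \<bar>l (fn U)\<bar> \<le> \<Lambda> * norm U)"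
proof -
  obtain \<Lambda> where \<Lambda>: "\<Lambda> \<ge> 0" "\<And>u. u \<in> L2 \<Omega> \<Longrightarrow> \<bar>l u\<bar> \<le> \<Lambda> * L2_norm \<Omega> u"
    using continuous_linear_form_L2(2)[OF \<Omega> l] by blast
  note cong = continuous_linear_form_L2(1)[OF \<Omega> l]
  have bd: "\<bar>l (fn U)\<bar> \<le> \<Lambda> * norm U" for U
  proof -
    have "L2_norm \<Omega> (fn U) = norm (restrict_l2 \<Omega> U)"
      by (simp add: restrict_l2_def[OF \<Omega>] class_on_norm[OF \<Omega> fn_L2_on[OF \<Omega>]])
    then show ?thesis
      using \<Lambda>(2)[OF fn_L2_on[OF \<Omega>]] mult_left_mono[OF restrict_l2_norm[OF \<Omega>] \<Lambda>(1)] order_trans by metis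
  qed
  have "bounded_linear (\<lambda>U. l (fn U))"
  proof (rule bounded_linear_intro[where K=\<Lambda>])
    fix U V :: "('a, real) l2" and c :: real
    have "l (fn (U + V)) = l (\<lambda>x. fn U x + fn V x)"
      by (intro cong class_on_cong_lebesgue fn_add fn_L2_on L2_add \<Omega>)
    then show "l (fn (U + V)) = l (fn U) + l (fn V)"
      using l fn_L2_on[OF \<Omega>] unfolding continuous_linear_form_def by metis
    have "l (fn (c *\<^sub>R U)) = l (\<lambda>x. c *\<^sub>R fn U x)"
      by (intro cong class_on_cong_lebesgue fn_scaleR fn_L2_on L2_scaleR \<Omega>)
    then show "l (fn (c *\<^sub>R U)) = c *\<^sub>R l (fn U)"
      using l fn_L2_on[OF \<Omega>] unfolding continuous_linear_form_def real_scaleR_def by metis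
    show "norm (l (fn U)) \<le> norm U * \<Lambda>" using bd[of U] by (simp add: mult.commute)
  qed
  then show ?thesis using \<Lambda>(1) bd by blast
qed

section \<open>Bochner spaces as limits of continuous functions\<close>

text \<open>
  Evaluation at the grid point to the left replaces a continuous function by a function with
  finitely many values; uniform continuity makes the error as small as desired.
\<close>
lemma grid_function:
  fixes w :: "real \<Rightarrow> 'v::metric_space"
  assumes w: "continuous_on {0..T} w" and e: "e > 0"
  shows "\<exists>g. simple_function (lebesgue_on {0<..<T}) g \<and> g ` {0<..<T} \<subseteq> {0..T} \<and>
    (\<forall>t\<in>{0<..<T}. dist (w (g t)) (w t) < (e::real))"
proof -
  have "uniformly_continuous_on {0..T} w" by (rule compact_uniformly_continuous[OF w compact_Icc])
  then obtain d where d: "d > 0" "\<And>s t. s \<in> {0..T} \<Longrightarrow> t \<in> {0..T} \<Longrightarrow> dist s t < d \<Longrightarrow> dist (w s) (w t) < e"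
    using e unfolding uniformly_continuous_on_def by metis
  obtain m :: nat where m: "1 / d < real m" using reals_Archimedean2 by blast
  have m0: "0 < real m" using m d(1) by (smt (verit) divide_pos_pos)
  have md: "1 / real m < d" using m m0 d(1) by (simp add: field_simps)
  \<comment> \<open>Rounding down stays in \<open>{0..T}\<close> because the left endpoint belongs to the closed interval.\<close>
  define g where "g = (\<lambda>t. real_of_int \<lfloor>t * real m\<rfloor> / real m)"
  have g: "g t \<in> {0..T}" "dist (g t) t < d" if t: "t \<in> {0<..<T}" for t
  proof -
    have 1: "real_of_int \<lfloor>t * real m\<rfloor> \<le> t * real m" "t * real m < real_of_int \<lfloor>t * real m\<rfloor> + 1" by linarith+
    have "0 \<le> \<lfloor>t * real m\<rfloor>" using t m0 by simp
    then have 0: "0 \<le> g t" using m0 by (simp add: g_def)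
    have le: "g t \<le> t" using 1(1) m0 by (simp add: g_def pos_divide_le_eq)
    then show "g t \<in> {0..T}" using 0 t by auto
    have "(t - g t) * real m = t * real m - real_of_int \<lfloor>t * real m\<rfloor>"
      using m0 by (simp add: g_def left_diff_distrib)
    then have "(t - g t) * real m < 1" using 1(2) by linarith
    then have "t - g t < 1 / real m" using m0 by (simp add: pos_less_divide_eq)
    then show "dist (g t) t < d" using le md by (simp add: dist_real_def)
  qed
  have "simple_function (lebesgue_on {0<..<T}) g"
    unfolding simple_function_def
  proof (intro conjI ballI)
    have "g ` {0<..<T} \<subseteq> (\<lambda>i. real_of_int i / real m) ` {0..\<lceil>T * real m\<rceil>}"
    proof
      fix y assume "y \<in> g ` {0<..<T}"
      then obtain t where t: "t \<in> {0<..<T}" "y = g t" by blast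
      have "0 \<le> t * real m" "t * real m \<le> T * real m" using t m0 by (auto intro: mult_right_mono)
      then have "\<lfloor>t * real m\<rfloor> \<in> {0..\<lceil>T * real m\<rceil>}" by (auto intro: order_trans[OF floor_mono floor_le_ceiling] simp del: floor_le_iff)
      then show "y \<in> (\<lambda>i. real_of_int i / real m) ` {0..\<lceil>T * real m\<rceil>}" using t by (auto simp: g_def)
    qed
    then show "finite (g ` space (lebesgue_on {0<..<T}))" by (simp add: finite_subset)
    have "g \<in> borel_measurable borel" unfolding g_def by measurable
    then have "g \<in> borel_measurable (lebesgue_on {0<..<T})"
      by (intro measurable_restrict_space1 measurable_completion) simp
    then show "g -` {x} \<inter> space (lebesgue_on {0<..<T}) \<in> sets (lebesgue_on {0<..<T})" for x
      by (rule measurable_sets) auto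
  qed
  moreover have "dist (w (g t)) (w t) < e" if t: "t \<in> {0<..<T}" for t
    using d(2)[OF g(1)[OF t] _ g(2)[OF t]] t by auto
  ultimately show ?thesis using g by (intro exI[of _ g]) auto
qed

text \<open>
  A common criterion for the two Bochner spaces in question. Elements of the function space are
  parametrised by a closed set \<open>S\<close> in a normed space in such a way that the seminorm \<open>N\<close> is
  dominated by the norm. Rounding the time argument of the continuous functions \<open>w k\<close> provides
  simple functions that converge almost everywhere.
\<close>
lemma Bochner_L2_limit:
  fixes w :: "nat \<Rightarrow> real \<Rightarrow> 'v::real_normed_vector" and \<Psi> :: "'v \<Rightarrow> 's \<Rightarrow> real"
  assumes w: "\<And>k. continuous_on {0..T} (w k)" "\<And>k t. t \<in> {0..T} \<Longrightarrow> w k t \<in> S" and S: "closed S"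
    and lim: "AE t in lebesgue_on {0<..<T}. (\<lambda>k. w k t) \<longlonglongrightarrow> w' t"
    and X: "\<And>z. z \<in> S \<Longrightarrow> \<Psi> z \<in> X"
    and N: "\<And>z y. z \<in> S \<Longrightarrow> y \<in> S \<Longrightarrow> 0 \<le> N (\<lambda>x. \<Psi> z x - \<Psi> y x) \<and> N (\<lambda>x. \<Psi> z x - \<Psi> y x) \<le> norm (z - y)"
      "\<And>z y. z \<in> S \<Longrightarrow> y \<in> S \<Longrightarrow> \<bar>N (\<Psi> z) - N (\<Psi> y)\<bar> \<le> norm (z - y)"
      "\<And>z. z \<in> S \<Longrightarrow> \<bar>N (\<Psi> z)\<bar> \<le> norm z"
    and int: "integrable (lebesgue_on {0<..<T}) (\<lambda>t. (norm (w' t))\<^sup>2)"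
  shows "(\<lambda>t. \<Psi> (w' t)) \<in> Bochner_L2 {0<..<T} X N"
proof -
  let ?M = "lebesgue_on {0<..<T}"
  have "\<exists>g. simple_function ?M g \<and> g ` {0<..<T} \<subseteq> {0..T} \<and> (\<forall>t\<in>{0<..<T}. dist (w k (g t)) (w k t) < (1/2) ^ k)" for k
    using grid_function[OF w(1), of "(1/2) ^ k" k] by simp
  then obtain g where g: "\<And>k. simple_function ?M (g k)" "\<And>k. g k ` {0<..<T} \<subseteq> {0..T}"
    "\<And>k t. t \<in> {0<..<T} \<Longrightarrow> dist (w k (g k t)) (w k t) < (1/2) ^ k" by metis
  have gS: "w k (g k t) \<in> S" if "t \<in> {0<..<T}" for k t using g(2)[of k] that w(2) by blast
  have ae: "AE t in ?M. t \<in> {0<..<T}" using AE_space[of ?M] by simp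
  have lim': "AE t in ?M. (\<lambda>k. w k (g k t)) \<longlonglongrightarrow> w' t \<and> w' t \<in> S \<and> t \<in> {0<..<T}"
    using lim ae
  proof eventually_elim
    fix t assume l: "(\<lambda>k. w k t) \<longlonglongrightarrow> w' t" and t: "t \<in> {0<..<T}"
    have n: "norm (w k (g k t) - w k t) \<le> (1/2) ^ k" for k using g(3)[OF t, of k] by (simp add: dist_norm)
    have "(\<lambda>k. (1/2::real) ^ k) \<longlonglongrightarrow> 0" by (intro LIMSEQ_power_zero) simp
    from Lim_null_comparison[OF always_eventually[OF allI[OF n]] this]
    have "(\<lambda>k. (w k (g k t) - w k t) + w k t) \<longlonglongrightarrow> 0 + w' t" by (intro tendsto_add l)
    then have "(\<lambda>k. w k (g k t)) \<longlonglongrightarrow> w' t" by simp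
    moreover have "w' t \<in> S"
      using S l w(2) t unfolding closed_sequential_limits by (metis atLeastAtMost_iff greaterThanLessThan_iff less_imp_le)
    ultimately show "(\<lambda>k. w k (g k t)) \<longlonglongrightarrow> w' t \<and> w' t \<in> S \<and> t \<in> {0<..<T}" using t by blast
  qed
  define \<sigma> where "\<sigma> = (\<lambda>k t. \<Psi> (w k (g k t)))"
  have \<sigma>: "simple_function ?M (\<sigma> k)" for k
    unfolding \<sigma>_def using simple_function_compose[OF g(1)[of k], of "\<lambda>s. \<Psi> (w k s)"] by (simp add: o_def)
  have "strongly_measurable {0<..<T} X N (\<lambda>t. \<Psi> (w' t))"
    unfolding strongly_measurable_def
  proof (intro exI[of _ \<sigma>] conjI allI \<sigma>)
    show "\<sigma> k ` {0<..<T} \<subseteq> X" for k unfolding \<sigma>_def using gS X by blast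
    show "AE t in ?M. (\<lambda>k. N (\<lambda>x. \<sigma> k t x - \<Psi> (w' t) x)) \<longlonglongrightarrow> 0"
      using lim'
    proof eventually_elim
      fix t assume a: "(\<lambda>k. w k (g k t)) \<longlonglongrightarrow> w' t \<and> w' t \<in> S \<and> t \<in> {0<..<T}"
      have n: "norm (N (\<lambda>x. \<sigma> k t x - \<Psi> (w' t) x)) \<le> norm (w k (g k t) - w' t)" for k
        using N(1)[of "w k (g k t)" "w' t"] a gS by (auto simp: \<sigma>_def)
      have "(\<lambda>k. norm (w k (g k t) - w' t)) \<longlonglongrightarrow> 0" using a by (simp add: LIM_zero_iff tendsto_norm_zero_iff)
      from Lim_null_comparison[OF always_eventually[OF allI[OF n]] this]
      show "(\<lambda>k. N (\<lambda>x. \<sigma> k t x - \<Psi> (w' t) x)) \<longlonglongrightarrow> 0" .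
    qed
  qed
  moreover have "integrable ?M (\<lambda>t. (N (\<Psi> (w' t)))\<^sup>2)"
  proof (rule Bochner_Integration.integrable_bound[OF int])
    have "(\<lambda>t. N (\<Psi> (w' t))) \<in> borel_measurable ?M"
    proof (rule borel_measurable_LIMSEQ_AE[where f="\<lambda>k t. N (\<sigma> k t)"])
      show "(\<lambda>t. N (\<sigma> k t)) \<in> borel_measurable ?M" for k
        using simple_function_compose[OF \<sigma>[of k], of N] by (simp add: o_def borel_measurable_simple_function)
      show "AE t in ?M. (\<lambda>k. N (\<sigma> k t)) \<longlonglongrightarrow> N (\<Psi> (w' t))"
        using lim'
      proof eventually_elim
        fix t assume a: "(\<lambda>k. w k (g k t)) \<longlonglongrightarrow> w' t \<and> w' t \<in> S \<and> t \<in> {0<..<T}"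
        have n: "norm (N (\<sigma> k t) - N (\<Psi> (w' t))) \<le> norm (w k (g k t) - w' t)" for k
          using N(2)[of "w k (g k t)" "w' t"] a gS by (auto simp: \<sigma>_def)
        have "(\<lambda>k. norm (w k (g k t) - w' t)) \<longlonglongrightarrow> 0" using a by (simp add: LIM_zero_iff tendsto_norm_zero_iff)
        from Lim_null_comparison[OF always_eventually[OF allI[OF n]] this]
        show "(\<lambda>k. N (\<sigma> k t)) \<longlonglongrightarrow> N (\<Psi> (w' t))" by (simp add: LIM_zero_iff)
      qed
    qed simp
    then show "(\<lambda>t. (N (\<Psi> (w' t)))\<^sup>2) \<in> borel_measurable ?M" by (rule borel_measurable_power)
    show "AE t in ?M. norm ((N (\<Psi> (w' t)))\<^sup>2) \<le> norm ((norm (w' t))\<^sup>2)"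
      using lim'
    proof eventually_elim
      fix t assume "(\<lambda>k. w k (g k t)) \<longlonglongrightarrow> w' t \<and> w' t \<in> S \<and> t \<in> {0<..<T}"
      then have "\<bar>N (\<Psi> (w' t))\<bar>\<^sup>2 \<le> (norm (w' t))\<^sup>2" using N(3) by (intro power_mono) auto
      then show "norm ((N (\<Psi> (w' t)))\<^sup>2) \<le> norm ((norm (w' t))\<^sup>2)" by simp
    qed
  qed
  moreover have "AE t in ?M. \<Psi> (w' t) \<in> X" using lim' by eventually_elim (use X in blast)
  ultimately show ?thesis by (simp add: Bochner_L2_def)
qed

lemma lebesgue_on_open_interval:
  fixes f :: "real \<Rightarrow> real"
  assumes "integrable (lebesgue_on {0..T}) f"
  shows "integrable (lebesgue_on {0<..<T}) f"
    "integral\<^sup>L (lebesgue_on {0<..<T}) f = integral\<^sup>L (lebesgue_on {0..T}) f"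
proof -
  have i: "integrable lebesgue (\<lambda>x. indicator {0..T} x *\<^sub>R f x)"
    using assms by (simp add: integrable_restrict_space)
  have "integrable lebesgue (\<lambda>x. indicator {0<..<T} x *\<^sub>R (indicator {0..T} x *\<^sub>R f x))"
    by (rule integrable_mult_indicator[OF _ i]) simp
  moreover have "(\<lambda>x. indicator {0<..<T} x *\<^sub>R (indicator {0..T} x *\<^sub>R f x)) = (\<lambda>x. indicator {0<..<T} x *\<^sub>R f x)"
    by (auto simp: indicator_def fun_eq_iff)
  ultimately have i': "integrable lebesgue (\<lambda>x. indicator {0<..<T} x *\<^sub>R f x)" by simp
  then show "integrable (lebesgue_on {0<..<T}) f" by (simp add: integrable_restrict_space)
  have ne: "AE x in lebesgue. x \<noteq> 0" "AE x in lebesgue. x \<noteq> T"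
    by (auto intro!: AE_completion AE_lborel_singleton)
  have "(LINT x|lebesgue. indicator {0<..<T} x *\<^sub>R f x) = (LINT x|lebesgue. indicator {0..T} x *\<^sub>R f x)"
  proof (rule integral_cong_AE)
    show "AE x in lebesgue. indicator {0<..<T} x *\<^sub>R f x = indicator {0..T} x *\<^sub>R f x"
      using ne by eventually_elim (auto simp: indicator_def)
  qed (use i i' in \<open>auto dest: borel_measurable_integrable\<close>)
  then show "integral\<^sup>L (lebesgue_on {0<..<T}) f = integral\<^sup>L (lebesgue_on {0..T}) f"
    by (simp add: integral_restrict_space)
qed

lemma AE_open_interval: "AE t in lebesgue_on {0..T}. P t \<Longrightarrow> AE t in lebesgue_on {0<..<T::real}. P t"
  by (simp add: AE_restrict_space_iff) (auto elim!: eventually_mono)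

lemma test_function_interval:
  assumes "\<phi> \<in> test_functions {0<..<T::real}"
  shows "\<And>t. (\<phi> has_real_derivative deriv \<phi> t) (at t)" "continuous_on A (deriv \<phi>)" "continuous_on A \<phi>" "\<phi> 0 = 0" "\<phi> T = 0"
proof -
  note d = test_function_deriv[OF assms] test_function_continuous[OF assms]
  have "(\<phi> has_real_derivative frechet_derivative \<phi> (at t) 1) (at t)" for t
  proof -
    have D: "(\<phi> has_derivative frechet_derivative \<phi> (at t)) (at t)"
      using d(1) by (simp add: frechet_derivative_works[symmetric])
    have *: "frechet_derivative \<phi> (at t) h = frechet_derivative \<phi> (at t) 1 * h" for h
      using linear_scale[OF has_derivative_linear[OF D], of h 1] by simp
    have e: "(*) (frechet_derivative \<phi> (at t) 1) = frechet_derivative \<phi> (at t)"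
      by (rule ext, rule *[symmetric])
    show ?thesis unfolding has_field_derivative_def e by (rule D)
  qed
  note D = this
  have eq: "deriv \<phi> t = frechet_derivative \<phi> (at t) 1" for t by (rule DERIV_imp_deriv[OF D])
  show "\<And>t. (\<phi> has_real_derivative deriv \<phi> t) (at t)" using D by (simp add: eq)
  show "continuous_on A (deriv \<phi>)" unfolding eq[abs_def] using d(2) by (rule continuous_on_subset) auto
  show "continuous_on A \<phi>" using d(3) by (rule continuous_on_subset) auto
  show "\<phi> 0 = 0" "\<phi> T = 0" by (rule test_function_zero_outside(1)[OF assms]; simp)+
qed

context nonlocal_system
begin

text \<open>
  The two shapes in which the equation is needed: as an equation for the time derivative in the
  dual space, and with the three terms integrated separately, which requires integrability of the
  diffusion term.
\<close>
lemma weak_solution_distributional: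
  assumes ws: "weak_solution u y f" and f: "continuous_on {0..T} f" and h: "(h1, h2) \<in> G"
    and \<phi>: "\<phi> \<in> test_functions {0<..<T}"
  shows "(LINT t|lebesgue_on {0<..<T}. (u t \<bullet> h1) * deriv \<phi> t) =
      - (LINT t|lebesgue_on {0<..<T}. (f t \<bullet> h1 + (- a (l (u t)) *\<^sub>R y t) \<bullet> h2) * \<phi> t)"
    "- (LINT t|lebesgue_on {0<..<T}. (u t \<bullet> h1) * deriv \<phi> t)
      + (LINT t|lebesgue_on {0<..<T}. (a (l (u t)) * (y t \<bullet> h2)) * \<phi> t)
      = (LINT t|lebesgue_on {0<..<T}. (f t \<bullet> h1) * \<phi> t)"
proof -
  note t\<phi> = test_function_interval[OF \<phi>]
  have cu: "continuous_on {0..T} u" and inty: "integrable (lebesgue_on {0..T}) (\<lambda>t. (norm (y t))\<^sup>2)"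
    and measy: "(\<lambda>t. y t \<bullet> h2) \<in> borel_measurable (lebesgue_on {0..T})"
    using ws by (simp_all add: weak_solution_def)
  have i1: "integrable (lebesgue_on {0..T}) (\<lambda>t. (u t \<bullet> h1) * deriv \<phi> t)"
    by (intro continuous_on_lebesgue_integral continuous_intros cu t\<phi>)
  have i3: "integrable (lebesgue_on {0..T}) (\<lambda>t. (f t \<bullet> h1) * \<phi> t)"
    by (intro continuous_on_lebesgue_integral continuous_intros f t\<phi>)
  have ca: "continuous_on {0..T} (\<lambda>t. a (l (u t)) * \<phi> t)"
    by (intro continuous_intros t\<phi> continuous_on_compose2[OF continuous_a_l cu]) auto
  have "bounded ((\<lambda>t. a (l (u t)) * \<phi> t) ` {0..T})"
    by (intro compact_imp_bounded compact_continuous_image ca compact_Icc)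
  then have "\<exists>C. \<forall>t\<in>{0..T}. \<bar>a (l (u t)) * \<phi> t\<bar> \<le> C" by (simp add: bounded_iff)
  then obtain C where C: "\<And>t. t \<in> {0..T} \<Longrightarrow> \<bar>a (l (u t)) * \<phi> t\<bar> \<le> C" by blast
  have i2: "integrable (lebesgue_on {0..T}) (\<lambda>t. (a (l (u t)) * (y t \<bullet> h2)) * \<phi> t)"
  proof (rule Bochner_Integration.integrable_bound)
    show "integrable (lebesgue_on {0..T}) (\<lambda>t. C * ((norm (y t))\<^sup>2 + (norm h2)\<^sup>2))"
      by (intro integrable_mult_right Bochner_Integration.integrable_add inty continuous_on_lebesgue_integral continuous_on_const)
    have "(\<lambda>t. (a (l (u t)) * \<phi> t) * (y t \<bullet> h2)) \<in> borel_measurable (lebesgue_on {0..T})"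
      by (rule borel_measurable_times[OF continuous_imp_measurable_on_sets_lebesgue[OF ca] measy]) simp
    then show "(\<lambda>t. (a (l (u t)) * (y t \<bullet> h2)) * \<phi> t) \<in> borel_measurable (lebesgue_on {0..T})"
      by (simp add: mult_ac)
    have "\<bar>(a (l (u t)) * (y t \<bullet> h2)) * \<phi> t\<bar> \<le> C * ((norm (y t))\<^sup>2 + (norm h2)\<^sup>2)" if t: "t \<in> {0..T}" for t
    proof -
      have "\<bar>y t \<bullet> h2\<bar> \<le> (norm (y t))\<^sup>2 + (norm h2)\<^sup>2"
        using Cauchy_Schwarz_ineq2[of "y t" h2] sum_squares_bound[of "norm (y t)" "norm h2"]
          mult_nonneg_nonneg[OF norm_ge_zero[of "y t"] norm_ge_zero[of h2]] by linarith
      then have "\<bar>a (l (u t)) * \<phi> t\<bar> * \<bar>y t \<bullet> h2\<bar> \<le> C * ((norm (y t))\<^sup>2 + (norm h2)\<^sup>2)"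
        using C[OF t] by (intro mult_mono) auto
      then show ?thesis by (simp add: abs_mult mult_ac)
    qed
    then show "AE t in lebesgue_on {0..T}. norm ((a (l (u t)) * (y t \<bullet> h2)) * \<phi> t) \<le> norm (C * ((norm (y t))\<^sup>2 + (norm h2)\<^sup>2))"
      by (intro AE_I2) (auto intro: order_trans[OF _ abs_ge_self])
  qed
  have "(LINT t|lebesgue_on {0..T}. (u t \<bullet> h1) * deriv \<phi> t + (- a (l (u t)) * (y t \<bullet> h2) + f t \<bullet> h1) * \<phi> t) = 0"
  proof -
    have "\<forall>t\<in>I. (\<phi> has_real_derivative deriv \<phi> t) (at t within I)"
      using t\<phi>(1) by (blast intro: has_field_derivative_at_within)
    then show ?thesis using ws h t\<phi>(2)[of I] t\<phi>(4,5) unfolding weak_solution_def by blast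
  qed
  moreover have "(\<lambda>t. (u t \<bullet> h1) * deriv \<phi> t + (- a (l (u t)) * (y t \<bullet> h2) + f t \<bullet> h1) * \<phi> t) =
     (\<lambda>t. (u t \<bullet> h1) * deriv \<phi> t - (a (l (u t)) * (y t \<bullet> h2)) * \<phi> t + (f t \<bullet> h1) * \<phi> t)"
    by (auto simp: algebra_simps)
  ultimately have eq: "(LINT t|lebesgue_on {0..T}. (u t \<bullet> h1) * deriv \<phi> t) - (LINT t|lebesgue_on {0..T}. (a (l (u t)) * (y t \<bullet> h2)) * \<phi> t)
     + (LINT t|lebesgue_on {0..T}. (f t \<bullet> h1) * \<phi> t) = 0"
    using i1 i2 i3 by simp
  note o = lebesgue_on_open_interval
  show 2: "- (LINT t|lebesgue_on {0<..<T}. (u t \<bullet> h1) * deriv \<phi> t)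
      + (LINT t|lebesgue_on {0<..<T}. (a (l (u t)) * (y t \<bullet> h2)) * \<phi> t)
      = (LINT t|lebesgue_on {0<..<T}. (f t \<bullet> h1) * \<phi> t)"
    unfolding o(2)[OF i1] o(2)[OF i2] o(2)[OF i3] using eq by linarith
  have "(\<lambda>t. (f t \<bullet> h1 + (- a (l (u t)) *\<^sub>R y t) \<bullet> h2) * \<phi> t) = (\<lambda>t. (f t \<bullet> h1) * \<phi> t - (a (l (u t)) * (y t \<bullet> h2)) * \<phi> t)"
    by (auto simp: algebra_simps)
  then show "(LINT t|lebesgue_on {0<..<T}. (u t \<bullet> h1) * deriv \<phi> t) =
      - (LINT t|lebesgue_on {0<..<T}. (f t \<bullet> h1 + (- a (l (u t)) *\<^sub>R y t) \<bullet> h2) * \<phi> t)"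
    using 2 o(1)[OF i2] o(1)[OF i3] by simp
qed

end

section \<open>The dual of the Sobolev space\<close>

text \<open>
  Every pair of square integrable functions acts on \<open>H\<^sub>0\<^sup>1\<close> by \<open>h \<mapsto> (z\<^sub>0, h) + (z\<^sub>1, \<nabla>h)\<close>. The time
  derivative of a solution has this form.
\<close>
definition dual_functional :: "'a::euclidean_space set \<Rightarrow> ('a, real) l2 \<times> ('a, 'a) l2 \<Rightarrow> ('a \<Rightarrow> real) \<Rightarrow> real" where
  "dual_functional \<Omega> z h = z \<bullet> (class_on \<Omega> h, class_on \<Omega> (grad \<Omega> h))"

context
  fixes \<Omega> :: "'a::euclidean_space set"
  assumes op: "open \<Omega>"
begin

lemma H10_diff:
  assumes "h \<in> H10 \<Omega>" "k \<in> H10 \<Omega>"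
  shows "(\<lambda>x. h x - k x) \<in> H10 \<Omega>"
    "(class_on \<Omega> (\<lambda>x. h x - k x), class_on \<Omega> (grad \<Omega> (\<lambda>x. h x - k x))) =
     (class_on \<Omega> h, class_on \<Omega> (grad \<Omega> h)) - (class_on \<Omega> k, class_on \<Omega> (grad \<Omega> k))"
proof -
  note h = H10_gradient_graph[OF op assms(1)] and k = H10_gradient_graph[OF op assms(2)]
  have G: "(class_on \<Omega> h - class_on \<Omega> k, class_on \<Omega> (grad \<Omega> h) - class_on \<Omega> (grad \<Omega> k)) \<in> gradient_graph \<Omega>"
    using subspace_diff[OF subspace_gradient_graph h(2) k(2)] by simp
  note c = L2_diff[OF h(1) k(1)] class_on_diff[OF \<Omega>_sets[OF op] h(1) k(1)]
  show "(\<lambda>x. h x - k x) \<in> H10 \<Omega>" by (rule gradient_graph_H10[OF op G c])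
  show "(class_on \<Omega> (\<lambda>x. h x - k x), class_on \<Omega> (grad \<Omega> (\<lambda>x. h x - k x))) =
     (class_on \<Omega> h, class_on \<Omega> (grad \<Omega> h)) - (class_on \<Omega> k, class_on \<Omega> (grad \<Omega> k))"
    using gradient_graph_H1(2)[OF op G c] c(2) by simp
qed

lemma H10_add:
  assumes "h \<in> H10 \<Omega>" "k \<in> H10 \<Omega>"
  shows "(class_on \<Omega> (\<lambda>x. h x + k x), class_on \<Omega> (grad \<Omega> (\<lambda>x. h x + k x))) =
     (class_on \<Omega> h, class_on \<Omega> (grad \<Omega> h)) + (class_on \<Omega> k, class_on \<Omega> (grad \<Omega> k))"
proof -
  note h = H10_gradient_graph[OF op assms(1)] and k = H10_gradient_graph[OF op assms(2)]
  have G: "(class_on \<Omega> h + class_on \<Omega> k, class_on \<Omega> (grad \<Omega> h) + class_on \<Omega> (grad \<Omega> k)) \<in> gradient_graph \<Omega>"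
    using subspace_add[OF subspace_gradient_graph h(2) k(2)] by simp
  note c = L2_add[OF h(1) k(1)] class_on_add[OF \<Omega>_sets[OF op] h(1) k(1)]
  show ?thesis using gradient_graph_H1(2)[OF op G c] c(2) by simp
qed

lemma H10_scale:
  assumes "h \<in> H10 \<Omega>"
  shows "(class_on \<Omega> (\<lambda>x. c * h x), class_on \<Omega> (grad \<Omega> (\<lambda>x. c * h x))) =
     c *\<^sub>R (class_on \<Omega> h, class_on \<Omega> (grad \<Omega> h))"
proof -
  note h = H10_gradient_graph[OF op assms(1)]
  have G: "(c *\<^sub>R class_on \<Omega> h, c *\<^sub>R class_on \<Omega> (grad \<Omega> h)) \<in> gradient_graph \<Omega>"
    using subspace_scale[OF subspace_gradient_graph h(2)] by simp
  have c: "(\<lambda>x. c * h x) \<in> L2 \<Omega>" "class_on \<Omega> (\<lambda>x. c * h x) = c *\<^sub>R class_on \<Omega> h"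
    using L2_scaleR[OF h(1), of c] class_on_scaleR[OF \<Omega>_sets[OF op] h(1), of c] by simp_all
  show ?thesis using gradient_graph_H1(2)[OF op G c] c(2) by simp
qed

lemma H10_norm: "h \<in> H10 \<Omega> \<Longrightarrow> H1_norm \<Omega> h = norm (class_on \<Omega> h, class_on \<Omega> (grad \<Omega> h))"
  using gradient_graph_H1(3)[OF op H10_gradient_graph(2)[OF op] H10_gradient_graph(1)[OF op] refl] .

lemma dual_functional_le: "h \<in> H10 \<Omega> \<Longrightarrow> \<bar>dual_functional \<Omega> z h\<bar> \<le> norm z * H1_norm \<Omega> h"
  unfolding dual_functional_def H10_norm by (rule Cauchy_Schwarz_ineq2)

lemma dual_functional_Hm1: "dual_functional \<Omega> z \<in> Hm1 \<Omega>"
  unfolding Hm1_def continuous_linear_form_def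
proof (intro CollectI conjI ballI allI impI)
  fix u v assume uv: "u \<in> H10 \<Omega>" "v \<in> H10 \<Omega>"
  show "dual_functional \<Omega> z (\<lambda>x. u x + v x) = dual_functional \<Omega> z u + dual_functional \<Omega> z v"
    unfolding dual_functional_def H10_add[OF uv] by (rule inner_add_right)
next
  fix c u assume u: "u \<in> H10 \<Omega>"
  show "dual_functional \<Omega> z (\<lambda>x. c * u x) = c * dual_functional \<Omega> z u"
    unfolding dual_functional_def H10_scale[OF u] by (rule inner_scaleR_right)
next
  fix u and \<epsilon> :: real assume u: "u \<in> H10 \<Omega>" and e: "\<epsilon> > 0"
  show "\<exists>\<delta>>0. \<forall>v\<in>H10 \<Omega>. H1_norm \<Omega> (\<lambda>x. v x - u x) < \<delta> \<longrightarrow> \<bar>dual_functional \<Omega> z v - dual_functional \<Omega> z u\<bar> < \<epsilon>"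
  proof (intro exI[of _ "\<epsilon> / (norm z + 1)"] conjI ballI impI)
    show "0 < \<epsilon> / (norm z + 1)" using e by (intro divide_pos_pos add_nonneg_pos) auto
    fix v assume v: "v \<in> H10 \<Omega>" and d: "H1_norm \<Omega> (\<lambda>x. v x - u x) < \<epsilon> / (norm z + 1)"
    have p: "norm z + 1 > 0" by (intro add_nonneg_pos) auto
    have "dual_functional \<Omega> z v - dual_functional \<Omega> z u = dual_functional \<Omega> z (\<lambda>x. v x - u x)"
      unfolding dual_functional_def H10_diff(2)[OF v u] by (rule inner_diff_right[symmetric])
    then have "\<bar>dual_functional \<Omega> z v - dual_functional \<Omega> z u\<bar> \<le> norm z * H1_norm \<Omega> (\<lambda>x. v x - u x)"
      using dual_functional_le[OF H10_diff(1)[OF v u]] by simp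
    also have "\<dots> \<le> (norm z + 1) * H1_norm \<Omega> (\<lambda>x. v x - u x)"
      by (intro mult_right_mono) (auto simp: H10_norm[OF H10_diff(1)[OF v u]])
    also have "\<dots> < (norm z + 1) * (\<epsilon> / (norm z + 1))" using p d by (intro mult_strict_left_mono)
    also have "\<dots> = \<epsilon>" using p by simp
    finally show "\<bar>dual_functional \<Omega> z v - dual_functional \<Omega> z u\<bar> < \<epsilon>" .
  qed
qed

lemma dual_functional_diff: "(\<lambda>h. dual_functional \<Omega> z h - dual_functional \<Omega> w h) = dual_functional \<Omega> (z - w)"
  by (simp add: dual_functional_def inner_diff_left fun_eq_iff)

lemma zero_H10: "(\<lambda>x. 0) \<in> H10 \<Omega>" "H1_norm \<Omega> (\<lambda>x. 0) = 0"
proof -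
  have c: "class_on \<Omega> (\<lambda>x. 0::real) = 0"
    using class_on_scaleR[OF \<Omega>_sets[OF op] L2_zero, of 0] by simp
  have G: "(0, 0) \<in> gradient_graph \<Omega>"
    using subspace_0[OF subspace_gradient_graph[of \<Omega>]] by (simp add: zero_prod_def)
  show "(\<lambda>x. 0) \<in> H10 \<Omega>" by (rule gradient_graph_H10[OF op G L2_zero c])
  show "H1_norm \<Omega> (\<lambda>x. 0) = 0" using gradient_graph_H1(3)[OF op G L2_zero c] by (simp add: norm_Pair)
qed

lemma dual_set_bounds:
  shows "bdd_above {\<bar>dual_functional \<Omega> z h\<bar> | h. h \<in> H10 \<Omega> \<and> H1_norm \<Omega> h \<le> 1}"
    and "{\<bar>dual_functional \<Omega> z h\<bar> | h. h \<in> H10 \<Omega> \<and> H1_norm \<Omega> h \<le> 1} \<noteq> {}"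
    and "h \<in> H10 \<Omega> \<Longrightarrow> H1_norm \<Omega> h \<le> 1 \<Longrightarrow> \<bar>dual_functional \<Omega> z h\<bar> \<le> norm z"
proof -
  show le: "\<bar>dual_functional \<Omega> z h\<bar> \<le> norm z" if "h \<in> H10 \<Omega>" "H1_norm \<Omega> h \<le> 1" for h
    using order_trans[OF dual_functional_le[OF that(1)] mult_left_mono[OF that(2) norm_ge_zero[of z]]] by simp
  then show "bdd_above {\<bar>dual_functional \<Omega> z h\<bar> | h. h \<in> H10 \<Omega> \<and> H1_norm \<Omega> h \<le> 1}"
    by (intro bdd_aboveI[of _ "norm z"]) auto
  show "{\<bar>dual_functional \<Omega> z h\<bar> | h. h \<in> H10 \<Omega> \<and> H1_norm \<Omega> h \<le> 1} \<noteq> {}"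
    using zero_H10 by force
qed

lemma Hm1_norm_upper: "h \<in> H10 \<Omega> \<Longrightarrow> H1_norm \<Omega> h \<le> 1 \<Longrightarrow> \<bar>dual_functional \<Omega> z h\<bar> \<le> Hm1_norm \<Omega> (dual_functional \<Omega> z)"
  unfolding Hm1_norm_def by (intro cSup_upper dual_set_bounds) auto

lemma Hm1_norm_bounds: "0 \<le> Hm1_norm \<Omega> (dual_functional \<Omega> z)" "Hm1_norm \<Omega> (dual_functional \<Omega> z) \<le> norm z"
proof -
  show "0 \<le> Hm1_norm \<Omega> (dual_functional \<Omega> z)"
    using Hm1_norm_upper[OF zero_H10(1), of z] zero_H10(2) by simp
  show "Hm1_norm \<Omega> (dual_functional \<Omega> z) \<le> norm z"
    unfolding Hm1_norm_def by (intro cSup_least dual_set_bounds(2)) (auto intro: dual_set_bounds(3))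
qed

text \<open>
  The dual norm is a supremum, so the triangle inequality is obtained first for a single argument
  of the functionals.
\<close>
lemma Hm1_norm_triangle: "Hm1_norm \<Omega> (dual_functional \<Omega> z) \<le> Hm1_norm \<Omega> (dual_functional \<Omega> w) + norm (z - w)"
proof -
  have "\<bar>dual_functional \<Omega> z h\<bar> \<le> Hm1_norm \<Omega> (dual_functional \<Omega> w) + norm (z - w)"
    if h: "h \<in> H10 \<Omega>" "H1_norm \<Omega> h \<le> 1" for h
  proof -
    have "dual_functional \<Omega> z h = dual_functional \<Omega> w h + dual_functional \<Omega> (z - w) h"
      by (simp flip: dual_functional_diff)
    then show ?thesis using Hm1_norm_upper[OF h, of w] dual_set_bounds(3)[OF h, of "z - w"] by linarith
  qed
  then show ?thesis unfolding Hm1_norm_def[of \<Omega> "dual_functional \<Omega> z"]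
    by (intro cSup_least dual_set_bounds(2)) auto
qed

lemma Bochner_Hm1:
  assumes w: "\<And>k. continuous_on {0..T} (w k)"
    and lim: "AE t in lebesgue_on {0<..<T}. (\<lambda>k::nat. w k t) \<longlonglongrightarrow> w' t"
    and int: "integrable (lebesgue_on {0<..<T}) (\<lambda>t. (norm (w' t))\<^sup>2)"
  shows "(\<lambda>t. dual_functional \<Omega> (w' t)) \<in> Bochner_L2 {0<..<T} (Hm1 \<Omega>) (Hm1_norm \<Omega>)"
proof (rule Bochner_L2_limit[OF w _ closed_UNIV lim _ _ _ _ int])
  show "\<bar>Hm1_norm \<Omega> (dual_functional \<Omega> z) - Hm1_norm \<Omega> (dual_functional \<Omega> y)\<bar> \<le> norm (z - y)" for z y
    using Hm1_norm_triangle[of z y] Hm1_norm_triangle[of y z] by (simp add: norm_minus_commute abs_le_iff)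
qed (use dual_functional_Hm1 Hm1_norm_bounds in \<open>auto simp: dual_functional_diff\<close>)

lemma Bochner_H10:
  assumes w: "\<And>k. continuous_on {0..T} (w k)" "\<And>k t. t \<in> {0..T} \<Longrightarrow> w k t \<in> gradient_graph \<Omega>"
    and lim: "AE t in lebesgue_on {0<..<T}. (\<lambda>k::nat. w k t) \<longlonglongrightarrow> w' t"
    and int: "integrable (lebesgue_on {0<..<T}) (\<lambda>t. (norm (w' t))\<^sup>2)"
  shows "(\<lambda>t. fn (fst (w' t))) \<in> Bochner_L2 {0<..<T} (H10 \<Omega>) (H1_norm \<Omega>)"
proof (rule Bochner_L2_limit[OF w _ lim _ _ _ _ int])
  show "closed (gradient_graph \<Omega>)" by (simp add: gradient_graph_def)
  fix z y assume z: "z \<in> gradient_graph \<Omega>"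
  then have zp: "(fst z, snd z) \<in> gradient_graph \<Omega>" by simp
  note L = fn_L2_on[OF \<Omega>_sets[OF op]]
  have nz: "H1_norm \<Omega> (fn (fst z)) = norm z"
    using gradient_graph_H1(3)[OF op zp L gradient_graph_restrict(1)[OF op zp]] by simp
  show "fn (fst z) \<in> H10 \<Omega>"
    by (rule gradient_graph_H10[OF op zp L gradient_graph_restrict(1)[OF op zp]])
  show "\<bar>H1_norm \<Omega> (fn (fst z))\<bar> \<le> norm z" using nz by simp
  assume y: "y \<in> gradient_graph \<Omega>"
  then have yp: "(fst y, snd y) \<in> gradient_graph \<Omega>" by simp
  have ny: "H1_norm \<Omega> (fn (fst y)) = norm y"
    using gradient_graph_H1(3)[OF op yp L gradient_graph_restrict(1)[OF op yp]] by simp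
  have zy: "(fst z - fst y, snd z - snd y) = z - y" by (simp add: prod_eq_iff)
  have G: "(fst z - fst y, snd z - snd y) \<in> gradient_graph \<Omega>"
    unfolding zy by (rule subspace_diff[OF subspace_gradient_graph z y])
  have "H1_norm \<Omega> (\<lambda>x. fn (fst z) x - fn (fst y) x) = norm (fst z - fst y, snd z - snd y)"
    by (rule gradient_graph_H1(3)[OF op G L2_diff[OF L L]])
      (simp add: class_on_diff[OF \<Omega>_sets[OF op] L L] gradient_graph_restrict(1)[OF op zp] gradient_graph_restrict(1)[OF op yp])
  also note zy
  finally show "0 \<le> H1_norm \<Omega> (\<lambda>x. fn (fst z) x - fn (fst y) x) \<and> H1_norm \<Omega> (\<lambda>x. fn (fst z) x - fn (fst y) x) \<le> norm (z - y)"
    by simp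
  show "\<bar>H1_norm \<Omega> (fn (fst z)) - H1_norm \<Omega> (fn (fst y))\<bar> \<le> norm (z - y)"
    unfolding nz ny by (rule norm_triangle_ineq3)
qed

end

section \<open>Existence for the nonlocal system\<close>

text \<open>
  Translation of one component of the abstract solution back to functions. For almost every time
  the pair \<open>(U t, y t)\<close> lies in the graph of the gradient, so the inner product with \<open>y t\<close> is the
  integral of the product of gradients; the exceptional times do not affect integrals over time.
\<close>
lemma weak_solution_concrete:
  fixes \<Omega> :: "'a::euclidean_space set" and U :: "real \<Rightarrow> ('a, real) l2"
  assumes op: "open \<Omega>"
    and sys: "nonlocal_system (gradient_graph \<Omega>) (\<lambda>U. l (fn U)) \<Lambda> a N m M L T"
    and ws: "nonlocal_system.weak_solution (gradient_graph \<Omega>) (\<lambda>U. l (fn U)) a T U y f"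
    and f: "continuous_on {0..T} f"
  defines "u \<equiv> \<lambda>t. fn (U t)"
  shows "u \<in> Bochner_L2 {0<..<T} (H10 \<Omega>) (H1_norm \<Omega>) \<inter> continuous_into {0..<T} (L2 \<Omega>) (L2_norm \<Omega>)"
    and "\<exists>u'\<in>Bochner_L2 {0<..<T} (Hm1 \<Omega>) (Hm1_norm \<Omega>). weak_time_deriv {0<..<T} \<Omega> u u'"
    and "\<And>h \<phi>. h \<in> H10 \<Omega> \<Longrightarrow> \<phi> \<in> test_functions {0<..<T} \<Longrightarrow>
       distr_deriv (regular_distr {0<..<T} (\<lambda>t. L2_inner \<Omega> (u t) h)) \<phi>
       + regular_distr {0<..<T}
           (\<lambda>t. a (l (u t)) * (LINT x|lebesgue_on \<Omega>. grad \<Omega> (u t) x \<bullet> grad \<Omega> h x)) \<phi>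
       = regular_distr {0<..<T} (\<lambda>t. f t \<bullet> class_on \<Omega> h) \<phi>"
proof -
  interpret nonlocal_system "gradient_graph \<Omega>" "\<lambda>U. l (fn U)" \<Lambda> a N m M L T by (rule sys)
  note \<Omega>s = \<Omega>_sets[OF op]
  have cU: "continuous_on {0..T} U" and inty: "integrable (lebesgue_on {0..T}) (\<lambda>t. (norm (y t))\<^sup>2)"
    using ws by (simp_all add: weak_solution_def)
  have "\<exists>z. (\<forall>k::nat. continuous_on {0..T} (z k) \<and> z k ` {0..T} \<subseteq> gradient_graph \<Omega>) \<and>
      (AE t in lebesgue_on {0..T}. (\<lambda>k. z k t) \<longlonglongrightarrow> (U t, y t))"
    using ws by (simp add: weak_solution_def)
  then obtain z where z': "\<forall>k::nat. continuous_on {0..T} (z k) \<and> z k ` {0..T} \<subseteq> gradient_graph \<Omega>"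
    and lim: "AE t in lebesgue_on {0..T}. (\<lambda>k. z k t) \<longlonglongrightarrow> (U t, y t)" by (elim exE conjE)
  have z: "\<And>k. continuous_on {0..T} (z k)" "\<And>k t. t \<in> {0..T} \<Longrightarrow> z k t \<in> gradient_graph \<Omega>"
    using z' by (simp, blast)
  note lim' = AE_open_interval[OF lim]
  have intU: "integrable (lebesgue_on {0<..<T}) (\<lambda>t. (norm (U t, y t))\<^sup>2)"
  proof -
    have "integrable (lebesgue_on {0..T}) (\<lambda>t. (norm (U t))\<^sup>2 + (norm (y t))\<^sup>2)"
      by (intro Bochner_Integration.integrable_add inty continuous_on_lebesgue_integral continuous_intros cU)
    then show ?thesis by (simp add: norm_Pair lebesgue_on_open_interval(1))
  qed
  have B: "u \<in> Bochner_L2 {0<..<T} (H10 \<Omega>) (H1_norm \<Omega>)"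
    using Bochner_H10[OF op z lim' intU] by (simp add: u_def)
  have C: "u \<in> continuous_into {0..<T} (L2 \<Omega>) (L2_norm \<Omega>)"
    unfolding continuous_into_def
  proof (intro CollectI ballI conjI)
    fix t assume t: "t \<in> {0..<T}"
    show "u t \<in> L2 \<Omega>" unfolding u_def by (rule fn_L2_on[OF \<Omega>s])
    have n: "norm (L2_norm \<Omega> (\<lambda>x. u s x - u t x)) \<le> norm (U s - U t)" for s
    proof -
      have "L2_norm \<Omega> (\<lambda>x. u s x - u t x) = norm (restrict_l2 \<Omega> (U s - U t))"
        unfolding u_def
        by (simp add: class_on_norm[OF \<Omega>s L2_diff[OF fn_L2_on[OF \<Omega>s] fn_L2_on[OF \<Omega>s]], symmetric]
            class_on_diff[OF \<Omega>s fn_L2_on[OF \<Omega>s] fn_L2_on[OF \<Omega>s]] restrict_l2_def[OF \<Omega>s, symmetric]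
            linear_diff[OF bounded_linear.linear[OF bounded_linear_restrict_l2[OF \<Omega>s]]])
      then show ?thesis using restrict_l2_norm[OF \<Omega>s, of "U s - U t"] by simp
    qed
    have "(U \<longlongrightarrow> U t) (at t within {0..<T})"
      using continuous_on_subset[OF cU, of "{0..<T}"] t unfolding continuous_on_def by (simp add: subset_eq)
    then have "((\<lambda>s. norm (U s - U t)) \<longlongrightarrow> 0) (at t within {0..<T})"
      by (simp add: LIM_zero_iff tendsto_norm_zero_iff)
    from Lim_null_comparison[OF always_eventually[OF allI[OF n]] this]
    show "((\<lambda>s. L2_norm \<Omega> (\<lambda>x. u s x - u t x)) \<longlongrightarrow> 0) (at t within {0..<T})" .
  qed
  show "u \<in> Bochner_L2 {0<..<T} (H10 \<Omega>) (H1_norm \<Omega>) \<inter> continuous_into {0..<T} (L2 \<Omega>) (L2_norm \<Omega>)"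
    using B C by blast
  have inner_u: "L2_inner \<Omega> (u t) h = U t \<bullet> class_on \<Omega> h" if "h \<in> H10 \<Omega>" for t h
    unfolding u_def using inner_class_on[OF \<Omega>s H10_gradient_graph(1)[OF op that]] by simp
  define b where "b = (\<lambda>t. a (l (fn (U t))))"
  have cb: "continuous_on {0..T} b"
    unfolding b_def by (rule continuous_on_compose2[OF continuous_a_l cU]) auto
  \<comment> \<open>The time derivative is the functional \<open>h \<mapsto> (f, h) - a(l(u)) (\<nabla>u, \<nabla>h)\<close>.\<close>
  define u' where "u' = (\<lambda>t. dual_functional \<Omega> (f t, - b t *\<^sub>R y t))"
  have "u' \<in> Bochner_L2 {0<..<T} (Hm1 \<Omega>) (Hm1_norm \<Omega>)"
    unfolding u'_def
  proof (rule Bochner_Hm1[OF op, where w="\<lambda>k t. (f t, - b t *\<^sub>R snd (z k t))"])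
    show "continuous_on {0..T} (\<lambda>t. (f t, - b t *\<^sub>R snd (z k t)))" for k
      by (intro continuous_intros f cb z)
    show "AE t in lebesgue_on {0<..<T}. (\<lambda>k. (f t, - b t *\<^sub>R snd (z k t))) \<longlonglongrightarrow> (f t, - b t *\<^sub>R y t)"
      using lim'
    proof eventually_elim
      fix t assume "(\<lambda>k. z k t) \<longlonglongrightarrow> (U t, y t)"
      from tendsto_snd[OF this] show "(\<lambda>k. (f t, - b t *\<^sub>R snd (z k t))) \<longlonglongrightarrow> (f t, - b t *\<^sub>R y t)"
        by (intro tendsto_Pair tendsto_const tendsto_scaleR) simp
    qed
    have "bounded (b ` {0..T})" by (intro compact_imp_bounded compact_continuous_image cb compact_Icc)
    then have "\<exists>c. \<forall>t\<in>{0..T}. \<bar>b t\<bar> \<le> c" by (simp add: bounded_iff)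
    then obtain c where c: "\<And>t. t \<in> {0..T} \<Longrightarrow> \<bar>b t\<bar> \<le> c" by blast
    have "integrable (lebesgue_on {0..T}) (\<lambda>t. (b t)\<^sup>2 * (norm (y t))\<^sup>2)"
    proof (rule Bochner_Integration.integrable_bound)
      show "integrable (lebesgue_on {0..T}) (\<lambda>t. c\<^sup>2 * (norm (y t))\<^sup>2)" by (intro integrable_mult_right inty)
      show "(\<lambda>t. (b t)\<^sup>2 * (norm (y t))\<^sup>2) \<in> borel_measurable (lebesgue_on {0..T})"
        by (intro borel_measurable_times borel_measurable_integrable[OF inty] continuous_imp_measurable_on_sets_lebesgue
            continuous_intros cb) simp
      have "(b t)\<^sup>2 \<le> c\<^sup>2" if "t \<in> {0..T}" for t
        using power_mono[OF c[OF that] abs_ge_zero, of 2] by simp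
      then show "AE t in lebesgue_on {0..T}. norm ((b t)\<^sup>2 * (norm (y t))\<^sup>2) \<le> norm (c\<^sup>2 * (norm (y t))\<^sup>2)"
        by (intro AE_I2) (auto intro!: mult_right_mono)
    qed
    moreover have "integrable (lebesgue_on {0..T}) (\<lambda>t. (norm (f t))\<^sup>2)"
      by (intro continuous_on_lebesgue_integral continuous_intros f)
    ultimately have "integrable (lebesgue_on {0..T}) (\<lambda>t. (norm (f t))\<^sup>2 + (b t)\<^sup>2 * (norm (y t))\<^sup>2)"
      by (intro Bochner_Integration.integrable_add)
    then show "integrable (lebesgue_on {0<..<T}) (\<lambda>t. (norm (f t, - b t *\<^sub>R y t))\<^sup>2)"
      by (simp add: norm_Pair power_mult_distrib lebesgue_on_open_interval(1))
  qed
  moreover have "weak_time_deriv {0<..<T} \<Omega> u u'"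
    unfolding weak_time_deriv_def
  proof (intro ballI)
    fix \<phi> h assume \<phi>: "\<phi> \<in> test_functions {0<..<T}" and h: "h \<in> H10 \<Omega>"
    show "(LINT t|lebesgue_on {0<..<T}. L2_inner \<Omega> (u t) h * deriv \<phi> t) = - (LINT t|lebesgue_on {0<..<T}. u' t h * \<phi> t)"
      using weak_solution_distributional(1)[OF ws f H10_gradient_graph(2)[OF op h] \<phi>]
      by (simp add: inner_u[OF h] u'_def dual_functional_def b_def)
  qed
  ultimately show "\<exists>u'\<in>Bochner_L2 {0<..<T} (Hm1 \<Omega>) (Hm1_norm \<Omega>). weak_time_deriv {0<..<T} \<Omega> u u'" by blast
  show "distr_deriv (regular_distr {0<..<T} (\<lambda>t. L2_inner \<Omega> (u t) h)) \<phi>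
       + regular_distr {0<..<T}
           (\<lambda>t. a (l (u t)) * (LINT x|lebesgue_on \<Omega>. grad \<Omega> (u t) x \<bullet> grad \<Omega> h x)) \<phi>
       = regular_distr {0<..<T} (\<lambda>t. f t \<bullet> class_on \<Omega> h) \<phi>"
    if h: "h \<in> H10 \<Omega>" and \<phi>: "\<phi> \<in> test_functions {0<..<T}" for h \<phi>
  proof -
    have H1h: "h \<in> H1 \<Omega>" using h by (simp add: H10_def)
    have ae: "AE t in lebesgue_on {0<..<T}.
       a (l (u t)) * (LINT x|lebesgue_on \<Omega>. grad \<Omega> (u t) x \<bullet> grad \<Omega> h x) * \<phi> t
       = (b t * (y t \<bullet> class_on \<Omega> (grad \<Omega> h))) * \<phi> t"
      using lim' AE_space[of "lebesgue_on {0<..<T}"]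
    proof eventually_elim
      fix t assume l: "(\<lambda>k. z k t) \<longlonglongrightarrow> (U t, y t)" and "t \<in> space (lebesgue_on {0<..<T})"
      then have "t \<in> {0..T}" by simp
      then have G: "(U t, y t) \<in> gradient_graph \<Omega>"
        using closed_sequentially[OF _ z(2) l] by (simp add: gradient_graph_def)
      note H = gradient_graph_H1[OF op G fn_L2_on[OF \<Omega>s] gradient_graph_restrict(1)[OF op G]]
      have "(LINT x|lebesgue_on \<Omega>. grad \<Omega> (u t) x \<bullet> grad \<Omega> h x) = y t \<bullet> class_on \<Omega> (grad \<Omega> h)"
        using class_on_inner[OF \<Omega>s grad_spec(1)[OF H(1)] grad_spec(1)[OF H1h]] H(2) by (simp add: u_def L2_inner_def)
      then show "a (l (u t)) * (LINT x|lebesgue_on \<Omega>. grad \<Omega> (u t) x \<bullet> grad \<Omega> h x) * \<phi> t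
         = (b t * (y t \<bullet> class_on \<Omega> (grad \<Omega> h))) * \<phi> t" by (simp add: b_def u_def)
    qed
    have m: "(\<lambda>t. (b t * (y t \<bullet> class_on \<Omega> (grad \<Omega> h))) * \<phi> t) \<in> borel_measurable (lebesgue_on {0<..<T})"
    proof -
      have "(\<lambda>t. y t \<bullet> class_on \<Omega> (grad \<Omega> h)) \<in> borel_measurable (lebesgue_on {0<..<T})"
      proof (rule borel_measurable_LIMSEQ_AE)
        show "(\<lambda>t. snd (z k t) \<bullet> class_on \<Omega> (grad \<Omega> h)) \<in> borel_measurable (lebesgue_on {0<..<T})" for k
          by (intro continuous_imp_measurable_on_sets_lebesgue continuous_intros continuous_on_subset[OF z(1)]) auto
        show "AE t in lebesgue_on {0<..<T}. (\<lambda>k. snd (z k t) \<bullet> class_on \<Omega> (grad \<Omega> h)) \<longlonglongrightarrow> y t \<bullet> class_on \<Omega> (grad \<Omega> h)"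
          using lim'
        proof eventually_elim
          fix t assume "(\<lambda>k. z k t) \<longlonglongrightarrow> (U t, y t)"
          from tendsto_snd[OF this]
          show "(\<lambda>k. snd (z k t) \<bullet> class_on \<Omega> (grad \<Omega> h)) \<longlonglongrightarrow> y t \<bullet> class_on \<Omega> (grad \<Omega> h)"
            by (intro tendsto_inner tendsto_const) simp
        qed
      qed simp
      moreover have "b \<in> borel_measurable (lebesgue_on {0<..<T})"
        by (rule continuous_imp_measurable_on_sets_lebesgue[OF continuous_on_subset[OF cb]]) auto
      moreover have "\<phi> \<in> borel_measurable (lebesgue_on {0<..<T})"
        by (rule continuous_imp_measurable_on_sets_lebesgue[OF test_function_interval(3)[OF \<phi>]]) simp
      ultimately show ?thesis by (intro borel_measurable_times)
    qed
    have "(LINT t|lebesgue_on {0<..<T}. a (l (u t)) * (LINT x|lebesgue_on \<Omega>. grad \<Omega> (u t) x \<bullet> grad \<Omega> h x) * \<phi> t)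
       = (LINT t|lebesgue_on {0<..<T}. (b t * (y t \<bullet> class_on \<Omega> (grad \<Omega> h))) * \<phi> t)"
    proof (rule integral_cong_AE[OF _ m ae])
      have "AE t in lebesgue_on {0<..<T}. (b t * (y t \<bullet> class_on \<Omega> (grad \<Omega> h))) * \<phi> t =
          a (l (u t)) * (LINT x|lebesgue_on \<Omega>. grad \<Omega> (u t) x \<bullet> grad \<Omega> h x) * \<phi> t"
        using ae by eventually_elim (rule sym)
      from borel_measurable_lebesgue_on_AE[OF m this]
      show "(\<lambda>t. a (l (u t)) * (LINT x|lebesgue_on \<Omega>. grad \<Omega> (u t) x \<bullet> grad \<Omega> h x) * \<phi> t) \<in> borel_measurable (lebesgue_on {0<..<T})"
        by simp
    qed
    then show ?thesis
      using weak_solution_distributional(2)[OF ws f H10_gradient_graph(2)[OF op h] \<phi>]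
      by (simp add: distr_deriv_def regular_distr_def inner_u[OF h] b_def)
  qed
qed

theorem theorem3p1:
  fixes \<Omega> :: "(real^'n) set"
    and \<alpha> M1 M2 m T :: real
    and f a :: "real \<Rightarrow> real"
    and l :: "(real^'n \<Rightarrow> real) \<Rightarrow> real"
    and u0 v0 :: "real^'n \<Rightarrow> real"
  assumes "open \<Omega>" and "connected \<Omega>" and "\<Omega> \<noteq> {}" and "bounded \<Omega>" and "C2_boundary \<Omega>"
    and "\<alpha> > 0" and "M1 > 0" and "M2 > 0" and "m > 0" and "0 < T"
    and "u0 \<in> L2 \<Omega>" and "v0 \<in> L2 \<Omega>"
    and "\<forall>s t. \<bar>f s - f t\<bar> \<le> M1 * \<bar>s - t\<bar>"
    and "\<forall>s t. \<bar>a s - a t\<bar> \<le> M2 * \<bar>s - t\<bar>"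
    and "\<forall>\<xi>. a \<xi> \<ge> m"
    and "continuous_linear_form (L2 \<Omega>) (L2_norm \<Omega>) l"
  shows "\<exists>u v :: real \<Rightarrow> real^'n \<Rightarrow> real.
    u \<in> Bochner_L2 {0<..<T} (H10 \<Omega>) (H1_norm \<Omega>) \<inter> continuous_into {0..<T} (L2 \<Omega>) (L2_norm \<Omega>) \<and>
    v \<in> Bochner_L2 {0<..<T} (H10 \<Omega>) (H1_norm \<Omega>) \<inter> continuous_into {0..<T} (L2 \<Omega>) (L2_norm \<Omega>) \<and>
    (\<exists>u'\<in>Bochner_L2 {0<..<T} (Hm1 \<Omega>) (Hm1_norm \<Omega>). weak_time_deriv {0<..<T} \<Omega> u u') \<and>
    (\<exists>v'\<in>Bochner_L2 {0<..<T} (Hm1 \<Omega>) (Hm1_norm \<Omega>). weak_time_deriv {0<..<T} \<Omega> v v') \<and>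
    (\<forall>h1\<in>H10 \<Omega>. \<forall>\<phi>\<in>test_functions {0<..<T}.
       distr_deriv (regular_distr {0<..<T} (\<lambda>t. L2_inner \<Omega> (u t) h1)) \<phi>
       + regular_distr {0<..<T}
           (\<lambda>t. a (l (u t)) * (LINT x|lebesgue_on \<Omega>. grad \<Omega> (u t) x \<bullet> grad \<Omega> h1 x)) \<phi>
       = regular_distr {0<..<T}
           (\<lambda>t. - (LINT x|lebesgue_on \<Omega>. f (u t x - v t x) * h1 x)
                + (LINT x|lebesgue_on \<Omega>. \<alpha> * (u t x - v t x) * h1 x)) \<phi>) \<and>
    (\<forall>h2\<in>H10 \<Omega>. \<forall>\<phi>\<in>test_functions {0<..<T}.
       distr_deriv (regular_distr {0<..<T} (\<lambda>t. L2_inner \<Omega> (v t) h2)) \<phi>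
       + regular_distr {0<..<T}
           (\<lambda>t. a (l (v t)) * (LINT x|lebesgue_on \<Omega>. grad \<Omega> (v t) x \<bullet> grad \<Omega> h2 x)) \<phi>
       = regular_distr {0<..<T}
           (\<lambda>t. (LINT x|lebesgue_on \<Omega>. f (u t x - v t x) * h2 x)
                - (LINT x|lebesgue_on \<Omega>. \<alpha> * (u t x - v t x) * h2 x)) \<phi>) \<and>
    (AE x in lebesgue_on \<Omega>. u 0 x = u0 x) \<and>
    (AE x in lebesgue_on \<Omega>. v 0 x = v0 x)"
proof -
  note op = \<open>open \<Omega>\<close>
  note \<Omega>s = \<Omega>_sets[OF op]
  have f: "\<bar>f s - f t\<bar> \<le> M1 * \<bar>s - t\<bar>" for s t using assms(13) by blast
  define F where "F = (\<lambda>s. \<alpha> * s - f s)"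
  have F: "\<bar>F s - F t\<bar> \<le> (\<alpha> + M1) * \<bar>s - t\<bar>" for s t
  proof -
    have "\<bar>F s - F t\<bar> = \<bar>\<alpha> * (s - t) - (f s - f t)\<bar>" by (simp add: F_def algebra_simps)
    also have "\<dots> \<le> \<bar>\<alpha> * (s - t)\<bar> + \<bar>f s - f t\<bar>" by (rule abs_triangle_ineq4)
    also have "\<dots> \<le> \<alpha> * \<bar>s - t\<bar> + M1 * \<bar>s - t\<bar>" using f[of s t] \<open>\<alpha> > 0\<close> by (simp add: abs_mult)
    finally show ?thesis by (simp add: distrib_right)
  qed
  define N where "N = (\<lambda>W :: (real^'n, real) l2. class_on \<Omega> (\<lambda>x. F (fn W x)))"
  have N_lip: "norm (N W - N W') \<le> (\<alpha> + M1) * norm (W - W')" for W W'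
    unfolding N_def by (rule nemytskii_lipschitz[OF \<Omega>s \<open>bounded \<Omega>\<close> _ F]) (use assms in simp)
  obtain \<Lambda> where \<Lambda>: "\<Lambda> \<ge> 0" "bounded_linear (\<lambda>U. l (fn U))" "\<And>U. \<bar>l (fn U)\<bar> \<le> \<Lambda> * norm U"
    using bounded_linear_l_fn[OF \<Omega>s assms(16)] by blast
  have sys: "nonlocal_system (gradient_graph \<Omega>) (\<lambda>U. l (fn U)) \<Lambda> a N m M2 (\<alpha> + M1) T"
  proof (intro nonlocal_system.intro closed_graph.intro nonlocal_system_axioms.intro)
    show "bounded_linear (\<lambda>U. l (fn U))" by (rule \<Lambda>(2))
    show "subspace (gradient_graph \<Omega>)" by (rule subspace_gradient_graph)
    show "closed (gradient_graph \<Omega>)" by (simp add: gradient_graph_def)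
    show "\<bar>l (fn U)\<bar> \<le> \<Lambda> * norm U" for U by (rule \<Lambda>(3))
    show "\<bar>a s - a t\<bar> \<le> M2 * \<bar>s - t\<bar>" for s t using assms(14) by blast
    show "norm (N U - N W) \<le> (\<alpha> + M1) * norm (U - W)" for U W by (rule N_lip)
  qed (use assms(6-10,15) \<Lambda>(1) in simp_all)
  interpret nonlocal_system "gradient_graph \<Omega>" "\<lambda>U. l (fn U)" \<Lambda> a N m M2 "\<alpha> + M1" T by (rule sys)
  obtain U V p q where
    wU: "weak_solution U p (\<lambda>t. N (U t - V t))" and wV: "weak_solution V q (\<lambda>t. - N (U t - V t))"
    and init: "U 0 = class_on \<Omega> u0" "V 0 = class_on \<Omega> v0"
    using weak_solution_exists[OF class_on_in_closure[OF op assms(11)] class_on_in_closure[OF op assms(12)]] by blast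
  have cN: "continuous_on {0..T} (\<lambda>t. N (U t - V t))"
  proof -
    have "continuous_on UNIV N"
      using lipschitz_on_continuous_on[of "\<alpha> + M1" UNIV N] N_lip assms by (auto simp: lipschitz_on_def dist_norm)
    moreover have "continuous_on {0..T} (\<lambda>t. U t - V t)"
      using wU wV by (intro continuous_on_diff) (simp_all add: weak_solution_def)
    ultimately show ?thesis by (rule continuous_on_compose2) auto
  qed
  note CU = weak_solution_concrete[OF op sys wU cN] and CV = weak_solution_concrete[OF op sys wV continuous_on_minus[OF cN]]
  have source: "N (U t - V t) \<bullet> class_on \<Omega> h =
      - (LINT x|lebesgue_on \<Omega>. f (fn (U t) x - fn (V t) x) * h x)
                + (LINT x|lebesgue_on \<Omega>. \<alpha> * (fn (U t) x - fn (V t) x) * h x)" if h: "h \<in> H10 \<Omega>" for t h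
  proof -
    let ?d = "\<lambda>x. fn (U t) x - fn (V t) x"
    have hL: "h \<in> L2 \<Omega>" by (rule H10_gradient_graph(1)[OF op h])
    have dL: "?d \<in> L2 \<Omega>" by (intro L2_diff fn_L2_on \<Omega>s)
    note FL = nemytskii_L2[OF \<Omega>s \<open>bounded \<Omega>\<close> _ F] and fL = nemytskii_L2[OF \<Omega>s \<open>bounded \<Omega>\<close> dL f]
    have "N (U t - V t) = class_on \<Omega> (\<lambda>x. F (?d x))"
      unfolding N_def
      by (rule class_on_cong_lebesgue[OF \<Omega>s _ FL[OF fn_L2_on[OF \<Omega>s]] FL[OF dL]])
        (use fn_diff[of "U t" "V t"] in \<open>auto elim!: eventually_mono\<close>)
    then have "N (U t - V t) \<bullet> class_on \<Omega> h = (LINT x|lebesgue_on \<Omega>. F (?d x) * h x)"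
      by (simp add: class_on_inner[OF \<Omega>s FL[OF dL] hL] L2_inner_def)
    also have "\<dots> = (LINT x|lebesgue_on \<Omega>. \<alpha> * ?d x * h x - f (?d x) * h x)"
      by (simp add: F_def algebra_simps)
    also have "\<dots> = (LINT x|lebesgue_on \<Omega>. \<alpha> * ?d x * h x) - (LINT x|lebesgue_on \<Omega>. f (?d x) * h x)"
      using L2_inner_integrable[OF L2_scaleR[OF dL, of \<alpha>] hL] L2_inner_integrable[OF fL hL]
      by (intro Bochner_Integration.integral_diff) simp_all
    finally show ?thesis by simp
  qed
  have iU: "AE x in lebesgue_on \<Omega>. fn (U 0) x = u0 x" and iV: "AE x in lebesgue_on \<Omega>. fn (V 0) x = v0 x"
    unfolding init by (intro fn_class_on \<Omega>s assms)+
  show ?thesis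
  proof (rule exI[of _ "\<lambda>t. fn (U t)"], rule exI[of _ "\<lambda>t. fn (V t)"],
      intro conjI ballI CU(1,2) CV(1,2) iU iV)
    fix h \<phi> assume h: "h \<in> H10 \<Omega>" and \<phi>: "\<phi> \<in> test_functions {0<..<T}"
    show "distr_deriv (regular_distr {0<..<T} (\<lambda>t. L2_inner \<Omega> (fn (U t)) h)) \<phi>
       + regular_distr {0<..<T}
           (\<lambda>t. a (l (fn (U t))) * (LINT x|lebesgue_on \<Omega>. grad \<Omega> (fn (U t)) x \<bullet> grad \<Omega> h x)) \<phi>
       = regular_distr {0<..<T}
           (\<lambda>t. - (LINT x|lebesgue_on \<Omega>. f (fn (U t) x - fn (V t) x) * h x)
                + (LINT x|lebesgue_on \<Omega>. \<alpha> * (fn (U t) x - fn (V t) x) * h x)) \<phi>"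
      using CU(3)[OF h \<phi>] unfolding source[OF h] by simp
    show "distr_deriv (regular_distr {0<..<T} (\<lambda>t. L2_inner \<Omega> (fn (V t)) h)) \<phi>
       + regular_distr {0<..<T}
           (\<lambda>t. a (l (fn (V t))) * (LINT x|lebesgue_on \<Omega>. grad \<Omega> (fn (V t)) x \<bullet> grad \<Omega> h x)) \<phi>
       = regular_distr {0<..<T}
           (\<lambda>t. (LINT x|lebesgue_on \<Omega>. f (fn (U t) x - fn (V t) x) * h x)
                - (LINT x|lebesgue_on \<Omega>. \<alpha> * (fn (U t) x - fn (V t) x) * h x)) \<phi>"
      using CV(3)[OF h \<phi>] unfolding inner_minus_left source[OF h] by simp
  qed
qed

end
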